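(* Let $d\ge 2$ and let $(\mathbf{X}_i)_{i\ge 1}$ be i.i.d. random vectors in $\mathbb{R}^d$, with generic copy $\mathbf{X}\in \mathrm{RV}(\alpha,\mu)$ (multivariate regularly varying with index $\alpha$ and limit measure $\mu$), where $\alpha>1$ and $\mathbf{E}\,\mathbf{X}=\mathbf{0}$. Assume that the angular measure $\varsigma$ of $\mathbf{X}$ is absolutely continuous with respect to the Lebesgue (surface) measure on the unit sphere $\mathbb{S}^{d-1}$ and is positive on the unit sphere. Let $A\subset\mathbb{R}^d$ be a compact convex set with non-empty interior $A^\circ$ such that $\mathbf{0}\notin A$ and $\mathbf{P}(\mathbf{X}_1\in A^\circ)>0$. Put $\mathbf{S}_k=\sum_{i=1}^k\mathbf{X}_i$ and $$r^*=\sup_{\boldsymbol{\varphi}\in\Xi(A)}\frac{U_{\boldsymbol{\varphi}}}{L_{\boldsymbol{\varphi}}}.$$ Then $$\lim_{n\to\infty}\frac{1}{(\log n)^2}\log \mathbf{P}\Big(k^{-1}\mathbf{S}_k\in A\ \text{ for all } k=1,2,\ldots,n\Big)=-\frac{\alpha-1}{2\log r^*}.$$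
   Context: $\mathbf{X}\in\mathrm{RV}(\alpha,\mu)$ means: there exist an increasing sequence of positive reals $a_n\uparrow\infty$ and a non-null Radon measure $\mu$ on the Borel sets of $\bar{\mathbb{R}}^d\setminus\{\mathbf{0}\}$ (where $\bar{\mathbb{R}}=[-\infty,\infty]$) with $\mu(\bar{\mathbb{R}}^d\setminus\mathbb{R}^d)=0$, such that $\lim_{n\to\infty} n\,\mathbf{P}(a_n^{-1}\mathbf{X}\in B)=\mu(B)$ for every Borel $B\subset\bar{\mathbb{R}}^d\setminus\{\mathbf{0}\}$ with $\mu(\partial B)=0$ and $\mathbf{0}\notin\overline{B}$; the measure $\mu$ then satisfies $\mu(uB)=u^{-\alpha}\mu(B)$ for all $u>0$ and all Borel $B$, where $uB=\{u\mathbf{x}:\mathbf{x}\in B\}$. Angular (spectral) measure: with $\|\cdot\|$ the Euclidean norm and $\mathbb{S}^{d-1}=\{\mathbf{x}\in\mathbb{R}^d:\|\mathbf{x}\|=1\}$, in the polar coordinates $\mathbf{x}\mapsto(\|\mathbf{x}\|,\mathbf{x}/\|\mathbf{x}\|)$ the measure $\mu$ becomes the product $\nu_\alpha\otimes\varsigma$ on $(0,\infty)\times\mathbb{S}^{d-1}$, where $\nu_\alpha(x,\infty)=x^{-\alpha}$ for $x>0$ and $\varsigma$ is a Radon measure on $\mathbb{S}^{d-1}$, the angular measure. "Positive on the unit sphere" means that $\varsigma$ gives positive mass to every non-empty relatively open subset of $\mathbb{S}^{d-1}$. For $A$ as in the claim: $\Xi(A)=\{\mathbf{x}/\|\mathbf{x}\|:\mathbf{x}\in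 A\}\subset\mathbb{S}^{d-1}$, and for $\boldsymbol{\varphi}\in\Xi(A)$, $L_{\boldsymbol{\varphi}}=\inf\{r>0:r\boldsymbol{\varphi}\in A\}$ and $U_{\boldsymbol{\varphi}}=\sup\{r>0:r\boldsymbol{\varphi}\in A\}$. *)

theory Defs
  imports "HOL-Probability.Probability"
begin

(* For the spaces used here (open subsets of ereal^'d, spheres), which are locally compact with a
   countable base, a Borel measure that is finite on compact sets is Radon. *)
definition radon_measure_on :: "'a::topological_space set \<Rightarrow> 'a measure \<Rightarrow> bool" where
  "radon_measure_on S \<mu> \<longleftrightarrow>
     sets \<mu> = sets (restrict_space borel S) \<and>
     (\<forall>K\<subseteq>S. compact K \<longrightarrow> emeasure \<mu> K < \<infinity>)"

definition ext_vec :: "real^'d \<Rightarrow> ereal^'d" where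
  "ext_vec x = (\<chi> i. ereal (x $ i))"

definition ext_scale :: "real \<Rightarrow> ereal^'d \<Rightarrow> ereal^'d" where
  "ext_scale u y = (\<chi> i. ereal u * y $ i)"

(* The index \<alpha> is determined by the homogeneity of the limit measure, which is why the scaling
   property is part of the definition.  Since 0 is not in the closure of B, the frontier of B is the
   same whether taken in ereal^'d or in ereal^'d without the origin. *)
definition regularly_varying ::
    "'w measure \<Rightarrow> ('w \<Rightarrow> real^'d) \<Rightarrow> real \<Rightarrow> (ereal^'d) measure \<Rightarrow> bool" where
  "regularly_varying M X \<alpha> \<mu> \<longleftrightarrow>
     radon_measure_on (- {0}) \<mu> \<and>
     emeasure \<mu> (space \<mu>) \<noteq> 0 \<and>
     emeasure \<mu> (- range ext_vec) = 0 \<and>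
     (\<exists>a :: nat \<Rightarrow> real.
        incseq a \<and> (\<forall>n. a n > 0) \<and> filterlim a at_top sequentially \<and>
        (\<forall>B \<in> sets borel. 0 \<notin> closure B \<longrightarrow> emeasure \<mu> (frontier B) = 0 \<longrightarrow>
           (\<lambda>n. ennreal (real n * measure M {\<omega> \<in> space M. ext_vec (X \<omega> /\<^sub>R a n) \<in> B}))
             \<longlonglongrightarrow> emeasure \<mu> B)) \<and>
     (\<forall>u>0. \<forall>B \<in> sets \<mu>.
        emeasure \<mu> (ext_scale u ` B) = ennreal (u powr - \<alpha>) * emeasure \<mu> B)"

(* The measure \<nu> is uniquely determined by its tails.  Product form is expressed by evaluating \<mu> on
   the preimage of each measurable C under polar coordinates. *)
definition angular_measure :: "real \<Rightarrow> (ereal^'d) measure \<Rightarrow> (real^'d) measure \<Rightarrow> bool" where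
  "angular_measure \<alpha> \<mu> \<sigma> \<longleftrightarrow>
     radon_measure_on (sphere 0 1) \<sigma> \<and>
     (\<exists>\<nu> :: real measure.
        sets \<nu> = sets (restrict_space borel {0<..}) \<and>
        (\<forall>x>0. emeasure \<nu> {x<..} = ennreal (x powr - \<alpha>)) \<and>
        (\<forall>C \<in> sets (\<nu> \<Otimes>\<^sub>M \<sigma>).
           emeasure \<mu> (ext_vec ` {x. x \<noteq> 0 \<and> (norm x, x /\<^sub>R norm x) \<in> C}) =
           emeasure (\<nu> \<Otimes>\<^sub>M \<sigma>) C))"

(* Surface measure on the unit sphere: the surface area of E is d times the Lebesgue measure of
   the cone of all r *\<^sub>R \<phi> with 0 < r \<le> 1 and \<phi> in E. *)
definition sphere_surface_measure :: "(real^'d) measure" where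
  "sphere_surface_measure =
     scale_measure (of_nat CARD('d))
       (distr (restrict_space lborel (cball 0 1 - {0})) (restrict_space borel (sphere 0 1))
          (\<lambda>x. x /\<^sub>R norm x))"

lemma emeasure_sphere_surface_measure:
  fixes E :: "(real^'d) set"
  assumes "E \<in> sets borel" "E \<subseteq> sphere 0 1"
  shows "emeasure sphere_surface_measure E =
    of_nat CARD('d) * emeasure lborel {r *\<^sub>R \<phi> | r \<phi>. 0 < r \<and> r \<le> 1 \<and> \<phi> \<in> E}"
proof -
  let ?D = "cball 0 1 - {0} :: (real^'d) set"
  have meas: "(\<lambda>x. x /\<^sub>R norm x) \<in>
      restrict_space lborel ?D \<rightarrow>\<^sub>M restrict_space borel (sphere (0::real^'d) 1)"
    by (rule measurable_restrict_space2)
      (auto simp: space_restrict_space intro!: measurable_restrict_space1)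
  have E: "E \<in> sets (restrict_space borel (sphere 0 1))"
    using assms by (subst sets_restrict_space_iff) auto
  have "(\<lambda>x. x /\<^sub>R norm x) -` E \<inter> ?D = {r *\<^sub>R \<phi> | r \<phi>. 0 < r \<and> r \<le> 1 \<and> \<phi> \<in> E}"
  proof (intro set_eqI iffI)
    fix x assume "x \<in> (\<lambda>x. x /\<^sub>R norm x) -` E \<inter> ?D"
    then show "x \<in> {r *\<^sub>R \<phi> | r \<phi>. 0 < r \<and> r \<le> 1 \<and> \<phi> \<in> E}"
      by (auto intro!: exI[of _ "norm x"] exI[of _ "x /\<^sub>R norm x"])
  next
    fix x assume "x \<in> {r *\<^sub>R \<phi> | r \<phi>. 0 < r \<and> r \<le> 1 \<and> \<phi> \<in> E}"
    then obtain r \<phi> where x: "x = r *\<^sub>R \<phi>" "0 < r" "r \<le> 1" "\<phi> \<in> E" by blast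
    moreover have "norm \<phi> = 1" using x assms by auto
    ultimately show "x \<in> (\<lambda>x. x /\<^sub>R norm x) -` E \<inter> ?D" by auto
  qed
  moreover have "emeasure (restrict_space lborel ?D) ((\<lambda>x. x /\<^sub>R norm x) -` E \<inter> ?D) =
      emeasure lborel ((\<lambda>x. x /\<^sub>R norm x) -` E \<inter> ?D)"
    by (rule emeasure_restrict_space) auto
  ultimately show ?thesis
    unfolding sphere_surface_measure_def
    by (simp add: emeasure_distr[OF meas E] space_restrict_space)
qed

definition radial_projection :: "(real^'d) set \<Rightarrow> (real^'d) set" where
  "radial_projection A = (\<lambda>x. x /\<^sub>R norm x) ` A"

definition lower_radius :: "(real^'d) set \<Rightarrow> real^'d \<Rightarrow> real" where
  "lower_radius A \<phi> = Inf {r. r > 0 \<and> r *\<^sub>R \<phi> \<in> A}"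

definition upper_radius :: "(real^'d) set \<Rightarrow> real^'d \<Rightarrow> real" where
  "upper_radius A \<phi> = Sup {r. r > 0 \<and> r *\<^sub>R \<phi> \<in> A}"

definition max_radial_ratio :: "(real^'d) set \<Rightarrow> real" where
  "max_radial_ratio A = (SUP \<phi>\<in>radial_projection A. upper_radius A \<phi> / lower_radius A \<phi>)"

end

theory Submission
  imports Defs
begin

text \<open>
Write $S_k$ for the partial sums and $R > 1$ for the maximal radial ratio of $A$.  The averages
$S_k / k$ can stay in $A$ only if the sums keep moving outwards: if $S$ stood still after time $m$,
then $S_k / k = (m / k) S_m / m$ would slide along a ray towards the origin, and every point of $A$
leaves $A$ once it has been shrunk by a factor larger than $R$.

Upper bound.  Let $r > R$.  The compact set $A$ has positive distance from $s A$ for all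
$s \in [r, r + 1]$ (lemma \<open>radial_gap\<close>), so the sum must deviate by a multiple of $m$ between the
times $m$ and $r m$.  For a centred sum with tails of index \<open>\<alpha>\<close> this has probability at most
$m^{-(q - 1)}$ up to a constant, for all $1 < q < \alpha$: one of the order of $m$ summands has to be
of the order of $m$, because the truncated sum is controlled by an exponential moment
(lemma \<open>maximal_large_deviation\<close>).  The blocks between consecutive times $r^j$ are independent, and
multiplying over $j \le \ln n / \ln r$ gives $\exp (- (q - 1) (\ln n)^2 / (2 \ln r))$ up to factors
that are negligible on this scale.

Lower bound.  Let $\rho < R$.  By convexity some ray has a segment with end points of ratio larger
than $\rho$ in the interior of $A$ (lemma \<open>radial_segment_neighborhood\<close>).  Start near the outer end
$x$ at time $m$, let the average slide inwards until shortly before time $\rho m$, and return to $x$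
by a single jump close to $(\rho - 1) m x$ (lemma \<open>one_jump_block\<close>).  The jump can take place at any
of a fixed fraction of $m$ times, each with probability at least $m^{-q}$ up to a constant, for every
$q > \alpha$, and the other summands contribute little with probability at least one half
(lemma \<open>jump_block_prob\<close>).  Since the errors grow linearly and the scale grows by the factor
$\rho$, the block ends with the same relative precision with which it began, and the construction
can be repeated.

Both halves use regular variation only through power bounds with exponents
arbitrarily close to \<open>\<alpha>\<close>: from above for the tail of the norm, from below for the probability of
balls that move to infinity.  These bounds follow from the limit relation along the norming
sequence; that every direction is charged is the positivity of the angular measure.  The theorem
follows on letting $q$ tend to \<open>\<alpha>\<close> and $r$, $\rho$ tend to $R$.
\<close>

section \<open>The radial geometry of the target set\<close>

lemma radial_section_bounds:
  fixes A :: "(real^'d) set"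
  assumes "compact A" "0 \<notin> A"
  obtains b B where "0 < b" "b \<le> B" "\<And>x. x \<in> A \<Longrightarrow> b \<le> norm x \<and> norm x \<le> B"
proof (cases "A = {}")
  case True
  then show ?thesis using that[of 1 1] by auto
next
  case False
  obtain y where y: "y \<in> A" "\<And>x. x \<in> A \<Longrightarrow> norm y \<le> norm x"
    using continuous_attains_inf[OF assms(1) False, of norm] continuous_on_norm_id by metis
  obtain z where z: "z \<in> A" "\<And>x. x \<in> A \<Longrightarrow> norm x \<le> norm z"
    using continuous_attains_sup[OF assms(1) False, of norm] continuous_on_norm_id by metis
  have "norm y > 0" using y assms(2) by (metis zero_less_norm_iff)
  then show ?thesis using that[of "norm y" "norm z"] y z by blast
qed

context
  fixes A :: "(real^'d) set"
  assumes compact: "compact A" and zero: "0 \<notin> A"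
begin

text \<open>
Both \<open>norm x\<close> and \<open>s * norm x\<close> are radii of points of \<open>A\<close> on the ray through \<open>x\<close>.  All radii lie
between two positive constants, so the infima and suprema in question, including the supremum over
all directions, are those of nonempty bounded sets of reals.
\<close>

lemma radial_ratio_le_max_radial_ratio:
  assumes "x \<in> A" "s *\<^sub>R x \<in> A" "1 \<le> s"
  shows "s \<le> max_radial_ratio A"
proof -
  obtain b B where b: "0 < b" and B: "b \<le> B" and bB: "\<And>x. x \<in> A \<Longrightarrow> b \<le> norm x \<and> norm x \<le> B"
    using radial_section_bounds[OF compact zero] by metis
  let ?S = "\<lambda>\<phi>. {r. r > 0 \<and> r *\<^sub>R \<phi> \<in> A}"
  have S: "b \<le> r \<and> r \<le> B" if "\<phi> \<in> radial_projection A" "r \<in> ?S \<phi>" for \<phi> r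
  proof -
    from that(1) obtain y where "y \<in> A" "\<phi> = y /\<^sub>R norm y" by (auto simp: radial_projection_def)
    then have "norm \<phi> = 1" using zero by (cases "y = 0") auto
    then show ?thesis using bB[of "r *\<^sub>R \<phi>"] that by auto
  qed
  have ne: "?S \<phi> \<noteq> {}" if "\<phi> \<in> radial_projection A" for \<phi>
  proof -
    from that obtain x where x: "x \<in> A" "\<phi> = x /\<^sub>R norm x" by (auto simp: radial_projection_def)
    have "x \<noteq> 0" using x zero by auto
    then have "norm x \<in> ?S \<phi>" using x by simp
    then show ?thesis by blast
  qed
  have lo: "b \<le> lower_radius A \<phi>" if "\<phi> \<in> radial_projection A" for \<phi>
    unfolding lower_radius_def using ne[OF that] S[OF that] by (intro cInf_greatest) blast+
  have up: "upper_radius A \<phi> \<le> B" if "\<phi> \<in> radial_projection A" for \<phi>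
    unfolding upper_radius_def using ne[OF that] S[OF that] by (intro cSup_least) blast+
  have bdd: "bdd_above ((\<lambda>\<phi>. upper_radius A \<phi> / lower_radius A \<phi>) ` radial_projection A)"
  proof (rule bdd_aboveI2)
    fix \<phi> assume "\<phi> \<in> radial_projection A"
    then show "upper_radius A \<phi> / lower_radius A \<phi> \<le> B / b"
      using lo[of \<phi>] up[of \<phi>] b B by (intro frac_le) auto
  qed
  let ?\<phi> = "x /\<^sub>R norm x"
  have x0: "norm x > 0" using assms(1) zero by auto
  have \<phi>: "?\<phi> \<in> radial_projection A" using assms(1) by (auto simp: radial_projection_def)
  have "bdd_below (?S ?\<phi>)" "bdd_above (?S ?\<phi>)"
    using S[OF \<phi>] unfolding bdd_below_def bdd_above_def by blast+
  moreover have "norm x \<in> ?S ?\<phi>" "s * norm x \<in> ?S ?\<phi>"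
    using x0 assms by (auto simp: divide_inverse[symmetric])
  ultimately have "lower_radius A ?\<phi> \<le> norm x" "s * norm x \<le> upper_radius A ?\<phi>"
    unfolding lower_radius_def upper_radius_def by (auto intro: cInf_lower cSup_upper)
  then have "s \<le> upper_radius A ?\<phi> / lower_radius A ?\<phi>"
    using lo[OF \<phi>] b order_trans[OF mult_left_mono[of "lower_radius A ?\<phi>" "norm x" s]] assms(3)
    by (simp add: pos_le_divide_eq)
  also have "\<dots> \<le> max_radial_ratio A"
    unfolding max_radial_ratio_def by (rule cSUP_upper[OF \<phi> bdd])
  finally show ?thesis .
qed

text \<open>
On a ray whose ratio exceeds \<open>\<rho>\<close>, take radii close enough to the supremum and to the infimum.
\<close>

lemma less_max_radial_ratioE:
  assumes "A \<noteq> {}" "1 \<le> \<rho>" "\<rho> < max_radial_ratio A"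
  obtains x s where "x \<in> A" "s *\<^sub>R x \<in> A" "\<rho> < s"
proof -
  obtain b B where b: "0 < b" and B: "b \<le> B" and bB: "\<And>x. x \<in> A \<Longrightarrow> b \<le> norm x \<and> norm x \<le> B"
    using radial_section_bounds[OF compact zero] by metis
  have "radial_projection A \<noteq> {}" using assms(1) by (auto simp: radial_projection_def)
  then obtain \<phi> where \<phi>: "\<phi> \<in> radial_projection A" "\<rho> < upper_radius A \<phi> / lower_radius A \<phi>"
    using cSUP_least[of "radial_projection A" "\<lambda>\<phi>. upper_radius A \<phi> / lower_radius A \<phi>" \<rho>] assms(3)
    unfolding max_radial_ratio_def by fastforce
  let ?S = "{r. r > 0 \<and> r *\<^sub>R \<phi> \<in> A}"
  obtain y where y: "y \<in> A" "\<phi> = y /\<^sub>R norm y" using \<phi>(1) by (auto simp: radial_projection_def)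
  have n\<phi>: "norm \<phi> = 1" using y zero by (cases "y = 0") auto
  have S: "b \<le> r" if "r \<in> ?S" for r
    using bB[of "r *\<^sub>R \<phi>"] that n\<phi> by auto
  have "y \<noteq> 0" using y zero by auto
  then have ne: "?S \<noteq> {}" using y by (auto intro!: exI[of _ "norm y"])
  have lo: "0 < lower_radius A \<phi>"
    using b cInf_greatest[of ?S b] ne S unfolding lower_radius_def by fastforce
  have "\<rho> * lower_radius A \<phi> < upper_radius A \<phi>"
    using \<phi>(2) lo by (simp add: field_simps)
  then obtain r2 where r2: "r2 \<in> ?S" "\<rho> * lower_radius A \<phi> < r2"
    unfolding upper_radius_def using ne by (elim less_cSupE)
  have "lower_radius A \<phi> < r2 / \<rho>" using r2 assms(2) by (simp add: field_simps)
  then obtain r1 where r1: "r1 \<in> ?S" "r1 < r2 / \<rho>"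
    unfolding lower_radius_def using cInf_lessD[OF ne] by blast
  show ?thesis
  proof (rule that[of "r1 *\<^sub>R \<phi>" "r2 / r1"])
    show "r1 *\<^sub>R \<phi> \<in> A" using r1 by auto
    show "(r2 / r1) *\<^sub>R r1 *\<^sub>R \<phi> \<in> A" using r1 r2 by auto
    show "\<rho> < r2 / r1" using r1 assms(2) by (auto simp: field_simps)
  qed
qed

lemma max_radial_ratio_gt_1:
  assumes "interior A \<noteq> {}"
  shows "1 < max_radial_ratio A"
proof -
  obtain x e where x: "0 < e" "cball x e \<subseteq> A"
    using assms by (metis all_not_in_conv mem_interior_cball)
  have "x \<in> A" using x by auto
  then have x0: "norm x > 0" using zero by auto
  have "(1 + e / norm x) *\<^sub>R x \<in> cball x e"
    using x0 x(1) by (simp add: dist_norm algebra_simps)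
  then have "(1 + e / norm x) *\<^sub>R x \<in> A" using x by blast
  then have "1 + e / norm x \<le> max_radial_ratio A"
    using radial_ratio_le_max_radial_ratio[OF \<open>x \<in> A\<close>] x0 x(1) by simp
  moreover have "0 < e / norm x" using x0 x(1) by simp
  ultimately show ?thesis by linarith
qed

text \<open>
A pair $y$, $r y$ of points of \<open>A\<close> with $r > \rho$ may lie on the boundary, for instance on a face of
\<open>A\<close> whose span contains the origin.  Pulling both points towards an interior point $z$ makes them
interior, and they remain on a common ray if the weights are matched: with
$r' = r / (1 + s (r - 1))$ and $t = r' s$ one has
$(1 - t) r y + t z = r' ((1 - s) y + s z)$.  The new ratio $r'$ tends to $r$ as $s$ tends to $0$.
\<close>

lemma interior_radial_pair:
  assumes "convex A" "interior A \<noteq> {}" "1 < \<rho>" "\<rho> < max_radial_ratio A"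
  obtains x where "x \<in> interior A" "\<rho> *\<^sub>R x \<in> interior A"
proof -
  have "A \<noteq> {}" using assms(2) by auto
  then obtain y r where y: "y \<in> A" "r *\<^sub>R y \<in> A" "\<rho> < r"
    using less_max_radial_ratioE[of \<rho>] assms by (metis less_imp_le)
  obtain z where z: "z \<in> interior A" using assms(2) by auto
  have "((\<lambda>s. r / (1 + s * (r - 1))) \<longlongrightarrow> r / (1 + 0 * (r - 1))) (at_right 0)"
    by (intro tendsto_intros) auto
  then have "eventually (\<lambda>s. \<rho> < r / (1 + s * (r - 1))) (at_right 0)"
    using y(3) by (simp add: order_tendstoD(1))
  moreover have "eventually (\<lambda>s::real. s \<in> {0<..<1}) (at_right 0)"
    by (rule eventually_at_right_real) simp
  ultimately have "eventually (\<lambda>s. s \<in> {0<..<1} \<and> \<rho> < r / (1 + s * (r - 1))) (at_right 0)"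
    by (simp add: eventually_conj_iff)
  then obtain s where s: "0 < s" "s < 1" "\<rho> < r / (1 + s * (r - 1))"
    using eventually_happens[of _ "at_right (0::real)"] by auto
  define r' where "r' = r / (1 + s * (r - 1))"
  have pos: "1 + s * (r - 1) > 0" using s y(3) assms(3) by (smt (verit) mult_pos_pos)
  have r': "r' * (1 + s * (r - 1)) = r" unfolding r'_def using pos by simp
  define t where "t = r' * s"
  have t: "0 < t" unfolding t_def r'_def using pos s y(3) assms(3) by simp
  have "t < 1"
  proof -
    have "r * s < 1 + s * (r - 1)" using s(2) by (simp add: algebra_simps)
    then show ?thesis unfolding t_def r'_def using pos by (simp add: field_simps)
  qed
  define u where "u = y - s *\<^sub>R (y - z)"
  have u: "u \<in> interior A"
    unfolding u_def by (rule mem_interior_convex_shrink) (use assms(1) z y s in auto)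
  have "r *\<^sub>R y - t *\<^sub>R (r *\<^sub>R y - z) \<in> interior A"
    by (rule mem_interior_convex_shrink) (use assms(1) z y t \<open>t < 1\<close> in auto)
  moreover have "r *\<^sub>R y - t *\<^sub>R (r *\<^sub>R y - z) = r' *\<^sub>R u"
  proof -
    have "r - t * r = r' * (1 + s * (r - 1)) - r' * s * r" unfolding r' by (simp add: t_def)
    also have "\<dots> = r' * (1 - s)" by (simp add: algebra_simps)
    finally have "r - t * r = r' * (1 - s)" .
    then have "(r - t * r) *\<^sub>R y = (r' * (1 - s)) *\<^sub>R y" by simp
    then show ?thesis unfolding u_def t_def by (simp add: algebra_simps)
  qed
  ultimately have r'u: "r' *\<^sub>R u \<in> interior A" by simp
  have "\<rho> *\<^sub>R u \<in> closed_segment u (r' *\<^sub>R u)"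
  proof -
    have "\<rho> < r'" using s(3) r'_def by simp
    then have "1 < r'" using assms(3) by simp
    have "(1 - (\<rho> - 1) / (r' - 1)) + (\<rho> - 1) / (r' - 1) * r' = \<rho>"
      using \<open>1 < r'\<close> by (simp add: divide_simps) (simp add: algebra_simps)
    then have "\<rho> *\<^sub>R u = (1 - (\<rho> - 1) / (r' - 1)) *\<^sub>R u + ((\<rho> - 1) / (r' - 1)) *\<^sub>R (r' *\<^sub>R u)"
      by (metis scaleR_add_left scaleR_scaleR)
    then show ?thesis unfolding closed_segment_def
      using \<open>\<rho> < r'\<close> assms(3) by (auto intro!: exI[of _ "(\<rho> - 1) / (r' - 1)"])
  qed
  then have "\<rho> *\<^sub>R u \<in> interior A"
    using convex_interior[OF assms(1)] u r'u by (metis closed_segment_subset subset_eq)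
  then show ?thesis using that u by blast
qed

text \<open>
A displacement \<open>h\<close> that keeps both end points of the segment in \<open>A\<close> keeps the whole segment in \<open>A\<close>,
by convexity, so one radius serves for all its points.
\<close>

lemma radial_segment_neighborhood:
  assumes "convex A" "interior A \<noteq> {}" "1 < \<rho>" "\<rho> < max_radial_ratio A"
  obtains x e where "0 < e" "\<And>s. 1 / \<rho> \<le> s \<Longrightarrow> s \<le> 1 \<Longrightarrow> cball (s *\<^sub>R x) e \<subseteq> A"
proof -
  obtain u where u: "u \<in> interior A" "\<rho> *\<^sub>R u \<in> interior A"
    using interior_radial_pair[OF assms] by metis
  obtain e1 where e1: "0 < e1" "cball u e1 \<subseteq> A"
    using u(1) mem_interior_cball by blast
  obtain e2 where e2: "0 < e2" "cball (\<rho> *\<^sub>R u) e2 \<subseteq> A"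
    using u(2) mem_interior_cball by blast
  define e where "e = min e1 e2"
  show ?thesis
  proof (rule that[of e "\<rho> *\<^sub>R u"])
    show "0 < e" using e1 e2 by (simp add: e_def)
    fix s assume s: "1 / \<rho> \<le> s" "s \<le> 1"
    show "cball (s *\<^sub>R \<rho> *\<^sub>R u) e \<subseteq> A"
    proof
      fix p assume p: "p \<in> cball (s *\<^sub>R \<rho> *\<^sub>R u) e"
      define h where "h = p - s *\<^sub>R \<rho> *\<^sub>R u"
      have h: "norm h \<le> e" using p by (simp add: h_def dist_norm norm_minus_commute)
      have a: "u + h \<in> A" "\<rho> *\<^sub>R u + h \<in> A"
        using e1 e2 h by (auto simp: e_def dist_norm subset_iff)
      define l where "l = (s * \<rho> - 1) / (\<rho> - 1)"
      have l: "0 \<le> l" "l \<le> 1"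
        using s assms(3) by (auto simp: l_def field_simps)
      have lr: "(1 - l) + l * \<rho> = s * \<rho>"
        using assms(3) by (simp add: l_def divide_simps) (simp add: algebra_simps)
      have "(1 - l) *\<^sub>R (u + h) + l *\<^sub>R (\<rho> *\<^sub>R u + h) = ((1 - l) + l * \<rho>) *\<^sub>R u + h"
        by (simp add: algebra_simps)
      also have "\<dots> = p" unfolding lr by (simp add: h_def)
      finally show "p \<in> A"
        using convexD_alt[OF assms(1) a l] by simp
    qed
  qed
qed

text \<open>
The union of the sets $s A$ over the compact range of $s$ is compact, and it does not meet \<open>A\<close>
because a common point would exhibit a radial ratio of at least $r$.
\<close>

lemma radial_gap:
  assumes "max_radial_ratio A < r" "1 < r" "r \<le> r'"
  obtains e where "0 < e" "\<And>x y s. x \<in> A \<Longrightarrow> y \<in> A \<Longrightarrow> r \<le> s \<Longrightarrow> s \<le> r' \<Longrightarrow> e \<le> norm (s *\<^sub>R y - x)"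
proof (cases "A = {}")
  case True
  then show ?thesis using that[of 1] by auto
next
  case False
  define K where "K = (\<lambda>(s, y). s *\<^sub>R y) ` ({r..r'} \<times> A)"
  have "compact K" unfolding K_def
    by (intro compact_continuous_image compact_Times compact)
       (auto simp: case_prod_beta intro!: continuous_intros)
  moreover have "A \<inter> K = {}"
  proof -
    have "False" if "y \<in> A" "s *\<^sub>R y \<in> A" "r \<le> s" for y s
      using radial_ratio_le_max_radial_ratio[of y s] that assms by auto
    then show ?thesis unfolding K_def by auto
  qed
  ultimately obtain e where e: "0 < e" "\<And>x y. x \<in> A \<Longrightarrow> y \<in> K \<Longrightarrow> e \<le> dist x y"
    using separate_compact_closed[OF compact, of K] compact_imp_closed by metis
  show ?thesis
  proof (rule that[OF e(1)])
    fix x y s assume *: "x \<in> A" "y \<in> A" "r \<le> s" "s \<le> r'"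
    then have "s *\<^sub>R y \<in> K" unfolding K_def by force
    then show "e \<le> norm (s *\<^sub>R y - x)" using e(2)[OF *(1)] by (metis dist_norm dist_commute)
  qed
qed

end

section \<open>Large deviations of centred sums by truncation\<close>

text \<open>
The case $p = 2$ is a second-order Taylor bound; lower powers are admissible because the remainder
is at most linear for large negative arguments.  This form serves variables with infinite
variance, of which only a moment of some order $p > 1$ is at hand.
\<close>

lemma exp_le_linear_plus_powr:
  fixes u p :: real
  assumes "1 \<le> p" "p \<le> 2"
  shows "exp u \<le> 1 + u + \<bar>u\<bar> powr p * exp (max u 0)"
proof -
  have sq: "u\<^sup>2 \<le> \<bar>u\<bar> powr p" if "\<bar>u\<bar> \<le> 1"
  proof (cases "u = 0")
    case False
    have "\<bar>u\<bar> powr 2 \<le> \<bar>u\<bar> powr p" using False that assms by (intro powr_mono') auto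
    then show ?thesis using False by simp
  qed (use assms in simp)
  consider "u \<le> -1" | "-1 \<le> u" "u \<le> 0" | "0 \<le> u" "u \<le> 1" | "1 \<le> u" by linarith
  then show ?thesis
  proof cases
    case 1
    have "\<bar>u\<bar> powr 1 \<le> \<bar>u\<bar> powr p" using 1 assms by (intro powr_mono) auto
    moreover have "exp u \<le> 1" "\<bar>u\<bar> powr p * exp (max u 0) = \<bar>u\<bar> powr p" "\<bar>u\<bar> powr 1 = - u"
      using 1 by simp_all
    ultimately show ?thesis by linarith
  next
    case 2
    define x where "x = - u"
    have x: "0 \<le> x" using 2 by (simp add: x_def)
    \<comment> \<open>Equivalently, the product of \<open>exp x\<close> and $1 - x + x^2$ is at least $1$ for $x = - u$.\<close>
    have "1 \<le> 1 + x\<^sup>2 / 2 + x ^ 3 / 2 + x ^ 4 / 2" using x by simp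
    also have "\<dots> = (1 - x + x\<^sup>2) * (1 + x + x\<^sup>2 / 2)"
      by (simp add: field_simps power2_eq_square power3_eq_cube power4_eq_xxxx)
    also have "\<dots> \<le> (1 - x + x\<^sup>2) * exp x"
    proof (intro mult_left_mono)
      show "1 + x + x\<^sup>2 / 2 \<le> exp x" using exp_lower_Taylor_quadratic[OF x] by simp
      have "1 - x + x\<^sup>2 = (1 - x / 2)\<^sup>2 + 3 / 4 * x\<^sup>2" by (simp add: power2_eq_square algebra_simps)
      then show "0 \<le> 1 - x + x\<^sup>2" by simp
    qed
    finally have "exp u \<le> 1 + u + u\<^sup>2"
      by (simp add: x_def exp_minus field_simps)
    then show ?thesis using sq 2 by simp
  next
    case 3
    have "exp u \<le> 1 + u + u\<^sup>2" using exp_bound[of u] 3 by simp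
    also have "u\<^sup>2 \<le> \<bar>u\<bar> powr p * 1" using sq 3 by simp
    also have "\<bar>u\<bar> powr p * 1 \<le> \<bar>u\<bar> powr p * exp (max u 0)"
      by (intro mult_left_mono) auto
    finally show ?thesis by simp
  next
    case 4
    have "1 * exp u \<le> \<bar>u\<bar> powr p * exp (max u 0)"
      using 4 assms by (intro mult_mono) (auto intro: ge_one_powr_ge_zero)
    then show ?thesis using 4 by linarith
  qed
qed

text \<open>
Only exponential moments of the variables restricted to the event $Y_i \le y$ occur.  Restricting
does no harm to the linear term: the bound $1 + l Y_i + \ldots$ is nonnegative where the
restricted exponential vanishes, so it is integrated over the whole space, where the mean of $Y_i$
is zero.
\<close>

lemma (in prob_space) truncated_chernoff:
  fixes Y :: "'i \<Rightarrow> 'a \<Rightarrow> real"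
  assumes "finite I" and indep: "indep_vars (\<lambda>_. borel) Y I"
    and int: "\<And>i. i \<in> I \<Longrightarrow> integrable M (Y i)" and zero: "\<And>i. i \<in> I \<Longrightarrow> expectation (Y i) = 0"
    and intp: "\<And>i. i \<in> I \<Longrightarrow> integrable M (\<lambda>\<omega>. \<bar>Y i \<omega>\<bar> powr p)"
    and B: "\<And>i. i \<in> I \<Longrightarrow> expectation (\<lambda>\<omega>. \<bar>Y i \<omega>\<bar> powr p) \<le> B"
    and p: "1 \<le> p" "p \<le> 2" and l: "0 \<le> l" and y: "0 \<le> y"
  shows "prob {\<omega> \<in> space M. x \<le> (\<Sum>i\<in>I. Y i \<omega>) \<and> (\<forall>i\<in>I. Y i \<omega> \<le> y)}
    \<le> exp (- l * x + card I * (B * l powr p * exp (l * y)))"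
proof -
  have rv[measurable]: "i \<in> I \<Longrightarrow> Y i \<in> borel_measurable M" for i
    using indep by (auto simp: indep_vars_def)
  define Z where "Z i \<omega> = ennreal (exp (l * Y i \<omega>) * indicator {..y} (Y i \<omega>))" for i \<omega>
  have indepZ: "indep_vars (\<lambda>_. borel) Z I"
    unfolding Z_def by (rule indep_vars_compose2[OF indep]) simp
  have Z: "(\<integral>\<^sup>+\<omega>. Z i \<omega> \<partial>M) \<le> ennreal (exp (B * l powr p * exp (l * y)))" if i: "i \<in> I" for i
  proof -
    let ?g = "\<lambda>\<omega>. 1 + l * Y i \<omega> + l powr p * exp (l * y) * \<bar>Y i \<omega>\<bar> powr p"
    have pw: "exp (l * Y i \<omega>) * indicator {..y} (Y i \<omega>) \<le> ?g \<omega>" for \<omega>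
    proof (cases "Y i \<omega> \<le> y")
      case True
      have "exp (l * Y i \<omega>) \<le> 1 + l * Y i \<omega> + \<bar>l * Y i \<omega>\<bar> powr p * exp (max (l * Y i \<omega>) 0)"
        by (rule exp_le_linear_plus_powr[OF p])
      also have "\<dots> \<le> 1 + l * Y i \<omega> + \<bar>l * Y i \<omega>\<bar> powr p * exp (l * y)"
        using True l y by (intro add_left_mono mult_left_mono) (auto intro: mult_left_mono)
      also have "\<dots> = ?g \<omega>" using l by (simp add: abs_mult powr_mult)
      finally show ?thesis using True by simp
    next
      case False
      then show ?thesis using l y by simp
    qed
    have g0: "0 \<le> ?g \<omega>" for \<omega> using order_trans[OF _ pw[of \<omega>], of 0] by simp
    have ig: "integrable M ?g" using int[OF i] intp[OF i] by auto
    have "(\<integral>\<^sup>+\<omega>. Z i \<omega> \<partial>M) \<le> (\<integral>\<^sup>+\<omega>. ennreal (?g \<omega>) \<partial>M)"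
      unfolding Z_def by (intro nn_integral_mono ennreal_leI pw)
    also have "\<dots> = ennreal (expectation ?g)"
      by (rule nn_integral_eq_integral[OF ig]) (simp add: g0)
    also have "expectation ?g = 1 + l powr p * exp (l * y) * expectation (\<lambda>\<omega>. \<bar>Y i \<omega>\<bar> powr p)"
      using int[OF i] intp[OF i] zero[OF i] by (simp add: prob_space)
    also have "\<dots> \<le> 1 + l powr p * exp (l * y) * B"
      using B[OF i] by (intro add_left_mono mult_left_mono) auto
    also have "\<dots> \<le> exp (B * l powr p * exp (l * y))"
      using exp_ge_add_one_self[of "B * l powr p * exp (l * y)"] by (simp add: mult_ac)
    finally show ?thesis by (simp add: ennreal_leI)
  qed
  let ?E = "{\<omega> \<in> space M. x \<le> (\<Sum>i\<in>I. Y i \<omega>) \<and> (\<forall>i\<in>I. Y i \<omega> \<le> y)}"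
  have E: "?E \<in> sets M" using \<open>finite I\<close> by measurable
  have "ennreal (prob ?E) = (\<integral>\<^sup>+\<omega>. indicator ?E \<omega> \<partial>M)"
    using E by (simp add: emeasure_eq_measure)
  also have "\<dots> \<le> (\<integral>\<^sup>+\<omega>. ennreal (exp (- l * x)) * (\<Prod>i\<in>I. Z i \<omega>) \<partial>M)"
  proof (intro nn_integral_mono)
    fix \<omega>
    show "indicator ?E \<omega> \<le> ennreal (exp (- l * x)) * (\<Prod>i\<in>I. Z i \<omega>)"
    proof (cases "\<omega> \<in> ?E")
      case True
      then have "(\<Prod>i\<in>I. Z i \<omega>) = (\<Prod>i\<in>I. ennreal (exp (l * Y i \<omega>)))"
        by (intro prod.cong) (auto simp: Z_def)
      also have "\<dots> = ennreal (exp (l * (\<Sum>i\<in>I. Y i \<omega>)))"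
        using \<open>finite I\<close> by (simp add: prod_ennreal exp_sum sum_distrib_left)
      finally have "ennreal (exp (- l * x)) * (\<Prod>i\<in>I. Z i \<omega>) = ennreal (exp (- l * x + l * (\<Sum>i\<in>I. Y i \<omega>)))"
        unfolding exp_add by (simp add: ennreal_mult)
      moreover have "0 \<le> - l * x + l * (\<Sum>i\<in>I. Y i \<omega>)"
        using True l by (auto simp: mult_left_mono)
      ultimately show ?thesis using True by simp
    qed simp
  qed
  also have "\<dots> = ennreal (exp (- l * x)) * (\<integral>\<^sup>+\<omega>. (\<Prod>i\<in>I. Z i \<omega>) \<partial>M)"
    using indepZ by (intro nn_integral_cmult borel_measurable_prod_ennreal) (auto simp: indep_vars_def)
  also have "\<dots> = ennreal (exp (- l * x)) * (\<Prod>i\<in>I. \<integral>\<^sup>+\<omega>. Z i \<omega> \<partial>M)"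
    using indep_vars_nn_integral[OF \<open>finite I\<close> indepZ] by simp
  also have "\<dots> \<le> ennreal (exp (- l * x)) * (\<Prod>i\<in>I. ennreal (exp (B * l powr p * exp (l * y))))"
  proof (rule mult_left_mono)
    have "(\<Prod>i\<in>K. \<integral>\<^sup>+\<omega>. Z i \<omega> \<partial>M) \<le> (\<Prod>i\<in>K. ennreal (exp (B * l powr p * exp (l * y))))"
      if "finite K" "K \<subseteq> I" for K
      using that
    proof (induction K rule: finite_induct)
      case (insert k K)
      then show ?case using Z[of k] by (simp del: prod_constant) (intro mult_mono, auto)
    qed simp
    then show "(\<Prod>i\<in>I. \<integral>\<^sup>+\<omega>. Z i \<omega> \<partial>M) \<le> (\<Prod>i\<in>I. ennreal (exp (B * l powr p * exp (l * y))))"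
      using \<open>finite I\<close> by blast
  qed simp
  also have "\<dots> = ennreal (exp (- l * x + card I * (B * l powr p * exp (l * y))))"
    unfolding exp_add exp_of_nat_mult by (simp add: ennreal_mult ennreal_power)
  finally show ?thesis by (simp add: ennreal_le_iff)
qed

text \<open>
The moment is dominated by the dyadic series $\sum_j 2^{p (j + 1)} P (U > 2^j)$, whose terms decay
geometrically since $p < q$.
\<close>

lemma (in prob_space) nn_moment_finite_of_tail:
  fixes U :: "'a \<Rightarrow> real"
  assumes [measurable]: "U \<in> borel_measurable M" and U: "\<And>\<omega>. 0 \<le> U \<omega>"
    and tail: "\<And>t. 0 < t \<Longrightarrow> prob {\<omega> \<in> space M. t < U \<omega>} \<le> C * t powr - q"
    and p: "0 < p" "p < q"
  shows "integrable M (\<lambda>\<omega>. U \<omega> powr p)"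
proof -
  let ?b = "\<lambda>j::nat. ennreal (2 powr (p * (real j + 1)))"
  let ?E = "\<lambda>j::nat. {\<omega> \<in> space M. 2 ^ j < U \<omega>}"
  have C: "0 \<le> C" using order_trans[OF measure_nonneg tail[of 1]] by simp
  have pw: "ennreal (U \<omega> powr p) \<le> 1 + (\<Sum>j. ?b j * indicator (?E j) \<omega>)" if \<omega>: "\<omega> \<in> space M" for \<omega>
  proof (cases "U \<omega> \<le> 1")
    case True
    have "U \<omega> powr p \<le> 1 powr p" using True U p by (intro powr_mono2) auto
    then have "ennreal (U \<omega> powr p) \<le> 1" using ennreal_leI[of _ 1] by simp
    then show ?thesis by (rule order_trans) simp
  next
    case False
    obtain n0 where "U \<omega> < 2 ^ n0" using real_arch_pow[of 2 "U \<omega>"] by auto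
    then have ex: "\<exists>n. U \<omega> \<le> 2 ^ n" by (auto intro: less_imp_le)
    define n where "n = (LEAST n. U \<omega> \<le> 2 ^ n)"
    have n: "U \<omega> \<le> 2 ^ n" unfolding n_def using ex by (rule LeastI_ex)
    have "n \<noteq> 0" using n False by (intro notI) simp
    then obtain j where j: "n = Suc j" by (cases n) auto
    have "2 ^ j < U \<omega>" using not_less_Least[of j "\<lambda>n. U \<omega> \<le> 2 ^ n"] j by (auto simp: n_def)
    then have "\<omega> \<in> ?E j" using \<omega> by simp
    moreover have "U \<omega> powr p \<le> 2 powr (p * (real j + 1))"
    proof -
      have "U \<omega> powr p \<le> (2 ^ n) powr p" using n U p by (intro powr_mono2) auto
      also have "(2::real) ^ n = 2 powr (real j + 1)" unfolding j by (simp add: powr_add powr_realpow add.commute)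
      finally show ?thesis by (simp add: powr_powr mult.commute)
    qed
    ultimately have "ennreal (U \<omega> powr p) \<le> ?b j * indicator (?E j) \<omega>"
      by (simp add: ennreal_leI)
    also have "\<dots> \<le> (\<Sum>j. ?b j * indicator (?E j) \<omega>)"
    proof -
      define h where "h = (\<lambda>j. ?b j * indicator (?E j) \<omega>)"
      have "sum h {j} \<le> suminf h" by (rule sum_le_suminf) auto
      then have "h j \<le> suminf h" by simp
      then show ?thesis by (simp only: h_def)
    qed
    finally show ?thesis by (simp add: add_increasing)
  qed
  have summand: "?b j * emeasure M (?E j) \<le> ennreal (2 powr p * C * (2 powr (p - q)) ^ j)" for j
  proof -
    have "?b j * emeasure M (?E j) = ennreal (2 powr (p * (real j + 1)) * prob (?E j))"
      by (simp add: emeasure_eq_measure ennreal_mult)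
    also have "\<dots> \<le> ennreal (2 powr (p * (real j + 1)) * (C * (2 ^ j) powr - q))"
      by (intro ennreal_leI mult_left_mono tail) auto
    also have "2 powr (p * (real j + 1)) * (C * (2 ^ j) powr - q) = 2 powr p * C * (2 powr (p - q)) ^ j"
    proof -
      have "(2 powr (p - q)) ^ j = 2 powr ((p - q) * j)"
        by (simp add: powr_powr powr_realpow[symmetric])
      moreover have "((2::real) ^ j) powr - q = 2 powr (- q * j)"
        by (simp add: powr_realpow[symmetric] powr_powr mult.commute)
      moreover have "2 powr (p * (real j + 1)) = 2 powr p * 2 powr (p * j)"
        by (simp add: powr_add[symmetric] algebra_simps)
      moreover have "2 powr ((p - q) * j) = 2 powr (p * j) * 2 powr (- q * j)"
        by (simp add: powr_add[symmetric] algebra_simps)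
      ultimately show ?thesis by (simp only: mult_ac)
    qed
    finally show ?thesis .
  qed
  have "summable (\<lambda>j. 2 powr p * C * (2 powr (p - q)) ^ j)"
    using p by (intro summable_mult summable_geometric) (simp add: powr_less_one)
  then have fin: "(\<Sum>j. ennreal (2 powr p * C * (2 powr (p - q)) ^ j)) \<noteq> top"
    using C by (intro ennreal_suminf_neq_top) auto
  have "(\<integral>\<^sup>+\<omega>. ennreal (U \<omega> powr p) \<partial>M) \<le> (\<integral>\<^sup>+\<omega>. 1 + (\<Sum>j. ?b j * indicator (?E j) \<omega>) \<partial>M)"
    by (intro nn_integral_mono pw)
  also have "\<dots> = (\<integral>\<^sup>+\<omega>. 1 \<partial>M) + (\<integral>\<^sup>+\<omega>. (\<Sum>j. ?b j * indicator (?E j) \<omega>) \<partial>M)"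
    by (intro nn_integral_add) auto
  also have "(\<integral>\<^sup>+\<omega>. (\<Sum>j. ?b j * indicator (?E j) \<omega>) \<partial>M) = (\<Sum>j. \<integral>\<^sup>+\<omega>. ?b j * indicator (?E j) \<omega> \<partial>M)"
    by (intro nn_integral_suminf) auto
  also have "\<dots> = (\<Sum>j. ?b j * emeasure M (?E j))"
    by (intro suminf_cong nn_integral_cmult_indicator) auto
  also have "\<dots> \<le> (\<Sum>j. ennreal (2 powr p * C * (2 powr (p - q)) ^ j))"
    by (intro suminf_le summand) auto
  finally have "(\<integral>\<^sup>+\<omega>. ennreal (U \<omega> powr p) \<partial>M) \<le> 1 + (\<Sum>j. ennreal (2 powr p * C * (2 powr (p - q)) ^ j))"
    by (simp add: emeasure_space_1 add_left_mono)
  also have "\<dots> < top" using fin by (simp add: less_top[symmetric])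
  finally show ?thesis by (intro integrableI_nonneg) auto
qed

locale iid_vectors = prob_space M for M :: "'w measure" +
  fixes X :: "nat \<Rightarrow> 'w \<Rightarrow> real^'d"
  assumes indep: "indep_vars (\<lambda>_. borel) X {1..}"
    and ident: "\<And>i. 1 \<le> i \<Longrightarrow> distr M borel (X i) = distr M borel (X 1)"
begin

lemma X_measurable[measurable]: "1 \<le> i \<Longrightarrow> X i \<in> borel_measurable M"
  using indep by (auto simp: indep_vars_def)

lemma prob_X_eq:
  assumes "1 \<le> i" "B \<in> sets borel"
  shows "prob {\<omega> \<in> space M. X i \<omega> \<in> B} = prob {\<omega> \<in> space M. X 1 \<omega> \<in> B}"
proof -
  have "prob {\<omega> \<in> space M. X j \<omega> \<in> B} = measure (distr M borel (X j)) B" if "1 \<le> j" for j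
    using that assms(2) by (subst measure_distr) (auto intro!: arg_cong[where f=prob])
  then show ?thesis using ident[OF assms(1)] assms(1) by simp
qed

lemma integrable_X_iff:
  fixes f :: "real^'d \<Rightarrow> real"
  assumes "1 \<le> i" and [measurable]: "f \<in> borel_measurable borel"
  shows "integrable M (\<lambda>\<omega>. f (X i \<omega>)) \<longleftrightarrow> integrable M (\<lambda>\<omega>. f (X 1 \<omega>))"
    and "expectation (\<lambda>\<omega>. f (X i \<omega>)) = expectation (\<lambda>\<omega>. f (X 1 \<omega>))"
proof -
  have [measurable]: "X i \<in> borel_measurable M" "X 1 \<in> borel_measurable M" using assms(1) by auto
  show "integrable M (\<lambda>\<omega>. f (X i \<omega>)) \<longleftrightarrow> integrable M (\<lambda>\<omega>. f (X 1 \<omega>))"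
    using integrable_distr_eq[of "X i" M borel f] integrable_distr_eq[of "X 1" M borel f] ident[OF assms(1)] by simp
  show "expectation (\<lambda>\<omega>. f (X i \<omega>)) = expectation (\<lambda>\<omega>. f (X 1 \<omega>))"
    using integral_distr[of "X i" M borel f] integral_distr[of "X 1" M borel f] ident[OF assms(1)] by simp
qed

text \<open>
With $l = L \ln N / N$ the deviation $\epsilon N$ gains the factor $N^{- L \epsilon}$, and $L$ is
chosen to make this $N^{- q}$.  The price is $N l^p \exp (l \eta N)$ in the exponent, that is
$(L \ln N)^p N^{1 - p + L \eta}$, which is bounded if the truncation level $\eta$ is small.
\<close>

lemma truncated_partial_sum_bound:
  assumes int: "integrable M (X 1)" and zero: "expectation (X 1) = 0"
    and p: "1 < p" "p \<le> 2" and intp: "integrable M (\<lambda>\<omega>. norm (X 1 \<omega>) powr p)"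
    and e: "0 < \<epsilon>" and q: "1 < q"
  obtains \<eta> K where "0 < \<eta>" "0 \<le> K"
    "\<And>N I c s. 1 \<le> N \<Longrightarrow> I \<subseteq> {1..} \<Longrightarrow> finite I \<Longrightarrow> card I \<le> N \<Longrightarrow> \<bar>s\<bar> = 1 \<Longrightarrow>
       prob {\<omega> \<in> space M. \<epsilon> * real N \<le> (\<Sum>i\<in>I. s * X i \<omega> $ c) \<and> (\<forall>i\<in>I. s * X i \<omega> $ c \<le> \<eta> * real N)}
         \<le> K * real N powr - q"
proof -
  define B where "B = expectation (\<lambda>\<omega>. norm (X 1 \<omega>) powr p)"
  have B0: "0 \<le> B" unfolding B_def by (rule integral_nonneg_AE) simp
  define L where "L = q / \<epsilon>"
  define \<eta> where "\<eta> = (p - 1) / (2 * L)"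
  \<comment> \<open>A logarithm is bounded by the power $N^r / r$; the $p$-th power of this is compensated by $N^{- (p - 1) / 2}$.\<close>
  define r where "r = (p - 1) / (2 * p)"
  define D where "D = B * (L / r) powr p"
  have L: "0 < L" using e q by (simp add: L_def)
  have \<eta>: "0 < \<eta>" using L p by (simp add: \<eta>_def)
  have r: "0 < r" using p by (simp add: r_def)
  show ?thesis
  proof (rule that[of \<eta> "exp D"])
    fix N :: nat and I :: "nat set" and c and s :: real
    assume N: "1 \<le> N" and I: "I \<subseteq> {1..}" "finite I" "card I \<le> N" and s: "\<bar>s\<bar> = 1"
    define l where "l = L * ln N / N"
    have ln0: "0 \<le> ln (real N)" using N by simp
    have l0: "0 \<le> l" using L N by (simp add: l_def)
    let ?Y = "\<lambda>i \<omega>. s * X i \<omega> $ c"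
    have le: "\<bar>s * x $ c\<bar> powr p \<le> norm x powr p" for x :: "real^'d"
      using p s by (intro powr_mono2) (auto simp: abs_mult component_le_norm_cart)
    have intpc: "integrable M (\<lambda>\<omega>. \<bar>?Y 1 \<omega>\<bar> powr p)"
      by (rule Bochner_Integration.integrable_bound[OF intp]) (auto intro!: le)
    have Bc: "expectation (\<lambda>\<omega>. \<bar>?Y 1 \<omega>\<bar> powr p) \<le> B"
      unfolding B_def by (intro integral_mono intpc intp le)
    have bl: "bounded_linear (\<lambda>x::real^'d. s * x $ c)"
      by (intro bounded_linear_intros bounded_linear_vec_nth)
    have intc: "integrable M (?Y 1)" using integrable_bounded_linear[OF bl int] .
    have zeroc: "expectation (?Y 1) = 0"
      using integral_bounded_linear[OF bl int] zero by simp
    have "prob {\<omega> \<in> space M. \<epsilon> * real N \<le> (\<Sum>i\<in>I. ?Y i \<omega>) \<and> (\<forall>i\<in>I. ?Y i \<omega> \<le> \<eta> * real N)}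
      \<le> exp (- l * (\<epsilon> * real N) + card I * (B * l powr p * exp (l * (\<eta> * real N))))"
    proof (rule truncated_chernoff)
      show "indep_vars (\<lambda>_. borel) ?Y I"
        by (rule indep_vars_compose2[OF indep_vars_subset[OF indep I(1)], of "\<lambda>_ x. s * x $ c"]) simp
      fix i assume "i \<in> I"
      then have i: "1 \<le> i" using I by auto
      show "integrable M (?Y i)" "expectation (?Y i) = 0"
        using integrable_X_iff[OF i, of "\<lambda>x. s * x $ c"] intc zeroc by auto
      show "integrable M (\<lambda>\<omega>. \<bar>?Y i \<omega>\<bar> powr p)" "expectation (\<lambda>\<omega>. \<bar>?Y i \<omega>\<bar> powr p) \<le> B"
        using integrable_X_iff[OF i, of "\<lambda>x. \<bar>s * x $ c\<bar> powr p"] intpc Bc by auto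
    qed (use I p l0 \<eta> in auto)
    also have "\<dots> \<le> exp (- q * ln N + D)"
    proof -
      have a: "l * (\<epsilon> * real N) = q * ln N" using N e by (simp add: l_def L_def)
      have b: "exp (l * (\<eta> * real N)) = real N powr ((p - 1) / 2)"
        using N L by (simp add: l_def \<eta>_def powr_def)
      have "card I * (B * l powr p * exp (l * (\<eta> * real N))) \<le> N * (B * l powr p * exp (l * (\<eta> * real N)))"
        using I B0 by (intro mult_right_mono) auto
      also have "\<dots> = B * L powr p * (ln N powr p * (N powr 1 * N powr (- p) * N powr ((p - 1) / 2)))"
        unfolding b using N L ln0 by (simp add: l_def powr_mult powr_divide powr_minus divide_simps)
      also have "N powr 1 * N powr (- p) * N powr ((p - 1) / 2) = real N powr (- (p - 1) / 2)"
        unfolding powr_add[symmetric] by (rule arg_cong2[where f="(powr)"]) (auto simp: field_simps)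
      also have "B * L powr p * (ln N powr p * real N powr (- (p - 1) / 2)) \<le> B * L powr p * (1 / r powr p)"
      proof (intro mult_left_mono)
        have "ln (real N) \<le> real N powr r / r" using N r by (intro ln_powr_bound) auto
        then have "ln N powr p \<le> (real N powr r / r) powr p" using ln0 p by (intro powr_mono2) auto
        also have "\<dots> = real N powr ((p - 1) / 2) / r powr p"
          using r p by (simp add: powr_divide powr_powr) (simp add: r_def)
        finally have "ln N powr p * real N powr (- (p - 1) / 2)
            \<le> real N powr ((p - 1) / 2) / r powr p * real N powr (- (p - 1) / 2)"
          by (intro mult_right_mono) auto
        also have "\<dots> = (real N powr ((p - 1) / 2) * real N powr (- (p - 1) / 2)) / r powr p" by simp
        also have "real N powr ((p - 1) / 2) * real N powr (- (p - 1) / 2) = 1"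
          unfolding powr_add[symmetric] using N by (simp add: field_simps)
        finally show "ln N powr p * real N powr (- (p - 1) / 2) \<le> 1 / r powr p" .
      qed (use B0 in auto)
      also have "\<dots> = D" unfolding D_def using L r by (simp add: powr_divide)
      finally show ?thesis using a by simp
    qed
    also have "\<dots> = exp D * real N powr - q" using N by (simp add: exp_add[symmetric] powr_def)
    finally show "prob {\<omega> \<in> space M. \<epsilon> * real N \<le> (\<Sum>i\<in>I. ?Y i \<omega>) \<and> (\<forall>i\<in>I. ?Y i \<omega> \<le> \<eta> * real N)}
         \<le> exp D * real N powr - q" .
  qed (use \<eta> in auto)
qed

text \<open>
Either some summand exceeds $\eta N$, which has probability of order $N^{1 - q}$, or all partial sums
are sums of truncated variables.  The bound for the latter has one power of $N$ to spare and
therefore survives a union bound over all partial sums.  Norms are reduced to signed coordinates.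
\<close>

lemma maximal_large_deviation:
  assumes int: "integrable M (X 1)" and zero: "expectation (X 1) = 0"
    and q: "1 < q" and tail: "\<And>t. 0 < t \<Longrightarrow> prob {\<omega> \<in> space M. t < norm (X 1 \<omega>)} \<le> C * t powr - q"
    and e: "0 < \<epsilon>"
  obtains K where "0 \<le> K"
    "\<And>N I. 1 \<le> N \<Longrightarrow> I \<subseteq> {1..} \<Longrightarrow> finite I \<Longrightarrow> card I \<le> N \<Longrightarrow>
       prob {\<omega> \<in> space M. \<exists>k. \<epsilon> * real N \<le> norm (\<Sum>i\<in>{i\<in>I. i \<le> k}. X i \<omega>)} \<le> K * real N powr (1 - q)"
proof -
  let ?d = "real CARD('d)"
  \<comment> \<open>Any order between $1$ and $q$ that is at most $2$ would do.\<close>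
  define p where "p = min 2 ((1 + q) / 2)"
  have p: "1 < p" "p \<le> 2" "p < q" using q by (auto simp: p_def min_def field_simps)
  have [measurable]: "X 1 \<in> borel_measurable M" by simp
  have intp: "integrable M (\<lambda>\<omega>. norm (X 1 \<omega>) powr p)"
    by (rule nn_moment_finite_of_tail[where q=q and C=C]) (use tail p in auto)
  have e': "0 < \<epsilon> / ?d" using e by simp
  obtain \<eta> K0 where \<eta>: "0 < \<eta>" and K0: "0 \<le> K0" and bound:
    "\<And>N I c s. 1 \<le> N \<Longrightarrow> I \<subseteq> {1..} \<Longrightarrow> finite I \<Longrightarrow> card I \<le> N \<Longrightarrow> \<bar>s\<bar> = 1 \<Longrightarrow>
       prob {\<omega> \<in> space M. \<epsilon> / ?d * real N \<le> (\<Sum>i\<in>I. s * X i \<omega> $ c) \<and> (\<forall>i\<in>I. s * X i \<omega> $ c \<le> \<eta> * real N)}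
         \<le> K0 * real N powr - q"
    by (rule truncated_partial_sum_bound[OF int zero p(1,2) intp e' q]) (rule that; assumption)
  have C: "0 \<le> C" using order_trans[OF measure_nonneg tail[of 1]] by simp
  show ?thesis
  proof (rule that[of "C * \<eta> powr - q + 2 * ?d * K0"])
    show "0 \<le> C * \<eta> powr - q + 2 * ?d * K0" using C K0 by simp
    fix N :: nat and I :: "nat set" assume N: "1 \<le> N" and I: "I \<subseteq> {1..}" "finite I" "card I \<le> N"
    have Xm[measurable]: "i \<in> I \<Longrightarrow> X i \<in> borel_measurable M" for i using I by auto
    let ?E = "{\<omega> \<in> space M. \<exists>k. \<epsilon> * real N \<le> norm (\<Sum>i\<in>{i\<in>I. i \<le> k}. X i \<omega>)}"
    let ?J = "\<lambda>i. {\<omega> \<in> space M. \<eta> * real N < norm (X i \<omega>)}"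
    let ?T = "I \<times> (UNIV :: 'd set) \<times> {1, -1 :: real}"
    let ?F = "\<lambda>(k, c, s). {\<omega> \<in> space M. \<epsilon> / ?d * real N \<le> (\<Sum>i\<in>{i\<in>I. i \<le> k}. s * X i \<omega> $ c) \<and>
                (\<forall>i\<in>{i\<in>I. i \<le> k}. s * X i \<omega> $ c \<le> \<eta> * real N)}"
    have mJ: "?J i \<in> sets M" if "i \<in> I" for i using that by measurable
    have Xc: "(\<lambda>\<omega>. s * X i \<omega> $ c) \<in> borel_measurable M" if "i \<in> I" for i c and s :: real
      using measurable_compose[OF Xm[OF that], of "\<lambda>x. s * x $ c" borel] by simp
    have mF: "?F t \<in> sets M" for t
    proof -
      obtain k c s where t: "t = (k, c, s)" by (cases t) auto
      have K: "finite {i\<in>I. i \<le> k}" using I(2) by simp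
      show ?thesis unfolding t split_conv
        by (intro sets.sets_Collect_conj sets.sets_Collect_finite_All[OF _ K] borel_measurable_le
            borel_measurable_sum measurable_const Xc) auto
    qed
    have sub: "?E \<subseteq> (\<Union>i\<in>I. ?J i) \<union> (\<Union>t\<in>?T. ?F t)"
    proof
      fix \<omega> assume "\<omega> \<in> ?E"
      then obtain k0 where \<omega>: "\<omega> \<in> space M" and k0: "\<epsilon> * real N \<le> norm (\<Sum>i\<in>{i\<in>I. i \<le> k0}. X i \<omega>)" by auto
      have "0 < \<epsilon> * real N" using e N by simp
      then have ne: "{i\<in>I. i \<le> k0} \<noteq> {}" using k0 by (metis norm_zero not_less sum.empty)
      define k where "k = Max {i\<in>I. i \<le> k0}"
      have "k \<in> {i\<in>I. i \<le> k0}" unfolding k_def using I(2) ne by (intro Max_in) auto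
      moreover have "i \<le> k" if "i \<in> {i\<in>I. i \<le> k0}" for i
        unfolding k_def using I(2) that by (intro Max_ge) auto
      ultimately have "k \<in> I" "{i\<in>I. i \<le> k0} = {i\<in>I. i \<le> k}" by auto
      then have k: "k \<in> I" "\<epsilon> * real N \<le> norm (\<Sum>i\<in>{i\<in>I. i \<le> k}. X i \<omega>)" using k0 by auto
      show "\<omega> \<in> (\<Union>i\<in>I. ?J i) \<union> (\<Union>t\<in>?T. ?F t)"
      proof (cases "\<exists>i\<in>I. \<eta> * real N < norm (X i \<omega>)")
        case False
        define S where "S = (\<Sum>i\<in>{i\<in>I. i \<le> k}. X i \<omega>)"
        have "\<exists>c. \<epsilon> / ?d * real N \<le> \<bar>S $ c\<bar>"
        proof (rule ccontr)
          assume "\<not> ?thesis"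
          then have "(\<Sum>c\<in>UNIV. \<bar>S $ c\<bar>) < (\<Sum>c\<in>(UNIV::'d set). \<epsilon> / ?d * real N)"
            by (intro sum_strict_mono) (auto simp: not_le)
          also have "\<dots> = \<epsilon> * real N" by simp
          finally show False using k(2) norm_le_l1_cart[of S] by (simp add: S_def)
        qed
        then obtain c where c: "\<epsilon> / ?d * real N \<le> \<bar>S $ c\<bar>" by blast
        define s where "s = (if 0 \<le> S $ c then 1 else -1 :: real)"
        have s: "s \<in> {1, -1}" "s * S $ c = \<bar>S $ c\<bar>" by (auto simp: s_def)
        have "(\<Sum>i\<in>{i\<in>I. i \<le> k}. s * X i \<omega> $ c) = s * S $ c"
          unfolding S_def by (simp add: sum_distrib_left)
        moreover have "s * X i \<omega> $ c \<le> \<eta> * real N" if "i \<in> I" for i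
        proof -
          have "s * X i \<omega> $ c \<le> \<bar>X i \<omega> $ c\<bar>" using s(1) by auto
          also have "\<dots> \<le> norm (X i \<omega>)" by (rule component_le_norm_cart)
          finally show ?thesis using False that by force
        qed
        ultimately have "\<omega> \<in> ?F (k, c, s)" using \<omega> c s(2) by simp
        moreover have "(k, c, s) \<in> ?T" using k s by simp
        ultimately show ?thesis by blast
      qed (use \<omega> in auto)
    qed
    have T: "finite ?T" using I(2) by simp
    have "prob ?E \<le> prob ((\<Union>i\<in>I. ?J i) \<union> (\<Union>t\<in>?T. ?F t))"
      by (intro finite_measure_mono[OF sub] sets.Un sets.finite_UN mJ mF T I(2))
    also have "\<dots> \<le> prob (\<Union>i\<in>I. ?J i) + prob (\<Union>t\<in>?T. ?F t)"
      using I(2) mJ mF by (intro measure_Un_le sets.finite_UN) auto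
    also have "\<dots> \<le> (\<Sum>i\<in>I. prob (?J i)) + (\<Sum>t\<in>?T. prob (?F t))"
      using I(2) mJ mF by (intro add_mono finite_measure_subadditive_finite) auto
    also have "(\<Sum>i\<in>I. prob (?J i)) \<le> (\<Sum>i\<in>I. C * (\<eta> * real N) powr - q)"
    proof (rule sum_mono)
      fix i assume "i \<in> I"
      then have "prob (?J i) = prob (?J 1)"
        using prob_X_eq[of i "{x. \<eta> * real N < norm x}"] I by auto
      also have "\<dots> \<le> C * (\<eta> * real N) powr - q" using \<eta> N by (intro tail) simp
      finally show "prob (?J i) \<le> C * (\<eta> * real N) powr - q" .
    qed
    also have "\<dots> \<le> real N * (C * (\<eta> * real N) powr - q)"
      using I C by (simp add: mult_right_mono)
    also have "real N * (C * (\<eta> * real N) powr - q) = C * \<eta> powr - q * real N powr (1 - q)"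
      using \<eta> N by (simp add: powr_mult powr_diff powr_minus divide_simps)
    also have "(\<Sum>t\<in>?T. prob (?F t)) \<le> (\<Sum>t\<in>?T. K0 * real N powr - q)"
    proof (rule sum_mono)
      fix t assume "t \<in> ?T"
      then obtain k c s where t: "t = (k, c, s)" "k \<in> I" "\<bar>s\<bar> = 1" by auto
      have "card {i\<in>I. i \<le> k} \<le> N"
        using card_mono[OF I(2), of "{i\<in>I. i \<le> k}"] I(3) by auto
      then show "prob (?F t) \<le> K0 * real N powr - q"
        using bound[OF N, of "{i\<in>I. i \<le> k}" s c] I t by auto
    qed
    also have "\<dots> = real (card I) * (2 * ?d * (K0 * real N powr - q))"
      by (simp add: card_cartesian_product)
    also have "\<dots> \<le> real N * (2 * ?d * (K0 * real N powr - q))"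
      using I K0 by (intro mult_right_mono) auto
    also have "\<dots> = 2 * ?d * K0 * real N powr (1 - q)"
      using N by (simp add: powr_diff powr_minus divide_simps)
    finally show "prob ?E \<le> (C * \<eta> powr - q + 2 * ?d * K0) * real N powr (1 - q)"
      by (simp add: algebra_simps)
  qed
qed

end

section \<open>From vague convergence to norms and balls\<close>

lemma inj_ext_vec: "inj ext_vec"
  by (rule injI) (auto simp: ext_vec_def vec_eq_iff)

lemma ext_vec_nth [simp]: "ext_vec x $ i = ereal (x $ i)"
  by (simp add: ext_vec_def)

lemma ext_vec_0 [simp]: "ext_vec 0 = 0"
  by (simp add: vec_eq_iff zero_ereal_def)

lemma ext_vec_mem_image_iff [simp]: "ext_vec x \<in> ext_vec ` S \<longleftrightarrow> x \<in> S"
  using inj_ext_vec by (auto dest: injD)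

lemma zero_mem_ext_vec_image_iff [simp]: "0 \<in> ext_vec ` S \<longleftrightarrow> 0 \<in> S"
  using ext_vec_mem_image_iff[of 0 S] by (simp del: ext_vec_mem_image_iff)

lemma ext_vec_eq_0_iff: "ext_vec x = 0 \<longleftrightarrow> x = 0"
  using inj_ext_vec ext_vec_0 by (metis injD)

lemma open_ext_vec_image:
  assumes "open S"
  shows "open (ext_vec ` S)"
  unfolding open_vec_def
proof (intro ballI)
  fix y assume "y \<in> ext_vec ` S"
  then obtain x where x: "x \<in> S" "y = ext_vec x" by auto
  obtain B where B: "\<And>i. open (B i) \<and> x $ i \<in> B i" "\<And>z. (\<And>i. z $ i \<in> B i) \<Longrightarrow> z \<in> S"
    using assms x(1) unfolding open_vec_def by meson
  show "\<exists>A. (\<forall>i. open (A i) \<and> y $ i \<in> A i) \<and> (\<forall>z. (\<forall>i. z $ i \<in> A i) \<longrightarrow> z \<in> ext_vec ` S)"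
  proof (intro exI[of _ "\<lambda>i. ereal ` B i"] conjI allI impI)
    fix i show "open (ereal ` B i)" "y $ i \<in> ereal ` B i"
      using B(1)[of i] x by (auto intro: open_ereal)
  next
    fix z assume z: "\<forall>i. z $ i \<in> ereal ` B i"
    define w where "w = (\<chi> i. real_of_ereal (z $ i))"
    have "z $ i = ereal (w $ i) \<and> w $ i \<in> B i" for i
      using z[rule_format, of i] by (auto simp: w_def)
    then have "z = ext_vec w" "w \<in> S" using B(2) by (auto simp: vec_eq_iff)
    then show "z \<in> ext_vec ` S" by simp
  qed
qed

text \<open>
The complement consists of the finite points outside the ball together with the open half spaces
in which some coordinate is too large or too small; the points with an infinite coordinate lie in
one of these.
\<close>

lemma closed_ext_vec_cball: "closed (ext_vec ` cball v e)"
proof -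
  let ?U = "\<Union>i. (\<lambda>y. y $ i) -` {ereal (v $ i + e)<..}" and ?L = "\<Union>i. (\<lambda>y. y $ i) -` {..<ereal (v $ i - e)}"
  have "- (ext_vec ` cball v e) = ext_vec ` (- cball v e) \<union> ?U \<union> ?L"
  proof (intro equalityI subsetI)
    fix y :: "ereal^'a" assume y: "y \<in> - (ext_vec ` cball v e)"
    show "y \<in> ext_vec ` (- cball v e) \<union> ?U \<union> ?L"
    proof (cases "\<forall>i. \<bar>y $ i\<bar> \<noteq> \<infinity>")
      case True
      then obtain x where x: "y = ext_vec x"
        by (intro that[of "\<chi> i. real_of_ereal (y $ i)"]) (simp add: vec_eq_iff ereal_real)
      then have "x \<notin> cball v e" using y by auto
      then show ?thesis unfolding x by blast
    next
      case False
      then obtain i where "y $ i = \<infinity> \<or> y $ i = -\<infinity>" by (auto simp: abs_eq_infinity_cases)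
      then show ?thesis by (auto intro!: exI[of _ i])
    qed
  next
    fix y :: "ereal^'a" assume y: "y \<in> ext_vec ` (- cball v e) \<union> ?U \<union> ?L"
    show "y \<in> - (ext_vec ` cball v e)"
    proof
      assume "y \<in> ext_vec ` cball v e"
      then obtain x where x: "y = ext_vec x" "dist v x \<le> e" by auto
      have "\<bar>v $ i - x $ i\<bar> \<le> e" for i
        using component_le_norm_cart[of "v - x" i] x(2) by (simp add: dist_norm)
      then have "v $ i - e \<le> x $ i \<and> x $ i \<le> v $ i + e" for i
        by (simp add: abs_le_iff) (metis add.commute diff_le_eq le_diff_eq)
      then have "y \<notin> ?U" "y \<notin> ?L" using x by (auto simp: not_less)
      then show False using y x by auto
    qed
  qed
  moreover have "open (ext_vec ` (- cball v e) \<union> ?U \<union> ?L)"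
    by (intro open_Un open_UN ballI open_vimage_vec_nth open_ext_vec_image) auto
  ultimately show ?thesis by (simp add: closed_def)
qed

lemma frontier_ext_vec_ball: "frontier (ext_vec ` ball v e) \<subseteq> ext_vec ` sphere v e"
proof -
  have "closure (ext_vec ` ball v e) \<subseteq> ext_vec ` cball v e"
    by (intro closure_minimal closed_ext_vec_cball image_mono ball_subset_cball)
  moreover have "interior (ext_vec ` ball v e) = ext_vec ` ball v e"
    by (intro interior_open open_ext_vec_image open_ball)
  ultimately show ?thesis by (auto simp: frontier_def)
qed

lemma frontier_compl_ext_vec_cball: "frontier (- ext_vec ` cball v e) \<subseteq> ext_vec ` sphere v e"
proof -
  have "closure (- ext_vec ` cball v e) \<subseteq> - ext_vec ` ball v e"
    using open_ext_vec_image[of "ball v e"] by (intro closure_minimal) (auto simp: closed_Compl)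
  moreover have "interior (- ext_vec ` cball v e) = - ext_vec ` cball v e"
    using closed_ext_vec_cball by (intro interior_open) (auto simp: open_Compl)
  ultimately show ?thesis by (auto simp: frontier_def)
qed

context
  fixes \<alpha> :: real and \<mu> :: "(ereal^'d) measure" and \<sigma> :: "(real^'d) measure" and \<nu> :: "real measure"
  assumes alpha: "0 < \<alpha>"
    and sets_mu: "sets \<mu> = sets (restrict_space borel (- {0}))"
    and sets_sigma: "sets \<sigma> = sets (restrict_space borel (sphere 0 1))"
    and sigma_fin: "emeasure \<sigma> (sphere 0 1) < \<infinity>"
    and sigma_pos: "\<And>U. openin (top_of_set (sphere 0 1)) U \<Longrightarrow> U \<noteq> {} \<Longrightarrow> 0 < emeasure \<sigma> U"
    and sets_nu: "sets \<nu> = sets (restrict_space borel {0<..})"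
    and nu_tail: "\<And>x. 0 < x \<Longrightarrow> emeasure \<nu> {x<..} = ennreal (x powr - \<alpha>)"
    and polar: "\<And>C. C \<in> sets (\<nu> \<Otimes>\<^sub>M \<sigma>) \<Longrightarrow>
      emeasure \<mu> (ext_vec ` {x. x \<noteq> 0 \<and> (norm x, x /\<^sub>R norm x) \<in> C}) = emeasure (\<nu> \<Otimes>\<^sub>M \<sigma>) C"
begin

lemma space_sigma: "space \<sigma> = sphere 0 1"
  using sets_eq_imp_space_eq[OF sets_sigma] by (simp add: space_restrict_space)

lemma space_nu: "space \<nu> = {0<..}"
  using sets_eq_imp_space_eq[OF sets_nu] by (simp add: space_restrict_space)

lemma sets_nuI: "S \<in> sets borel \<Longrightarrow> S \<subseteq> {0<..} \<Longrightarrow> S \<in> sets \<nu>"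
  unfolding sets_nu by (subst sets_restrict_space_iff) auto

lemma sets_sigmaI: "S \<in> sets borel \<Longrightarrow> S \<subseteq> sphere 0 1 \<Longrightarrow> S \<in> sets \<sigma>"
  unfolding sets_sigma by (subst sets_restrict_space_iff) auto

lemma finite_sigma: "finite_measure \<sigma>"
  using sigma_fin by (intro finite_measureI) (simp add: space_sigma)

lemma sigma_sphere_pos: "0 < emeasure \<sigma> (sphere 0 1)"
proof (rule sigma_pos)
  have "axis undefined 1 \<in> sphere (0::real^'d) 1" by (simp add: norm_axis_1)
  then show "sphere (0::real^'d) 1 \<noteq> {}" by blast
qed simp

lemma measurable_polar: "(\<lambda>(r, \<phi>). r *\<^sub>R \<phi>) \<in> borel_measurable (\<nu> \<Otimes>\<^sub>M \<sigma>)"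
proof -
  have "(\<lambda>x. x) \<in> measurable \<nu> borel"
    unfolding measurable_cong_sets[OF sets_nu refl] by (rule measurable_restrict_space1) simp
  moreover have "(\<lambda>x. x) \<in> measurable \<sigma> borel"
    unfolding measurable_cong_sets[OF sets_sigma refl] by (rule measurable_restrict_space1) simp
  ultimately have "fst \<in> borel_measurable (\<nu> \<Otimes>\<^sub>M \<sigma>)" "snd \<in> borel_measurable (\<nu> \<Otimes>\<^sub>M \<sigma>)"
    using measurable_compose[OF measurable_fst] measurable_compose[OF measurable_snd] by auto
  then show ?thesis unfolding case_prod_beta by (rule borel_measurable_scaleR)
qed

lemma polar_emeasure:
  assumes "S \<in> sets borel" "0 \<notin> S"
  shows "emeasure \<mu> (ext_vec ` S) = emeasure (\<nu> \<Otimes>\<^sub>M \<sigma>) ((\<lambda>(r, \<phi>). r *\<^sub>R \<phi>) -` S \<inter> space (\<nu> \<Otimes>\<^sub>M \<sigma>))"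
proof -
  let ?C = "(\<lambda>(r, \<phi>). r *\<^sub>R \<phi>) -` S \<inter> space (\<nu> \<Otimes>\<^sub>M \<sigma>)"
  have "?C \<in> sets (\<nu> \<Otimes>\<^sub>M \<sigma>)" by (rule measurable_sets[OF measurable_polar assms(1)])
  moreover have "{x. x \<noteq> 0 \<and> (norm x, x /\<^sub>R norm x) \<in> ?C} = S"
  proof (rule set_eqI)
    fix x show "x \<in> {x. x \<noteq> 0 \<and> (norm x, x /\<^sub>R norm x) \<in> ?C} \<longleftrightarrow> x \<in> S"
      using assms(2) by (cases "x = 0") (auto simp: space_pair_measure space_nu space_sigma)
  qed
  ultimately show ?thesis using polar[of ?C] by simp
qed

lemma mu_outside_ball:
  assumes "0 < s"
  shows "emeasure \<mu> (ext_vec ` {x. s < norm x}) = ennreal (s powr - \<alpha>) * emeasure \<sigma> (sphere 0 1)"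
proof -
  interpret S: finite_measure \<sigma> by (rule finite_sigma)
  have "emeasure \<mu> (ext_vec ` {x. s < norm x})
      = emeasure (\<nu> \<Otimes>\<^sub>M \<sigma>) ((\<lambda>(r, \<phi>). r *\<^sub>R \<phi>) -` {x. s < norm x} \<inter> space (\<nu> \<Otimes>\<^sub>M \<sigma>))"
    using assms by (intro polar_emeasure) auto
  also have "(\<lambda>(r, \<phi>). r *\<^sub>R \<phi>) -` {x. s < norm x} \<inter> space (\<nu> \<Otimes>\<^sub>M \<sigma>) = {s<..} \<times> sphere 0 1"
    using assms by (auto simp: space_pair_measure space_nu space_sigma)
  also have "emeasure (\<nu> \<Otimes>\<^sub>M \<sigma>) \<dots> = emeasure \<nu> {s<..} * emeasure \<sigma> (sphere 0 1)"
    using assms by (intro S.emeasure_pair_measure_Times sets_nuI sets_sigmaI) auto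
  finally show ?thesis using nu_tail[OF assms] by simp
qed

lemma nu_greaterThanAtMost:
  assumes "0 < u" "u < s"
  shows "emeasure \<nu> {u<..s} = ennreal (u powr - \<alpha> - s powr - \<alpha>)"
proof -
  have "emeasure \<nu> ({u<..} - {s<..}) = emeasure \<nu> {u<..} - emeasure \<nu> {s<..}"
  proof (rule emeasure_Diff)
    show "emeasure \<nu> {s<..} \<noteq> \<infinity>" using nu_tail[of s] assms by simp
    show "{u<..} \<in> sets \<nu>" "{s<..} \<in> sets \<nu>" using assms by (auto intro: sets_nuI)
  qed (use assms in auto)
  moreover have "{u<..} - {s<..} = {u<..s}" using assms by auto
  ultimately show ?thesis using assms nu_tail[of s] nu_tail[of u] by (simp add: ennreal_minus)
qed

lemma mu_centered_sphere:
  assumes "0 < s"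
  shows "emeasure \<mu> (ext_vec ` sphere 0 s) = 0"
proof -
  interpret S: finite_measure \<sigma> by (rule finite_sigma)
  have "emeasure \<nu> {s} \<le> ennreal 0"
  proof (rule tendsto_lowerbound)
    have "((\<lambda>u. ennreal (u powr - \<alpha> - s powr - \<alpha>)) \<longlongrightarrow> ennreal (s powr - \<alpha> - s powr - \<alpha>)) (at_left s)"
      using assms by (intro tendsto_ennrealI tendsto_diff tendsto_powr tendsto_const tendsto_ident_at) auto
    then show "((\<lambda>u. ennreal (u powr - \<alpha> - s powr - \<alpha>)) \<longlongrightarrow> ennreal 0) (at_left s)" by simp
    have "eventually (\<lambda>u. u \<in> {0<..<s}) (at_left s)"
      using assms by (rule eventually_at_left_real)
    then show "eventually (\<lambda>u. emeasure \<nu> {s} \<le> ennreal (u powr - \<alpha> - s powr - \<alpha>)) (at_left s)"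
    proof eventually_elim
      case (elim u)
      then have "emeasure \<nu> {s} \<le> emeasure \<nu> {u<..s}"
        by (intro emeasure_mono sets_nuI) auto
      then show ?case using elim nu_greaterThanAtMost[of u s] by simp
    qed
  qed simp
  have "emeasure \<mu> (ext_vec ` sphere 0 s)
      = emeasure (\<nu> \<Otimes>\<^sub>M \<sigma>) ((\<lambda>(r, \<phi>). r *\<^sub>R \<phi>) -` sphere 0 s \<inter> space (\<nu> \<Otimes>\<^sub>M \<sigma>))"
    using assms by (intro polar_emeasure) auto
  also have "(\<lambda>(r, \<phi>). r *\<^sub>R \<phi>) -` sphere 0 s \<inter> space (\<nu> \<Otimes>\<^sub>M \<sigma>) = {s} \<times> sphere 0 1"
    using assms by (auto simp: space_pair_measure space_nu space_sigma)
  also have "emeasure (\<nu> \<Otimes>\<^sub>M \<sigma>) \<dots> = emeasure \<nu> {s} * emeasure \<sigma> (sphere 0 1)"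
    using assms by (intro S.emeasure_pair_measure_Times sets_nuI sets_sigmaI) auto
  finally show ?thesis using \<open>emeasure \<nu> {s} \<le> ennreal 0\<close> by simp
qed

lemma sets_muI: "S \<in> sets borel \<Longrightarrow> 0 \<notin> S \<Longrightarrow> S \<in> sets \<mu>"
proof -
  assume "S \<in> sets borel" "0 \<notin> S"
  moreover have "- {0 :: ereal^'d} \<in> sets borel"
    using closed_ext_vec_cball[of "0 :: real^'d" 0] by (intro borel_comp borel_closed) simp
  ultimately show ?thesis unfolding sets_mu by (subst sets_restrict_space_iff) auto
qed

lemma open_ext_vec_sets_mu: "open S \<Longrightarrow> 0 \<notin> S \<Longrightarrow> ext_vec ` S \<in> sets \<mu>"
  using open_ext_vec_image[of S] by (intro sets_muI) auto

lemma mu_ball_finite: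
  assumes "e < norm v"
  shows "emeasure \<mu> (ext_vec ` ball v e) < \<infinity>"
proof -
  define s where "s = norm v - e"
  have s: "0 < s" using assms by (simp add: s_def)
  have "s < norm x" if "x \<in> ball v e" for x
    using that norm_triangle_ineq2[of v x] by (simp add: dist_norm s_def)
  then have "ext_vec ` ball v e \<subseteq> ext_vec ` {x. s < norm x}" by auto
  moreover have "open {x::real^'d. s < norm x}" by (intro open_Collect_less continuous_intros)
  ultimately have "emeasure \<mu> (ext_vec ` ball v e) \<le> emeasure \<mu> (ext_vec ` {x. s < norm x})"
    using s by (intro emeasure_mono open_ext_vec_sets_mu) auto
  also have "\<dots> < \<infinity>" unfolding mu_outside_ball[OF s] using sigma_fin
    by (simp add: ennreal_mult_less_top)
  finally show ?thesis .
qed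

text \<open>
In polar coordinates the ball contains a product of a radial interval and an open cap of the
sphere, and both factors have positive mass.
\<close>

lemma mu_ball_pos:
  assumes "0 < e" "e < norm v"
  shows "0 < emeasure \<mu> (ext_vec ` ball v e)"
proof -
  interpret S: finite_measure \<sigma> by (rule finite_sigma)
  define w where "w = v /\<^sub>R norm v"
  have "v \<noteq> 0" using assms by auto
  then have v: "norm v > 0" "norm v *\<^sub>R w = v" by (auto simp: w_def)
  define U where "U = sphere 0 1 \<inter> ball w (e / (2 * norm v))"
  have "openin (top_of_set (sphere 0 1)) U" unfolding U_def by (rule openin_open_Int) simp
  moreover have "w \<in> U" using v(1) assms by (simp add: U_def w_def)
  ultimately have U: "0 < emeasure \<sigma> U" using sigma_pos by blast
  define u where "u = norm v - e / 2"
  have u: "0 < u" "u < norm v" using assms by (auto simp: u_def)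
  have dist: "r *\<^sub>R \<phi> \<in> ball v e" if "r \<in> {u<..norm v}" "\<phi> \<in> U" for r \<phi>
  proof -
    have \<phi>: "norm \<phi> = 1" "norm (w - \<phi>) < e / (2 * norm v)" using that by (auto simp: U_def dist_norm)
    have "v - r *\<^sub>R \<phi> = norm v *\<^sub>R (w - \<phi>) + (norm v - r) *\<^sub>R \<phi>"
      by (simp add: scaleR_diff_left scaleR_diff_right v(2))
    then have "norm (v - r *\<^sub>R \<phi>) \<le> norm (norm v *\<^sub>R (w - \<phi>)) + norm ((norm v - r) *\<^sub>R \<phi>)"
      by (metis norm_triangle_ineq)
    also have "\<dots> = norm v * norm (w - \<phi>) + (norm v - r)" using that \<phi> by simp
    also have "norm v * norm (w - \<phi>) < e / 2" using \<phi>(2) v(1) by (simp add: field_simps)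
    also have "norm v - r \<le> e / 2" using that by (simp add: u_def)
    finally show ?thesis by (simp add: dist_norm)
  qed
  have "0 < emeasure \<nu> {u<..norm v} * emeasure \<sigma> U"
    using U u alpha powr_less_mono2_neg[of "-\<alpha>" u "norm v"]
    by (simp add: nu_greaterThanAtMost ennreal_zero_less_mult_iff)
  also have "\<dots> = emeasure (\<nu> \<Otimes>\<^sub>M \<sigma>) ({u<..norm v} \<times> U)"
    using u by (intro S.emeasure_pair_measure_Times[symmetric] sets_nuI sets_sigmaI) (auto simp: U_def)
  also have "\<dots> \<le> emeasure (\<nu> \<Otimes>\<^sub>M \<sigma>) ((\<lambda>(r, \<phi>). r *\<^sub>R \<phi>) -` ball v e \<inter> space (\<nu> \<Otimes>\<^sub>M \<sigma>))"
    using u dist by (intro emeasure_mono measurable_sets[OF measurable_polar])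
      (auto simp: space_pair_measure space_nu space_sigma U_def simp del: mem_ball)
  also have "\<dots> = emeasure \<mu> (ext_vec ` ball v e)"
    using assms by (intro polar_emeasure[symmetric]) auto
  finally show ?thesis .
qed

text \<open>
Only countably many concentric spheres around \<open>v\<close> can have positive mass, so there are arbitrarily
small balls around \<open>v\<close> that are continuity sets of \<open>\<mu>\<close>.
\<close>

lemma mu_null_sphere:
  assumes "0 < e" "e < norm v"
  obtains e' where "0 < e'" "e' < e" "emeasure \<mu> (ext_vec ` sphere v e') = 0"
proof -
  let ?N = "\<nu> \<Otimes>\<^sub>M \<sigma>" and ?f = "\<lambda>(r, \<phi>). r *\<^sub>R (\<phi> :: real^'d)"
  define D where "D = ?f -` ball v e \<inter> space ?N"
  have D: "D \<in> sets ?N" unfolding D_def by (rule measurable_sets[OF measurable_polar]) simp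
  have Dfin: "emeasure ?N D < \<infinity>"
    using mu_ball_finite[OF assms(2)] polar_emeasure[of "ball v e"] assms by (simp add: D_def)
  let ?R = "restrict_space ?N D"
  have spR: "space ?R = D" using D sets.sets_into_space[OF D] by (auto simp: space_restrict_space)
  have R: "finite_measure ?R"
    using Dfin D by (intro finite_measureI) (simp add: spR emeasure_restrict_space)
  have g: "(\<lambda>z. dist v (?f z)) \<in> borel_measurable ?R"
    using measurable_polar by (intro measurable_restrict_space1 borel_measurable_dist) auto
  interpret Q: finite_measure "distr ?R borel (\<lambda>z. dist v (?f z))"
    by (rule finite_measure.finite_measure_distr[OF R g])
  have "\<exists>t. t \<in> {0<..<e} - {t. measure (distr ?R borel (\<lambda>z. dist v (?f z))) {t} \<noteq> 0}"
    using uncountable_minus_countable[OF _ Q.countable_support, of "{0<..<e}"] assms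
      uncountable_open_interval[of 0 e] by (metis countable_empty ex_in_conv)
  then obtain t where t: "0 < t" "t < e" "measure (distr ?R borel (\<lambda>z. dist v (?f z))) {t} = 0" by auto
  have "0 = emeasure (distr ?R borel (\<lambda>z. dist v (?f z))) {t}"
    using t(3) by (simp add: Q.emeasure_eq_measure)
  also have "\<dots> = emeasure ?R ((\<lambda>z. dist v (?f z)) -` {t} \<inter> D)"
    using g by (subst emeasure_distr) (auto simp: spR)
  also have "\<dots> = emeasure ?N ((\<lambda>z. dist v (?f z)) -` {t} \<inter> D)"
    using D by (intro emeasure_restrict_space) auto
  also have "(\<lambda>z. dist v (?f z)) -` {t} \<inter> D = ?f -` sphere v t \<inter> space ?N"
    using t by (auto simp: D_def)
  also have "emeasure ?N \<dots> = emeasure \<mu> (ext_vec ` sphere v t)"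
    using assms t by (intro polar_emeasure[symmetric]) auto
  finally show ?thesis using that[of t] t by simp
qed

end

text \<open>
The vague convergence is evaluated on two families of continuity sets: the complements of centred
balls describe the tail of the norm, and small balls away from the origin describe the directions.
\<close>

lemma regularly_varying_norm_and_ball_limits:
  fixes X :: "'w \<Rightarrow> real^'d"
  assumes M: "prob_space M" and X[measurable]: "X \<in> borel_measurable M" and alpha: "0 < \<alpha>"
    and rv: "regularly_varying M X \<alpha> \<mu>" and ang: "angular_measure \<alpha> \<mu> \<sigma>"
    and pos: "\<And>U. openin (top_of_set (sphere 0 1)) U \<Longrightarrow> U \<noteq> {} \<Longrightarrow> 0 < emeasure \<sigma> U"
  obtains a :: "nat \<Rightarrow> real" and c where
    "incseq a" "\<And>n. 0 < a n" "filterlim a at_top sequentially" "0 < c"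
    "\<And>s. 0 < s \<Longrightarrow> (\<lambda>n. real n * measure M {\<omega> \<in> space M. a n * s < norm (X \<omega>)}) \<longlonglongrightarrow> c * s powr - \<alpha>"
    "\<And>v e. v \<noteq> 0 \<Longrightarrow> 0 < e \<Longrightarrow> \<exists>e' m. 0 < e' \<and> e' < e \<and> 0 < m \<and>
       (\<lambda>n. real n * measure M {\<omega> \<in> space M. X \<omega> /\<^sub>R a n \<in> ball v e'}) \<longlonglongrightarrow> m"
proof -
  interpret prob_space M by (rule M)
  obtain \<nu> :: "real measure" where nu: "sets \<nu> = sets (restrict_space borel {0<..})"
    "\<And>x. 0 < x \<Longrightarrow> emeasure \<nu> {x<..} = ennreal (x powr - \<alpha>)"
    "\<And>C. C \<in> sets (\<nu> \<Otimes>\<^sub>M \<sigma>) \<Longrightarrow>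
      emeasure \<mu> (ext_vec ` {x. x \<noteq> 0 \<and> (norm x, x /\<^sub>R norm x) \<in> C}) = emeasure (\<nu> \<Otimes>\<^sub>M \<sigma>) C"
    using ang unfolding angular_measure_def by blast
  have sets_mu: "sets \<mu> = sets (restrict_space borel (- {0}))"
    using rv unfolding regularly_varying_def radon_measure_on_def by blast
  have sets_sigma: "sets \<sigma> = sets (restrict_space borel (sphere 0 1))"
    and sigma_fin: "emeasure \<sigma> (sphere 0 1) < \<infinity>"
    using ang unfolding angular_measure_def radon_measure_on_def by auto
  note facts = alpha sets_mu sets_sigma sigma_fin pos nu
  have inf_null: "emeasure \<mu> (- range ext_vec) = 0"
    using rv unfolding regularly_varying_def by blast
  obtain a :: "nat \<Rightarrow> real" where a: "incseq a" "\<And>n. 0 < a n" "filterlim a at_top sequentially"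
    and lim: "\<And>B. B \<in> sets borel \<Longrightarrow> 0 \<notin> closure B \<Longrightarrow> emeasure \<mu> (frontier B) = 0 \<Longrightarrow>
       (\<lambda>n. ennreal (real n * prob {\<omega> \<in> space M. ext_vec (X \<omega> /\<^sub>R a n) \<in> B})) \<longlonglongrightarrow> emeasure \<mu> B"
    using rv unfolding regularly_varying_def by blast
  have null_mono: "emeasure \<mu> F = 0" if "F \<subseteq> G" "emeasure \<mu> G = 0" "G \<in> sets \<mu>" for F G
    using emeasure_mono[OF that(1,3)] that(2) by simp
  have sphere_sets: "ext_vec ` sphere v e \<in> sets \<mu>" if "e \<noteq> norm v" for v :: "real^'d" and e
  proof -
    have "ext_vec ` sphere v e = ext_vec ` cball v e - ext_vec ` ball v e"
      by (simp only: image_set_diff[OF inj_ext_vec, symmetric] cball_diff_eq_sphere)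
    moreover have "ext_vec ` cball v e \<in> sets borel" "ext_vec ` ball v e \<in> sets borel"
      using closed_ext_vec_cball[of v e] open_ext_vec_image[of "ball v e"]
      by (auto intro: borel_closed borel_open)
    ultimately have "ext_vec ` sphere v e \<in> sets borel" by auto
    then show ?thesis
      using that by (intro sets_muI[OF facts]) (auto simp: ext_vec_eq_0_iff eq_commute[of 0])
  qed
  define c where "c = measure \<sigma> (sphere 0 1)"
  have ec: "emeasure \<sigma> (sphere 0 1) = ennreal c"
    unfolding c_def using sigma_fin by (intro emeasure_eq_ennreal_measure) auto
  have c: "0 < c" using sigma_sphere_pos[OF facts] unfolding ec by simp
  show ?thesis
  proof (rule that[OF a c])
    fix s :: real assume s: "0 < s"
    define B where "B = - ext_vec ` cball (0::real^'d) s"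
    have "emeasure \<mu> (frontier B) = 0"
      unfolding B_def using mu_centered_sphere[OF facts s] sphere_sets[of s 0] s
      by (intro null_mono[OF frontier_compl_ext_vec_cball]) auto
    moreover have "0 \<notin> closure B"
    proof -
      have "closure B \<subseteq> - ext_vec ` ball 0 s"
        unfolding B_def using open_ext_vec_image[of "ball 0 s"] by (intro closure_minimal) (auto simp: closed_Compl)
      moreover have "0 \<in> ext_vec ` ball (0::real^'d) s"
        using s ext_vec_mem_image_iff[of 0 "ball 0 s"] by simp
      ultimately show ?thesis by blast
    qed
    moreover have "B \<in> sets borel" unfolding B_def using closed_ext_vec_cball by (intro borel_open) (auto simp: open_Compl)
    ultimately have "(\<lambda>n. ennreal (real n * prob {\<omega> \<in> space M. ext_vec (X \<omega> /\<^sub>R a n) \<in> B})) \<longlonglongrightarrow> emeasure \<mu> B"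
      by (intro lim)
    also have "emeasure \<mu> B = ennreal (c * s powr - \<alpha>)"
    proof -
      have "B = ext_vec ` {x. s < norm x} \<union> - range ext_vec"
        unfolding B_def by (auto simp: not_le dest!: injD[OF inj_ext_vec])
      moreover have "- range ext_vec \<in> null_sets \<mu>"
      proof (rule null_setsI[OF inf_null])
        have "- range (ext_vec :: real^'d \<Rightarrow> _) \<in> sets borel"
          using open_ext_vec_image[of "UNIV :: (real^'d) set"] by (intro borel_comp borel_open) simp
        then show "- range (ext_vec :: real^'d \<Rightarrow> _) \<in> sets \<mu>"
          by (intro sets_muI[OF facts]) auto
      qed
      moreover have "ext_vec ` {x::real^'d. s < norm x} \<in> sets \<mu>"
        using s by (intro open_ext_vec_sets_mu[OF facts] open_Collect_less continuous_intros) auto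
      ultimately have "emeasure \<mu> B = emeasure \<mu> (ext_vec ` {x. s < norm x})"
        by (simp add: emeasure_Un_null_set)
      then show ?thesis using mu_outside_ball[OF facts s] c
        by (simp add: ec ennreal_mult mult.commute)
    qed
    also have "(\<lambda>n. ennreal (real n * prob {\<omega> \<in> space M. ext_vec (X \<omega> /\<^sub>R a n) \<in> B}))
      = (\<lambda>n. ennreal (real n * prob {\<omega> \<in> space M. a n * s < norm (X \<omega>)}))"
    proof -
      have "ext_vec (x /\<^sub>R a n) \<in> B \<longleftrightarrow> a n * s < norm x" for x n
        using a(2)[of n] by (simp add: B_def not_le field_simps)
      then show ?thesis by simp
    qed
    finally show "(\<lambda>n. real n * prob {\<omega> \<in> space M. a n * s < norm (X \<omega>)}) \<longlonglongrightarrow> c * s powr - \<alpha>"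
      using c by (elim tendsto_ennrealD) auto
  next
    fix v :: "real^'d" and e :: real assume v: "v \<noteq> 0" and e: "0 < e"
    define e0 where "e0 = min e (norm v / 2)"
    have e0: "0 < e0" "e0 < norm v" "e0 \<le> e" using v e by (auto simp: e0_def min_def)
    obtain e' where e': "0 < e'" "e' < e0" "emeasure \<mu> (ext_vec ` sphere v e') = 0"
      using mu_null_sphere[OF facts e0(1,2)] by metis
    let ?B = "ext_vec ` ball v e'"
    define m where "m = measure \<mu> ?B"
    have em: "emeasure \<mu> ?B = ennreal m"
      unfolding m_def using mu_ball_finite[OF facts, of e' v] e' e0 by (intro emeasure_eq_ennreal_measure) auto
    have m: "0 < m" using mu_ball_pos[OF facts, of e' v] e' e0 unfolding em by simp
    have "emeasure \<mu> (frontier ?B) = 0"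
      using e' e0 sphere_sets[of e' v] by (intro null_mono[OF frontier_ext_vec_ball]) auto
    moreover have "0 \<notin> closure ?B"
    proof -
      have "closure ?B \<subseteq> ext_vec ` cball v e'"
        by (intro closure_minimal closed_ext_vec_cball image_mono ball_subset_cball)
      moreover have "0 \<notin> ext_vec ` cball v e'"
        using e' e0 by (auto simp: ext_vec_eq_0_iff eq_commute[of 0])
      ultimately show ?thesis by blast
    qed
    moreover have "?B \<in> sets borel" using open_ext_vec_image[of "ball v e'"] by (intro borel_open) auto
    ultimately have "(\<lambda>n. ennreal (real n * prob {\<omega> \<in> space M. ext_vec (X \<omega> /\<^sub>R a n) \<in> ?B})) \<longlonglongrightarrow> ennreal m"
      unfolding em[symmetric] by (intro lim)
    then have "(\<lambda>n. real n * prob {\<omega> \<in> space M. X \<omega> /\<^sub>R a n \<in> ball v e'}) \<longlonglongrightarrow> m"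
      unfolding ext_vec_mem_image_iff using m by (elim tendsto_ennrealD) auto
    then show "\<exists>e' m. 0 < e' \<and> e' < e \<and> 0 < m \<and>
       (\<lambda>n. real n * prob {\<omega> \<in> space M. X \<omega> /\<^sub>R a n \<in> ball v e'}) \<longlonglongrightarrow> m"
      using e' e0 m by (intro exI[of _ e'] exI[of _ m]) auto
  qed
qed

section \<open>Power bounds for regularly varying tails\<close>

text \<open>
Transfers statements along a sequence to all large reals: \<open>t\<close> is compared with the neighbouring terms
\<open>a n\<close> and \<open>a (Suc n)\<close>.
\<close>

lemma bracket_seq:
  fixes a :: "nat \<Rightarrow> real"
  assumes "filterlim a at_top sequentially" "a N \<le> t"
  obtains n where "N \<le> n" "a n \<le> t" "t < a (Suc n)"
proof -
  have "eventually (\<lambda>n. t < a n) sequentially" using assms(1) by (simp add: filterlim_at_top_dense)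
  then obtain n0 where "N \<le> n0" "t < a n0" unfolding eventually_sequentially by (metis max.cobounded1 max.cobounded2)
  then have "\<exists>k. t < a (N + k)" by (metis le_add_diff_inverse)
  define k where "k = (LEAST k. t < a (N + k))"
  have k: "t < a (N + k)" unfolding k_def using \<open>\<exists>k. t < a (N + k)\<close> by (rule LeastI_ex)
  have "k \<noteq> 0" using k assms(2) by (intro notI) simp
  then obtain j where j: "k = Suc j" by (cases k) auto
  have "a (N + j) \<le> t" using not_less_Least[of j "\<lambda>k. t < a (N + k)"] j by (simp add: k_def)
  then show ?thesis using that[of "N + j"] k j by simp
qed

lemma filterlim_power2_mult:
  assumes "0 < T"
  shows "filterlim (\<lambda>k. 2 ^ k * T :: real) at_top sequentially"
  unfolding filterlim_at_top_dense eventually_sequentially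
proof
  fix Z
  obtain N where N: "Z / T < 2 ^ N" using real_arch_pow[of 2 "Z / T"] by auto
  have "Z < 2 ^ n * T" if "N \<le> n" for n
  proof -
    have "Z / T < 2 ^ n" using N power_increasing[OF that, of "2::real"] by linarith
    then show ?thesis using assms by (simp add: field_simps)
  qed
  then show "\<exists>N. \<forall>n\<ge>N. Z < 2 ^ n * T" by blast
qed

lemma eventually_less_of_limits:
  fixes f g :: "nat \<Rightarrow> real"
  assumes "f \<longlonglongrightarrow> l" "g \<longlonglongrightarrow> l'" "l < l'"
  shows "eventually (\<lambda>n. f n < g n) sequentially"
proof -
  obtain z where "l < z" "z < l'" using dense[OF assms(3)] by blast
  then show ?thesis
    using order_tendstoD(2)[OF assms(1), of z] order_tendstoD(1)[OF assms(2), of z]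
    by (auto elim: eventually_elim2)
qed

text \<open>
Regular variation of a tail as it is given by the vague convergence: a limit along a norming
sequence that may have irregular gaps.
\<close>

locale regular_tail =
  fixes V :: "real \<Rightarrow> real" and a :: "nat \<Rightarrow> real" and c \<alpha> :: real
  assumes antimono: "\<And>s t. s \<le> t \<Longrightarrow> V t \<le> V s" and nonneg: "\<And>t. 0 \<le> V t" and le1: "\<And>t. V t \<le> 1"
    and a_inc: "incseq a" and a_pos: "\<And>n. 0 < a n" and a_top: "filterlim a at_top sequentially"
    and c: "0 < c" and alpha: "0 < \<alpha>"
    and lim: "\<And>s. 0 < s \<Longrightarrow> (\<lambda>n. real n * V (a n * s)) \<longlonglongrightarrow> c * s powr - \<alpha>"
begin

lemma lim_Suc:
  assumes "0 < s"
  shows "(\<lambda>n. real n * V (a (Suc n) * s)) \<longlonglongrightarrow> c * s powr - \<alpha>"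
proof -
  have "(\<lambda>n. real n / real (Suc n) * (real (Suc n) * V (a (Suc n) * s))) \<longlonglongrightarrow> 1 * (c * s powr - \<alpha>)"
    by (rule tendsto_mult[OF LIMSEQ_n_over_Suc_n LIMSEQ_Suc[OF lim[OF assms]]])
  then show ?thesis by (simp del: of_nat_Suc)
qed

text \<open>
If \<open>a (Suc n)\<close> exceeded \<open>s * a n\<close> infinitely often, monotonicity of the tail would give
$c \le c s^{- \alpha}$ for the limits along \<open>a (Suc n)\<close> and \<open>s * a n\<close>.
\<close>

lemma ratio_tendsto_1:
  assumes "1 < s"
  shows "eventually (\<lambda>n. a (Suc n) \<le> s * a n) sequentially"
proof -
  have "s powr - \<alpha> < 1" using assms alpha by (simp add: powr_less_one)
  then have "eventually (\<lambda>n. real n * V (a n * s) < real n * V (a (Suc n) * 1)) sequentially"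
    by (intro eventually_less_of_limits[OF lim[of s] lim_Suc[of 1]]) (use assms c in auto)
  then show ?thesis
  proof eventually_elim
    case (elim n)
    show ?case
    proof (rule ccontr)
      assume "\<not> a (Suc n) \<le> s * a n"
      then have "V (a (Suc n) * 1) \<le> V (a n * s)" by (intro antimono) (simp add: mult.commute)
      then show False using elim by (auto simp: mult_less_cancel_left not_less dest: mult_left_mono)
    qed
  qed
qed

text \<open>
Comparing with the limit relation at the two neighbours of $t$ yields
$V (2 t) \le 2^{- q} V (t)$ for all large $t$, and doubling repeatedly turns this into a power bound.
The opposite bound below is obtained in the same way.
\<close>

lemma upper_power_bound:
  assumes q: "0 < q" "q < \<alpha>"
  obtains C where "0 \<le> C" "\<And>t. 0 < t \<Longrightarrow> V t \<le> C * t powr - q"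
proof -
  have "(2::real) powr - \<alpha> < 2 powr - q" using q by simp
  then have "eventually (\<lambda>n. real n * V (a n * 2) < 2 powr - q * (real n * V (a (Suc n) * 1))) sequentially"
    by (intro eventually_less_of_limits[OF lim[of 2] tendsto_mult_left[OF lim_Suc[of 1], of "2 powr - q"]])
      (use c in auto)
  then obtain N where N: "\<And>n. N \<le> n \<Longrightarrow> real n * V (a n * 2) < 2 powr - q * (real n * V (a (Suc n) * 1))"
    unfolding eventually_sequentially by blast
  define T where "T = a N"
  have T: "0 < T" using a_pos by (simp add: T_def)
  have step: "V (2 * t) \<le> 2 powr - q * V t" if tT: "T \<le> t" for t
  proof -
    obtain n where n: "N \<le> n" "a n \<le> t" "t < a (Suc n)"
      by (rule bracket_seq[OF a_top tT[unfolded T_def]]) (rule that; assumption)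
    have n0: "0 < real n" using N[OF n(1)] by (cases "n = 0") auto
    then have "V (a n * 2) \<le> 2 powr - q * V (a (Suc n))" using N[OF n(1)] by (simp add: algebra_simps)
    moreover have "V (2 * t) \<le> V (a n * 2)" using n by (intro antimono) simp
    moreover have "2 powr - q * V (a (Suc n)) \<le> 2 powr - q * V t"
      using n by (intro mult_left_mono antimono) auto
    ultimately show ?thesis by linarith
  qed
  have iter: "V (2 ^ k * T) \<le> (2 ^ k) powr - q" for k
  proof (induction k)
    case 0
    then show ?case using le1 by simp
  next
    case (Suc k)
    have "T \<le> 2 ^ k * T" using T by simp
    then have "V (2 * (2 ^ k * T)) \<le> 2 powr - q * V (2 ^ k * T)" by (rule step)
    also have "\<dots> \<le> 2 powr - q * (2 ^ k) powr - q" using Suc by (intro mult_left_mono) auto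
    also have "\<dots> = (2 ^ Suc k) powr - q" by (simp add: powr_mult)
    finally show ?case by (simp add: mult.assoc)
  qed
  show ?thesis
  proof (rule that[of "(2 * T) powr q"])
    fix t :: real assume t: "0 < t"
    have eq: "(2 * T) powr q * t powr - q = (t / (2 * T)) powr - q"
      using t T by (simp add: powr_divide powr_minus divide_simps)
    show "V t \<le> (2 * T) powr q * t powr - q"
    proof (cases "t < T")
      case True
      have "1 \<le> (t / (2 * T)) powr - q"
        using True t T q powr_mono2'[of "- q" "t / (2 * T)" 1] by (simp add: field_simps)
      then show ?thesis using eq le1[of t] by linarith
    next
      case False
      have "filterlim (\<lambda>k. 2 ^ k * T) at_top sequentially"
        by (rule filterlim_power2_mult[OF T])
      then obtain k where k: "2 ^ k * T \<le> t" "t < 2 ^ Suc k * T"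
        using bracket_seq[of "\<lambda>k. 2 ^ k * T" 0 t] False by auto
      have "V t \<le> V (2 ^ k * T)" using k by (intro antimono)
      also have "\<dots> \<le> (2 ^ k) powr - q" by (rule iter)
      also have "\<dots> \<le> (t / (2 * T)) powr - q"
        using k(2) t T q by (intro powr_mono2') (auto simp: field_simps)
      finally show ?thesis using eq by simp
    qed
  qed simp
qed

lemma lower_power_bound:
  assumes q: "\<alpha> < q"
  obtains b T where "0 < b" "0 < T" "\<And>t. T \<le> t \<Longrightarrow> b * t powr - q \<le> V t"
proof -
  have "(2::real) powr - q < 2 powr - \<alpha>" using q by simp
  then have "eventually (\<lambda>n. 2 powr - q * (real n * V (a n * 1)) < real n * V (a (Suc n) * 2)) sequentially"
    by (intro eventually_less_of_limits[OF tendsto_mult_left[OF lim[of 1], of "2 powr - q"] lim_Suc[of 2]])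
      (use c in auto)
  then obtain N where N: "\<And>n. N \<le> n \<Longrightarrow> 2 powr - q * (real n * V (a n * 1)) < real n * V (a (Suc n) * 2)"
    unfolding eventually_sequentially by blast
  define T where "T = a N"
  have T: "0 < T" using a_pos by (simp add: T_def)
  have step: "2 powr - q * V t \<le> V (2 * t)" if tT: "T \<le> t" for t
  proof -
    obtain n where n: "N \<le> n" "a n \<le> t" "t < a (Suc n)"
      by (rule bracket_seq[OF a_top tT[unfolded T_def]]) (rule that; assumption)
    have n0: "0 < real n" using N[OF n(1)] by (cases "n = 0") auto
    then have "2 powr - q * V (a n) \<le> V (a (Suc n) * 2)" using N[OF n(1)] by (simp add: algebra_simps)
    moreover have "V (a (Suc n) * 2) \<le> V (2 * t)" using n by (intro antimono) simp
    moreover have "2 powr - q * V t \<le> 2 powr - q * V (a n)"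
      using n by (intro mult_left_mono antimono) auto
    ultimately show ?thesis by linarith
  qed
  have VT: "0 < V T"
  proof -
    have "0 \<le> 2 powr - q * (real N * V (a N * 1))" using nonneg by simp
    then have "0 < real N * V (a (Suc N) * 2)" using N[of N] by linarith
    then have "0 < V (a (Suc N) * 2)" using nonneg by (simp add: zero_less_mult_iff)
    also have "\<dots> \<le> V T" unfolding T_def using incseq_SucD[OF a_inc, of N] a_pos[of "Suc N"] by (intro antimono) linarith
    finally show ?thesis .
  qed
  have iter: "(2 ^ k) powr - q * V T \<le> V (2 ^ k * T)" for k
  proof (induction k)
    case (Suc k)
    have "T \<le> 2 ^ k * T" using T by simp
    then have *: "2 powr - q * V (2 ^ k * T) \<le> V (2 * (2 ^ k * T))" by (rule step)
    have "(2 ^ Suc k) powr - q * V T = 2 powr - q * ((2 ^ k) powr - q * V T)" by (simp add: powr_mult)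
    also have "\<dots> \<le> 2 powr - q * V (2 ^ k * T)" using Suc by (intro mult_left_mono) auto
    finally show ?case using * by (simp add: mult.assoc)
  qed simp
  show ?thesis
  proof (rule that[of "V T * (2 / T) powr - q" T])
    fix t :: real assume t: "T \<le> t"
    have "filterlim (\<lambda>k. 2 ^ k * T) at_top sequentially"
      by (rule filterlim_power2_mult[OF T])
    then obtain k where k: "2 ^ k * T \<le> t" "t < 2 ^ Suc k * T"
      using bracket_seq[of "\<lambda>k. 2 ^ k * T" 0 t] t by auto
    have "V T * (2 / T) powr - q * t powr - q = (2 / T * t) powr - q * V T"
    proof -
      have "(2 / T * t) powr - q = (2 / T) powr - q * t powr - q"
        using t T by (subst powr_mult) auto
      then show ?thesis by simp
    qed
    also have "\<dots> \<le> (2 ^ Suc k) powr - q * V T"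
      using k T q alpha VT by (intro mult_right_mono powr_mono2') (auto simp: field_simps)
    also have "\<dots> \<le> V (2 ^ Suc k * T)" by (rule iter)
    also have "\<dots> \<le> V t" using k by (intro antimono) simp
    finally show "V T * (2 / T) powr - q * t powr - q \<le> V t" .
  qed (use VT T in auto)
qed

end

text \<open>
The limit relation gives a probability of order $1 / n$, hence comparable to the tail of the norm, for
a ball at scale \<open>a n\<close>.  As \<open>a (Suc n) / a n\<close> tends to $1$, a slightly larger ball at scale \<open>t\<close>
contains it.  A centre at the origin is covered by moving it a little.
\<close>

lemma (in prob_space) ball_prob_power_bound:
  fixes X :: "'a \<Rightarrow> 'b::euclidean_space"
  assumes [measurable]: "X \<in> borel_measurable M"
    and tail: "regular_tail (\<lambda>t. prob {\<omega> \<in> space M. t < norm (X \<omega>)}) a c \<alpha>"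
    and balls: "\<And>v e. v \<noteq> 0 \<Longrightarrow> 0 < e \<Longrightarrow> \<exists>e' m. 0 < e' \<and> e' < e \<and> 0 < m \<and>
       (\<lambda>n. real n * prob {\<omega> \<in> space M. X \<omega> /\<^sub>R a n \<in> ball v e'}) \<longlonglongrightarrow> m"
    and q: "\<alpha> < q" and e: "0 < e"
  obtains b T where "0 < b" "0 < T" "\<And>t. T \<le> t \<Longrightarrow> b * t powr - q \<le> prob {\<omega> \<in> space M. X \<omega> \<in> ball (t *\<^sub>R v) (t * e)}"
proof -
  let ?V = "\<lambda>t. prob {\<omega> \<in> space M. t < norm (X \<omega>)}"
  interpret regular_tail ?V a c \<alpha> by (rule tail)
  obtain v' where v': "v' \<noteq> 0" "norm (v' - v) < e / 2"
  proof (cases "v = 0")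
    case True
    obtain u :: 'b where "norm u = e / 4" using vector_choose_size[of "e / 4"] e by auto
    then show ?thesis using True e by (intro that[of u]) auto
  qed (use that[of v] e in auto)
  obtain e' m where e': "0 < e'" "e' < e / 4" "0 < m"
    and m: "(\<lambda>n. real n * prob {\<omega> \<in> space M. X \<omega> /\<^sub>R a n \<in> ball v' e'}) \<longlonglongrightarrow> m"
    using balls[OF v'(1), of "e / 4"] e by auto
  \<comment> \<open>With this ratio the centres at scales \<open>t\<close> and \<open>a n\<close> differ by at most \<open>a n * (e / 4)\<close>.\<close>
  define s where "s = 1 + e / (4 * norm v')"
  have s: "1 < s" using e v' by (simp add: s_def)
  have "eventually (\<lambda>n. a (Suc n) \<le> s * a n) sequentially" by (rule ratio_tendsto_1[OF s])
  moreover have "eventually (\<lambda>n. m / 2 < real n * prob {\<omega> \<in> space M. X \<omega> /\<^sub>R a n \<in> ball v' e'}) sequentially"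
    using m e' by (intro order_tendstoD) auto
  moreover have "eventually (\<lambda>n. real n * ?V (a n * 1) < 2 * c) sequentially"
    using lim[of 1] c by (intro order_tendstoD) auto
  ultimately have "eventually (\<lambda>n. a (Suc n) \<le> s * a n \<and>
      m / 2 < real n * prob {\<omega> \<in> space M. X \<omega> /\<^sub>R a n \<in> ball v' e'} \<and> real n * ?V (a n * 1) < 2 * c) sequentially"
    by eventually_elim auto
  then obtain N where N: "\<And>n. N \<le> n \<Longrightarrow> a (Suc n) \<le> s * a n"
      "\<And>n. N \<le> n \<Longrightarrow> m / 2 < real n * prob {\<omega> \<in> space M. X \<omega> /\<^sub>R a n \<in> ball v' e'}"
      "\<And>n. N \<le> n \<Longrightarrow> real n * ?V (a n) < 2 * c"
    unfolding eventually_sequentially by auto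
  obtain b T where b: "0 < b" "0 < T" "\<And>t. T \<le> t \<Longrightarrow> b * t powr - q \<le> ?V t"
    by (rule lower_power_bound[OF q]) (rule that; assumption)
  show ?thesis
  proof (rule that[of "m / (4 * c) * b" "max T (a N)"])
    show "0 < m / (4 * c) * b" using e' c b by simp
    show "0 < max T (a N)" using b by simp
    fix t assume t: "max T (a N) \<le> t"
    obtain n where n: "N \<le> n" "a n \<le> t" "t < a (Suc n)"
      using bracket_seq[OF a_top, of N t] t by auto
    have n0: "0 < real n" using N(2)[OF n(1)] e' by (cases "n = 0") auto
    have an: "0 < a n" by (rule a_pos)
    then have t0: "0 < t" using n by linarith
    have "m / (4 * c) * b * t powr - q \<le> m / (4 * c) * ?V t"
      using b(3)[of t] t e' c by (simp add: mult.assoc divide_right_mono mult_left_mono)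
    also have "\<dots> \<le> m / (4 * c) * ?V (a n)"
      using n e' c by (intro mult_left_mono antimono) auto
    also have "\<dots> \<le> m / (4 * c) * (2 * c / real n)"
      using N(3)[OF n(1)] n0 e' c by (intro mult_left_mono) (auto simp: field_simps)
    also have "\<dots> = m / 2 / real n" using c by simp
    also have "\<dots> \<le> prob {\<omega> \<in> space M. X \<omega> /\<^sub>R a n \<in> ball v' e'}"
      using N(2)[OF n(1)] n0 by (simp add: field_simps)
    also have "\<dots> \<le> prob {\<omega> \<in> space M. X \<omega> \<in> ball (t *\<^sub>R v) (t * e)}"
    proof (intro finite_measure_mono subsetI)
      fix \<omega> assume "\<omega> \<in> {\<omega> \<in> space M. X \<omega> /\<^sub>R a n \<in> ball v' e'}"
      then have \<omega>: "\<omega> \<in> space M" "norm (v' - X \<omega> /\<^sub>R a n) < e'" by (auto simp: dist_norm)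
      have "a n *\<^sub>R v' - X \<omega> = a n *\<^sub>R (v' - X \<omega> /\<^sub>R a n)" using an by (simp add: algebra_simps)
      then have 1: "norm (a n *\<^sub>R v' - X \<omega>) \<le> a n * e'"
        using \<omega>(2) an by simp
      have 2: "norm (t *\<^sub>R v' - a n *\<^sub>R v') \<le> a n * (e / 4)"
      proof -
        have "norm (t *\<^sub>R v' - a n *\<^sub>R v') = (t - a n) * norm v'"
          using n(2) by (simp add: scaleR_diff_left[symmetric])
        also have "\<dots> \<le> (s * a n - a n) * norm v'"
          using N(1)[OF n(1)] n(3) by (intro mult_right_mono) auto
        also have "\<dots> = a n * (e / 4)" using v'(1) by (simp add: s_def field_simps)
        finally show ?thesis .
      qed
      have 3: "norm (t *\<^sub>R v - t *\<^sub>R v') < t * (e / 2)"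
        using v'(2) t0 by (simp add: scaleR_diff_right[symmetric] norm_minus_commute)
      have "norm (t *\<^sub>R v - X \<omega>) \<le> norm (t *\<^sub>R v - t *\<^sub>R v') + norm (t *\<^sub>R v' - a n *\<^sub>R v') + norm (a n *\<^sub>R v' - X \<omega>)"
        using norm_triangle_ineq[of "t *\<^sub>R v - t *\<^sub>R v'" "(t *\<^sub>R v' - a n *\<^sub>R v') + (a n *\<^sub>R v' - X \<omega>)"]
          norm_triangle_ineq[of "t *\<^sub>R v' - a n *\<^sub>R v'" "a n *\<^sub>R v' - X \<omega>"] by simp
      also have "\<dots> < t * (e / 2) + a n * (e / 4) + a n * (e / 4)"
        using 1 2 3 e'(2) an mult_strict_left_mono[OF e'(2) an] by linarith
      also have "\<dots> \<le> t * (e / 2) + t * (e / 4) + t * (e / 4)"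
        using n(2) e by (intro add_mono mult_right_mono) auto
      also have "\<dots> = t * e" by simp
      finally show "\<omega> \<in> {\<omega> \<in> space M. X \<omega> \<in> ball (t *\<^sub>R v) (t * e)}"
        using \<omega>(1) by (simp add: dist_norm)
    qed (use measurable_sets[OF assms(1), of "ball (t *\<^sub>R v) (t * e)"] in \<open>simp add: vimage_def Int_def conj_commute\<close>)
    finally show "m / (4 * c) * b * t powr - q \<le> prob {\<omega> \<in> space M. X \<omega> \<in> ball (t *\<^sub>R v) (t * e)}" .
  qed
qed

section \<open>Geometric grids and the logarithmic rate\<close>

text \<open>
An integer version of the times $m r^j$.  Rounding up at each step loses only a bounded factor in
total, since the rounding errors form a geometric series.
\<close>

fun geometric_grid :: "real \<Rightarrow> nat \<Rightarrow> nat \<Rightarrow> nat" where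
  "geometric_grid r m 0 = m"
| "geometric_grid r m (Suc j) = nat \<lceil>r * real (geometric_grid r m j)\<rceil>"

lemma geometric_grid_Suc_bounds:
  assumes "1 < r"
  shows "r * real (geometric_grid r m j) \<le> real (geometric_grid r m (Suc j))"
    and "real (geometric_grid r m (Suc j)) \<le> r * real (geometric_grid r m j) + 1"
proof -
  have "0 \<le> r * real (geometric_grid r m j)" using assms by simp
  then show "r * real (geometric_grid r m j) \<le> real (geometric_grid r m (Suc j))"
    and "real (geometric_grid r m (Suc j)) \<le> r * real (geometric_grid r m j) + 1"
    by (simp_all add: le_of_int_ceiling of_int_ceiling_le_add_one)
qed

lemma geometric_grid_ge:
  assumes "1 < r"
  shows "real m * r ^ j \<le> real (geometric_grid r m j)"
proof (induction j)
  case (Suc j)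
  have "real m * r ^ Suc j = r * (real m * r ^ j)" by simp
  also have "\<dots> \<le> r * real (geometric_grid r m j)" using Suc assms by (intro mult_left_mono) auto
  also have "\<dots> \<le> real (geometric_grid r m (Suc j))" by (rule geometric_grid_Suc_bounds(1)[OF assms])
  finally show ?case .
qed simp

lemma geometric_grid_le:
  assumes "1 < r"
  shows "real (geometric_grid r m j) \<le> (real m + 1 / (r - 1)) * r ^ j"
proof -
  have "real (geometric_grid r m j) + 1 / (r - 1) \<le> (real m + 1 / (r - 1)) * r ^ j"
  proof (induction j)
    case (Suc j)
    have "real (geometric_grid r m (Suc j)) + 1 / (r - 1) \<le> r * real (geometric_grid r m j) + 1 + 1 / (r - 1)"
      using geometric_grid_Suc_bounds(2)[OF assms, of m j] by linarith
    also have "\<dots> = r * (real (geometric_grid r m j) + 1 / (r - 1))"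
      using assms by (simp add: field_simps)
    also have "\<dots> \<le> r * ((real m + 1 / (r - 1)) * r ^ j)"
      using Suc assms by (intro mult_left_mono) auto
    also have "\<dots> = (real m + 1 / (r - 1)) * r ^ Suc j" by simp
    finally show ?case .
  qed simp
  moreover have "0 \<le> 1 / (r - 1)" using assms by simp
  ultimately show ?thesis by linarith
qed

lemma geometric_grid_pos:
  assumes "1 < r" "1 \<le> m"
  shows "m \<le> geometric_grid r m j" "1 \<le> geometric_grid r m j"
proof -
  have "real m * 1 \<le> real m * r ^ j" using assms by (intro mult_left_mono one_le_power) auto
  then have "real m \<le> real (geometric_grid r m j)" using geometric_grid_ge[OF assms(1), of m j] by simp
  then show "m \<le> geometric_grid r m j" by simp
  then show "1 \<le> geometric_grid r m j" using assms by linarith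
qed

lemma geometric_grid_less_Suc:
  assumes "1 < r" "1 \<le> m"
  shows "geometric_grid r m j < geometric_grid r m (Suc j)"
proof -
  have "1 * real (geometric_grid r m j) < r * real (geometric_grid r m j)"
    using assms geometric_grid_pos(2)[OF assms, of j] by (intro mult_strict_right_mono) auto
  then show ?thesis using geometric_grid_Suc_bounds(1)[OF assms(1), of m j] by linarith
qed

text \<open>
Here \<open>J n\<close> stands for the number of grid points up to \<open>n\<close>, and the numerator for the logarithm of a
product over these points.
\<close>

lemma quadratic_in_log_limit:
  assumes r: "1 < r" and J: "eventually (\<lambda>n. \<bar>real (J n) - ln (real n) / ln r\<bar> \<le> D) sequentially"
  shows "(\<lambda>n. (real (J n) * u + w - b * ln r * (real (J n))\<^sup>2 / 2) / (ln (real n))\<^sup>2) \<longlonglongrightarrow> - b / (2 * ln r)"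
proof -
  have lnr: "0 < ln r" using r by simp
  have top: "filterlim (\<lambda>n. ln (real n)) at_top sequentially"
    by (rule filterlim_compose[OF ln_at_top filterlim_real_sequentially])
  have null: "(\<lambda>n. C / ln (real n)) \<longlonglongrightarrow> 0" for C :: real
    by (intro tendsto_divide_0[OF tendsto_const] filterlim_at_top_imp_at_infinity top)
  have pos: "eventually (\<lambda>n. 0 < ln (real n)) sequentially"
    using top by (simp add: filterlim_at_top_dense)
  define y where "y n = real (J n) / ln (real n)" for n
  have "(\<lambda>n. y n - 1 / ln r) \<longlonglongrightarrow> 0"
  proof (rule Lim_null_comparison[OF _ null[of D]])
    show "eventually (\<lambda>n. norm (y n - 1 / ln r) \<le> D / ln (real n)) sequentially"
      using J pos
    proof eventually_elim
      case (elim n)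
      have "y n - 1 / ln r = (real (J n) - ln (real n) / ln r) / ln (real n)"
        using elim(2) lnr by (simp add: y_def field_simps)
      then show ?case using elim by (simp add: divide_right_mono)
    qed
  qed
  then have y: "y \<longlonglongrightarrow> 1 / ln r" by (rule LIM_zero_cancel)
  have lim: "(\<lambda>n. y n * (u / ln (real n)) + (w / ln (real n)) * (1 / ln (real n)) - b * ln r * (y n)\<^sup>2 / 2)
      \<longlonglongrightarrow> 1 / ln r * 0 + 0 * 0 - b * ln r * (1 / ln r)\<^sup>2 / 2"
    by (intro tendsto_intros y null) simp
  have eq: "1 / ln r * 0 + 0 * 0 - b * ln r * (1 / ln r)\<^sup>2 / 2 = - b / (2 * ln r)"
    using lnr by (simp add: power2_eq_square)
  have "eventually (\<lambda>n. y n * (u / ln (real n)) + (w / ln (real n)) * (1 / ln (real n)) - b * ln r * (y n)\<^sup>2 / 2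
      = (real (J n) * u + w - b * ln r * (real (J n))\<^sup>2 / 2) / (ln (real n))\<^sup>2) sequentially"
    using pos by eventually_elim (simp add: y_def field_simps power2_eq_square)
  then show ?thesis using lim unfolding eq by (rule Lim_transform_eventually[rotated])
qed

text \<open>
The last grid point before \<open>n\<close> decides: \<open>P\<close> is monotone, so a bound along the grid is enough.  In the
lower counterpart it is the first grid point after \<open>n\<close>.
\<close>

lemma log_square_rate_upper:
  assumes pos: "\<And>n. 0 < P n" and anti: "\<And>m n. m \<le> n \<Longrightarrow> P n \<le> P m"
    and r: "1 < r" and K: "0 < K" and grid: "\<And>j. real (m j) \<le> K * r ^ j"
    and bound: "\<And>J. ln (P (m J)) \<le> real J * u + w - b * ln r * (real J)\<^sup>2 / 2"
    and l: "- b / (2 * ln r) < l"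
  shows "eventually (\<lambda>n. ln (P n) / (ln (real n))\<^sup>2 < l) sequentially"
proof -
  have lnr: "0 < ln r" using r by simp
  define J where "J n = nat \<lfloor>(ln (real n) - ln K) / ln r\<rfloor>" for n
  have large: "eventually (\<lambda>n. max 1 K \<le> real n) sequentially"
    using filterlim_real_sequentially unfolding filterlim_at_top by blast
  have J: "real (J n) \<le> (ln (real n) - ln K) / ln r \<and> (ln (real n) - ln K) / ln r - 1 \<le> real (J n)"
    if "max 1 K \<le> real n" for n
  proof -
    have "0 \<le> ln (real n) - ln K" using that K by simp
    then have "0 \<le> (ln (real n) - ln K) / ln r" using lnr by simp
    then show ?thesis unfolding J_def by linarith
  qed
  have "eventually (\<lambda>n. \<bar>real (J n) - ln (real n) / ln r\<bar> \<le> \<bar>ln K / ln r\<bar> + 1) sequentially"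
    using large
  proof eventually_elim
    case (elim n)
    show ?case using J[OF elim] unfolding diff_divide_distrib by linarith
  qed
  then have "eventually (\<lambda>n. (real (J n) * u + w - b * ln r * (real (J n))\<^sup>2 / 2) / (ln (real n))\<^sup>2 < l) sequentially"
    using l by (intro order_tendstoD(2)[OF quadratic_in_log_limit[OF r]])
  then show ?thesis using large
  proof eventually_elim
    case (elim n)
    have "real (m (J n)) \<le> K * r ^ J n" by (rule grid)
    also have "\<dots> = exp (ln K + real (J n) * ln r)"
      using K r by (simp add: exp_add exp_of_nat_mult)
    also have "\<dots> \<le> exp (ln (real n))"
      using J[OF elim(2)] lnr by (simp add: field_simps)
    also have "\<dots> = real n" using elim(2) by simp
    finally have "P n \<le> P (m (J n))" by (intro anti) simp
    then have "ln (P n) \<le> real (J n) * u + w - b * ln r * (real (J n))\<^sup>2 / 2"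
      using bound[of "J n"] pos[of n] by (smt (verit) ln_mono)
    then show ?case using elim(1) by (smt (verit) divide_right_mono zero_le_power2)
  qed
qed

lemma log_square_rate_lower:
  assumes pos: "\<And>n. 0 < P n" and anti: "\<And>m n. m \<le> n \<Longrightarrow> P n \<le> P m"
    and r: "1 < r" and grid: "\<And>j. r ^ j \<le> real (m j)"
    and bound: "\<And>J. real J * u + w - b * ln r * (real J)\<^sup>2 / 2 \<le> ln (P (m J))"
    and l: "l < - b / (2 * ln r)"
  shows "eventually (\<lambda>n. l < ln (P n) / (ln (real n))\<^sup>2) sequentially"
proof -
  have lnr: "0 < ln r" using r by simp
  define J where "J n = nat \<lceil>ln (real n) / ln r\<rceil>" for n
  have large: "eventually (\<lambda>n. 1 \<le> n) sequentially" by (rule eventually_ge_at_top)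
  have J: "ln (real n) / ln r \<le> real (J n) \<and> real (J n) \<le> ln (real n) / ln r + 1"
    if "1 \<le> n" for n
  proof -
    have "0 \<le> ln (real n) / ln r" using that lnr by simp
    then show ?thesis unfolding J_def by linarith
  qed
  have "eventually (\<lambda>n. \<bar>real (J n) - ln (real n) / ln r\<bar> \<le> 1) sequentially"
    using large
  proof eventually_elim
    case (elim n)
    show ?case using J[OF elim] by linarith
  qed
  then have "eventually (\<lambda>n. l < (real (J n) * u + w - b * ln r * (real (J n))\<^sup>2 / 2) / (ln (real n))\<^sup>2) sequentially"
    using l by (intro order_tendstoD(1)[OF quadratic_in_log_limit[OF r]])
  then show ?thesis using large
  proof eventually_elim
    case (elim n)
    have "real n = exp (ln (real n))" using elim(2) by simp
    also have "\<dots> \<le> exp (real (J n) * ln r)"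
      using J[OF elim(2)] lnr by (simp add: field_simps)
    also have "\<dots> = r ^ J n" using r by (simp add: exp_of_nat_mult)
    also have "\<dots> \<le> real (m (J n))" by (rule grid)
    finally have "P (m (J n)) \<le> P n" by (intro anti) simp
    then have "real (J n) * u + w - b * ln r * (real (J n))\<^sup>2 / 2 \<le> ln (P n)"
      using bound[of "J n"] pos[of "m (J n)"] by (smt (verit) ln_mono)
    then show ?case using elim(1) by (smt (verit) divide_right_mono zero_le_power2)
  qed
qed

lemma sum_real_lessThan: "(\<Sum>j<J. real j) = (real J)\<^sup>2 / 2 - real J / 2"
  by (induction J) (auto simp: power2_eq_square field_simps)

section \<open>A block with one large jump\<close>

lemma measurable_sum_coords:
  assumes "K \<subseteq> I"
  shows "(\<lambda>f. \<Sum>i\<in>K. f i) \<in> borel_measurable (PiM I (\<lambda>_. borel :: ('b::euclidean_space) measure))"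
  using assms by (intro borel_measurable_sum measurable_component_singleton) auto

lemma sum_restrict_coords: "K \<subseteq> I \<Longrightarrow> (\<Sum>i\<in>K. restrict f I i) = (\<Sum>i\<in>K. f i)"
  by (intro sum.cong) auto

text \<open>
The step at time \<open>\<tau>\<close> is a jump close to \<open>m v\<close>, and the partial sums of all other steps of the block
stay small.  The two conditions concern disjoint sets of steps and are therefore independent.
\<close>

definition jump_block :: "'b::euclidean_space \<Rightarrow> real \<Rightarrow> nat \<Rightarrow> nat \<Rightarrow> nat \<Rightarrow> (nat \<Rightarrow> 'b) \<Rightarrow> bool" where
  "jump_block v \<delta> m m' \<tau> f \<longleftrightarrow> f \<tau> \<in> ball (real m *\<^sub>R v) (real m * \<delta>) \<and>
     (\<forall>k. norm (\<Sum>i\<in>{i\<in>{m<..m'} - {\<tau>}. i \<le> k}. f i) < \<delta> * real m)"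

lemma measurable_jump_block:
  fixes v :: "'b::euclidean_space"
  assumes "\<tau> \<in> {m<..m'}" "{m<..m'} \<subseteq> I"
  shows "Measurable.pred (PiM I (\<lambda>_. borel)) (jump_block v \<delta> m m' \<tau>)"
proof -
  have "(\<lambda>f. f \<tau>) \<in> borel_measurable (PiM I (\<lambda>_. borel :: 'b measure))"
    using assms by (intro measurable_component_singleton) auto
  moreover have "(\<lambda>f. \<Sum>i\<in>{i\<in>{m<..m'} - {\<tau>}. i \<le> k}. f i) \<in> borel_measurable (PiM I (\<lambda>_. borel :: 'b measure))" for k
    using assms by (intro measurable_sum_coords) auto
  ultimately show ?thesis
    unfolding jump_block_def mem_ball by measurable
qed

lemma jump_block_restrict:
  assumes "\<tau> \<in> {m<..m'}" "{m<..m'} \<subseteq> I"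
  shows "jump_block v \<delta> m m' \<tau> (restrict f I) \<longleftrightarrow> jump_block v \<delta> m m' \<tau> f"
proof -
  have "(\<Sum>i\<in>{i\<in>{m<..m'} - {\<tau>}. i \<le> k}. restrict f I i) = (\<Sum>i\<in>{i\<in>{m<..m'} - {\<tau>}. i \<le> k}. f i)" for k
    using assms by (intro sum_restrict_coords) auto
  moreover have "restrict f I \<tau> = f \<tau>" using assms by auto
  ultimately show ?thesis unfolding jump_block_def by simp
qed

text \<open>
If a jump also took place at time \<open>\<tau>\<close>, it would be the difference of two partial sums of the steps
other than \<open>\<tau>'\<close>, which are too small for that.
\<close>

lemma jump_block_unique:
  assumes v: "3 * \<delta> < norm v" and m: "0 < m" and \<tau>: "\<tau> \<in> {m<..m'}" "\<tau>' \<in> {m<..m'}" "\<tau> \<noteq> \<tau>'"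
    and j: "jump_block v \<delta> m m' \<tau> f" "jump_block v \<delta> m m' \<tau>' f"
  shows False
proof -
  let ?R = "\<lambda>k. \<Sum>i\<in>{i\<in>{m<..m'} - {\<tau>'}. i \<le> k}. f i"
  have "{i\<in>{m<..m'} - {\<tau>'}. i \<le> \<tau>} = insert \<tau> {i\<in>{m<..m'} - {\<tau>'}. i \<le> \<tau> - 1}"
    using \<tau> by auto
  from arg_cong[OF this, of "sum f"]
  have "?R \<tau> = sum f (insert \<tau> {i\<in>{m<..m'} - {\<tau>'}. i \<le> \<tau> - 1})" .
  also have "\<dots> = f \<tau> + ?R (\<tau> - 1)"
  proof (rule sum.insert)
    show "\<tau> \<notin> {i\<in>{m<..m'} - {\<tau>'}. i \<le> \<tau> - 1}" using \<tau> by auto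
  qed simp
  finally have "?R \<tau> = f \<tau> + ?R (\<tau> - 1)" .
  then have "?R \<tau> - ?R (\<tau> - 1) = f \<tau>" unfolding diff_eq_eq .
  then have eq: "f \<tau> = ?R \<tau> - ?R (\<tau> - 1)" by (rule sym)
  have "norm (f \<tau>) \<le> norm (?R \<tau>) + norm (?R (\<tau> - 1))" by (subst eq) (rule norm_triangle_ineq4)
  moreover have noise: "norm (?R k) < \<delta> * real m" for k using j(2) unfolding jump_block_def by blast
  ultimately have "norm (f \<tau>) < 2 * (\<delta> * real m)" using noise[of \<tau>] noise[of "\<tau> - 1"] by linarith
  moreover have "norm (real m *\<^sub>R v - f \<tau>) < real m * \<delta>"
    using j(1) by (simp add: jump_block_def dist_norm)
  moreover have "real m * norm v \<le> norm (real m *\<^sub>R v - f \<tau>) + norm (f \<tau>)"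
    using norm_triangle_ineq[of "real m *\<^sub>R v - f \<tau>" "f \<tau>"] by simp
  ultimately have "real m * norm v < real m * (3 * \<delta>)" by (simp add: algebra_simps)
  then show False using v m by simp
qed

text \<open>
Before the jump, \<open>S k\<close> is close to \<open>m x\<close>, so \<open>S k / k\<close> is close to \<open>(m / k) x\<close>, which runs down the
segment; afterwards \<open>S k\<close> is close to \<open>\<rho> m x\<close>, and \<open>S k / k\<close> is close to \<open>x\<close> because the jump comes
late in the block.  The constants make the second conclusion reproduce the hypothesis on \<open>S m\<close>: the
block adds an error of at most \<open>e / 4 * (\<rho> - 1) * m\<close>, which is exactly what the growth of the time
scale from \<open>m\<close> to \<open>\<rho> m\<close> allows.
\<close>

lemma one_jump_block:
  fixes f :: "nat \<Rightarrow> 'b::real_normed_vector" and A :: "'b set" and m m' :: nat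
  defines "S \<equiv> \<lambda>k. \<Sum>i=1..k. f i"
  assumes tube: "\<And>s. 1 / \<rho>' \<le> s \<Longrightarrow> s \<le> 1 \<Longrightarrow> cball (s *\<^sub>R x) e \<subseteq> A"
    and rho: "1 < \<rho>" "\<rho> < \<rho>'" and e: "0 < e"
    and theta: "0 \<le> \<theta>" "\<theta> \<le> \<rho> - 1" "\<theta> * norm x \<le> e / 4"
    and delta: "0 \<le> \<delta>" "\<delta> \<le> e / 8" "\<delta> \<le> e / 4 * (\<rho> - 1) / 4"
    and m: "1 \<le> m" "1 \<le> real m * (\<rho>' - \<rho>)" "2 * norm x \<le> real m * (e / 4) * (\<rho> - 1)"
    and m': "\<rho> * real m \<le> real m'" "real m' \<le> \<rho> * real m + 1"
    and stay: "\<forall>k\<in>{1..m}. S k /\<^sub>R real k \<in> A" and start: "norm (S m - real m *\<^sub>R x) \<le> e / 4 * real m"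
    and \<tau>: "m < \<tau>" "\<tau> \<le> m'" "(\<rho> - \<theta>) * real m \<le> real \<tau>"
    and jump: "norm (f \<tau> - (real m * (\<rho> - 1)) *\<^sub>R x) \<le> \<delta> * real m"
    and noise: "\<And>k. norm (\<Sum>i\<in>{i\<in>{m<..m'} - {\<tau>}. i \<le> k}. f i) \<le> \<delta> * real m"
  shows "\<forall>k\<in>{1..m'}. S k /\<^sub>R real k \<in> A" and "norm (S m' - real m' *\<^sub>R x) \<le> e / 4 * real m'"
proof -
  define R where "R k = (\<Sum>i\<in>{i\<in>{m<..m'} - {\<tau>}. i \<le> k}. f i)" for k
  have m0: "0 < real m" using m by simp
  have S_split: "S k = S m + R k + (if \<tau> \<le> k then f \<tau> else 0)" if "m < k" "k \<le> m'" for k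
  proof -
    have "S k = S m + (\<Sum>i\<in>{m<..k}. f i)"
    proof -
      have "{1..k} = {1..m} \<union> {m<..k}" using that by auto
      moreover have "(\<Sum>i\<in>{1..m} \<union> {m<..k}. f i) = (\<Sum>i=1..m. f i) + (\<Sum>i\<in>{m<..k}. f i)"
        by (rule sum.union_disjoint) auto
      ultimately show ?thesis unfolding S_def by simp
    qed
    also have "(\<Sum>i\<in>{m<..k}. f i) = R k + (if \<tau> \<le> k then f \<tau> else 0)"
    proof (cases "\<tau> \<le> k")
      case True
      have "{i\<in>{m<..m'} - {\<tau>}. i \<le> k} = {m<..k} - {\<tau>}" using that by auto
      moreover have "\<tau> \<in> {m<..k}" using True \<tau> by auto
      ultimately show ?thesis unfolding R_def using True by (simp add: sum.remove[of "{m<..k}" \<tau>] add.commute)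
    next
      case False
      have "{i\<in>{m<..m'} - {\<tau>}. i \<le> k} = {m<..k}" using that False by auto
      then show ?thesis unfolding R_def using False by simp
    qed
    finally show ?thesis by (simp add: add.assoc)
  qed
  have Rk: "norm (R k) \<le> \<delta> * real m" for k unfolding R_def by (rule noise)
  have before: "norm (S k - real m *\<^sub>R x) \<le> (e / 4 + \<delta>) * real m" if "m < k" "k < \<tau>" for k
  proof -
    have eq: "S k - real m *\<^sub>R x = (S m - real m *\<^sub>R x) + R k" using S_split[of k] that \<tau> by simp
    show ?thesis unfolding eq distrib_right
      using norm_triangle_ineq[of "S m - real m *\<^sub>R x" "R k"] start Rk[of k] by linarith
  qed
  have after: "norm (S k - (\<rho> * real m) *\<^sub>R x) \<le> (e / 4 + 2 * \<delta>) * real m" if "\<tau> \<le> k" "k \<le> m'" for k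
  proof -
    have "S k - (\<rho> * real m) *\<^sub>R x = (S m - real m *\<^sub>R x) + (R k + (f \<tau> - (real m * (\<rho> - 1)) *\<^sub>R x))"
      using S_split[of k] that \<tau> by (simp add: algebra_simps)
    then show ?thesis
      using norm_triangle_ineq[of "S m - real m *\<^sub>R x" "R k + (f \<tau> - (real m * (\<rho> - 1)) *\<^sub>R x)"]
        norm_triangle_ineq[of "R k" "f \<tau> - (real m * (\<rho> - 1)) *\<^sub>R x"] start Rk[of k] jump
      by (simp add: distrib_right)
  qed
  have in_A: "S k /\<^sub>R real k \<in> A"
    if k: "m < k" "k \<le> m'" and s: "0 \<le> t" "(t - min 1 (t / real k) * real k) * norm x \<le> \<theta> * norm x * real k"
      and t: "real m \<le> t" and err: "norm (S k - t *\<^sub>R x) \<le> e / 2 * real k" for k t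
  proof -
    \<comment> \<open>Near the end of the block \<open>t / k\<close> may exceed $1$ by up to \<open>\<theta>\<close> and leave the segment; truncating at $1$ costs at most \<open>\<theta> * norm x\<close>.\<close>
    define s where "s = min 1 (t / real k)"
    have k0: "0 < real k" using k by simp
    have "real k \<le> \<rho>' * real m" using k m' m(2) by (simp add: algebra_simps)
    then have "1 / \<rho>' \<le> real m / real k" using k0 rho by (simp add: field_simps)
    also have "\<dots> \<le> t / real k" using t by (intro divide_right_mono) auto
    finally have s1: "1 / \<rho>' \<le> s" "s \<le> 1" using rho by (auto simp: s_def field_simps)
    have ts: "0 \<le> t - s * real k" using k0 by (simp add: s_def min_def field_simps)
    have eq: "S k - (s * real k) *\<^sub>R x = (S k - t *\<^sub>R x) + (t - s * real k) *\<^sub>R x" by (simp add: algebra_simps)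
    have "norm ((t - s * real k) *\<^sub>R x) = (t - s * real k) * norm x" using ts by simp
    then have "norm (S k - (s * real k) *\<^sub>R x) \<le> e / 2 * real k + (t - s * real k) * norm x"
      unfolding eq using norm_triangle_ineq[of "S k - t *\<^sub>R x" "(t - s * real k) *\<^sub>R x"] err by linarith
    also have "\<dots> \<le> e / 2 * real k + e / 4 * real k"
      using that(4) mult_right_mono[OF theta(3), of "real k"] by (simp add: s_def)
    also have "\<dots> \<le> e * real k" using e k0 by simp
    finally have *: "norm (S k - (s * real k) *\<^sub>R x) \<le> e * real k" .
    have "S k /\<^sub>R real k - s *\<^sub>R x = (S k - (s * real k) *\<^sub>R x) /\<^sub>R real k"
      using k0 by (simp add: algebra_simps)
    then have "norm (S k /\<^sub>R real k - s *\<^sub>R x) = norm (S k - (s * real k) *\<^sub>R x) / real k"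
      using k0 by (simp add: divide_inverse)
    also have "\<dots> \<le> e" using * k0 by (simp add: field_simps)
    finally have "S k /\<^sub>R real k \<in> cball (s *\<^sub>R x) e"
      by (simp add: dist_norm norm_minus_commute)
    then show ?thesis using tube[OF s1] by blast
  qed
  show "\<forall>k\<in>{1..m'}. S k /\<^sub>R real k \<in> A"
  proof
    fix k assume k: "k \<in> {1..m'}"
    consider "k \<le> m" | "m < k" "k < \<tau>" | "\<tau> \<le> k" by linarith
    then show "S k /\<^sub>R real k \<in> A"
    proof cases
      case 1
      then show ?thesis using stay k by auto
    next
      case 2
      have "norm (S k - real m *\<^sub>R x) \<le> (e / 4 + \<delta>) * real m" using before 2 by blast
      also have "\<dots> \<le> e / 2 * real k" using delta e 2 by (intro mult_mono) auto
      finally have err: "norm (S k - real m *\<^sub>R x) \<le> e / 2 * real k" .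
      have "real m - min 1 (real m / real k) * real k = 0" using 2 by (simp add: min_def)
      then show ?thesis using err 2 k theta by (intro in_A[of k "real m"]) auto
    next
      case 3
      have mk: "m < k" using 3 \<tau> by simp
      have "norm (S k - (\<rho> * real m) *\<^sub>R x) \<le> (e / 4 + 2 * \<delta>) * real m" using after 3 k by auto
      also have "\<dots> \<le> e / 2 * real k" using delta e mk by (intro mult_mono) auto
      finally have err: "norm (S k - (\<rho> * real m) *\<^sub>R x) \<le> e / 2 * real k" .
      have "\<rho> * real m - min 1 (\<rho> * real m / real k) * real k \<le> \<theta> * real k"
      proof (cases "\<rho> * real m \<le> real k")
        case True
        then show ?thesis using mk theta by (simp add: min_def field_simps)
      next
        case False
        then have "1 \<le> \<rho> * real m / real k" using mk by (simp add: field_simps)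
        then have "\<rho> * real m - min 1 (\<rho> * real m / real k) * real k = \<rho> * real m - real k" by simp
        also have "\<dots> \<le> \<theta> * real m" using \<tau>(3) 3 by (simp add: algebra_simps)
        also have "\<dots> \<le> \<theta> * real k" using mk theta by (intro mult_left_mono) auto
        finally show ?thesis .
      qed
      then have "(\<rho> * real m - min 1 (\<rho> * real m / real k) * real k) * norm x \<le> \<theta> * real k * norm x"
        by (intro mult_right_mono) auto
      then show ?thesis using err mk k rho m0
        by (intro in_A[of k "\<rho> * real m"]) (auto simp: mult_ac)
    qed
  qed
  show "norm (S m' - real m' *\<^sub>R x) \<le> e / 4 * real m'"
  proof -
    have eq: "S m' - real m' *\<^sub>R x = (S m' - (\<rho> * real m) *\<^sub>R x) + (\<rho> * real m - real m') *\<^sub>R x"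
      by (simp add: algebra_simps)
    have "norm (S m' - real m' *\<^sub>R x) \<le> (e / 4 + 2 * \<delta>) * real m + \<bar>\<rho> * real m - real m'\<bar> * norm x"
      unfolding eq
      using norm_triangle_ineq[of "S m' - (\<rho> * real m) *\<^sub>R x" "(\<rho> * real m - real m') *\<^sub>R x"]
        after[OF \<tau>(2) order_refl] by simp
    also have "\<bar>\<rho> * real m - real m'\<bar> * norm x \<le> 1 * norm x"
      using m' by (intro mult_right_mono) auto
    also have "1 * norm x \<le> real m * (e / 4) * (\<rho> - 1) / 2" using m(3) by simp
    also have "(e / 4 + 2 * \<delta>) * real m \<le> (e / 4 + 2 * (e / 4 * (\<rho> - 1) / 4)) * real m"
      using delta by (intro mult_right_mono) auto
    also have "(e / 4 + 2 * (e / 4 * (\<rho> - 1) / 4)) * real m + real m * (e / 4) * (\<rho> - 1) / 2 = e / 4 * (\<rho> * real m)"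
      by (simp add: field_simps)
    also have "\<dots> \<le> e / 4 * real m'" using m' e by (intro mult_left_mono) auto
    finally show ?thesis by simp
  qed
qed

context iid_vectors
begin

text \<open>
Independence of events that depend on disjoint sets of steps.  The restriction hypotheses allow both
events to be written in terms of the full family of steps.
\<close>

lemma prob_indep_conj:
  assumes disj: "I \<inter> J = {}" "I \<subseteq> {1..}" "J \<subseteq> {1..}"
    and P[measurable]: "Measurable.pred (PiM I (\<lambda>_. borel)) P" and PI: "\<And>f. P (restrict f I) = P f"
    and Q[measurable]: "Measurable.pred (PiM J (\<lambda>_. borel)) Q" and QJ: "\<And>f. Q (restrict f J) = Q f"
  shows "prob {\<omega> \<in> space M. P (\<lambda>i. X i \<omega>) \<and> Q (\<lambda>i. X i \<omega>)}
    = prob {\<omega> \<in> space M. P (\<lambda>i. X i \<omega>)} * prob {\<omega> \<in> space M. Q (\<lambda>i. X i \<omega>)}"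
proof -
  let ?MI = "PiM I (\<lambda>_. borel) :: (nat \<Rightarrow> real^'d) measure" and ?MJ = "PiM J (\<lambda>_. borel) :: (nat \<Rightarrow> real^'d) measure"
  have X: "(\<lambda>\<omega>. restrict (\<lambda>i. X i \<omega>) K) \<in> measurable M (PiM K (\<lambda>_. borel))" if "K \<subseteq> {1..}" for K
    using that by (intro measurable_restrict) auto
  have sp: "restrict (\<lambda>i. X i \<omega>) K \<in> space (PiM K (\<lambda>_. borel))" for \<omega> K
    by (simp add: space_PiM)
  have "prob ((\<lambda>\<omega>. (restrict (\<lambda>i. X i \<omega>) I, restrict (\<lambda>i. X i \<omega>) J)) -`
      ({f \<in> space ?MI. P f} \<times> {f \<in> space ?MJ. Q f}) \<inter> space M)
    = prob ((\<lambda>\<omega>. restrict (\<lambda>i. X i \<omega>) I) -` {f \<in> space ?MI. P f} \<inter> space M)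
      * prob ((\<lambda>\<omega>. restrict (\<lambda>i. X i \<omega>) J) -` {f \<in> space ?MJ. Q f} \<inter> space M)"
    by (rule indep_varD[OF indep_var_restrict[OF indep disj]]) measurable
  moreover have "(\<lambda>\<omega>. (restrict (\<lambda>i. X i \<omega>) I, restrict (\<lambda>i. X i \<omega>) J)) -`
      ({f \<in> space ?MI. P f} \<times> {f \<in> space ?MJ. Q f}) \<inter> space M = {\<omega> \<in> space M. P (\<lambda>i. X i \<omega>) \<and> Q (\<lambda>i. X i \<omega>)}"
    using sp[of _ I] sp[of _ J] by (auto simp: PI QJ)
  moreover have "(\<lambda>\<omega>. restrict (\<lambda>i. X i \<omega>) I) -` {f \<in> space ?MI. P f} \<inter> space M = {\<omega> \<in> space M. P (\<lambda>i. X i \<omega>)}"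
    using sp[of _ I] by (auto simp: PI)
  moreover have "(\<lambda>\<omega>. restrict (\<lambda>i. X i \<omega>) J) -` {f \<in> space ?MJ. Q f} \<inter> space M = {\<omega> \<in> space M. Q (\<lambda>i. X i \<omega>)}"
    using sp[of _ J] by (auto simp: QJ)
  ultimately show ?thesis by simp
qed

end

section \<open>The upper bound\<close>

text \<open>
Regular variation of the steps is represented by \<open>tail_upper\<close> and \<open>ball_lower\<close>: power bounds whose
exponents come arbitrarily close to \<open>\<alpha>\<close>.
\<close>

locale centered_regular_walk = iid_vectors M X for M :: "'w measure" and X :: "nat \<Rightarrow> 'w \<Rightarrow> real^'d" +
  fixes \<alpha> :: real and A :: "(real^'d) set"
  assumes alpha: "1 < \<alpha>" and int: "integrable M (X 1)" and zero: "expectation (X 1) = 0"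
    and tail_upper: "\<And>q. 1 < q \<Longrightarrow> q < \<alpha> \<Longrightarrow> \<exists>C. \<forall>t>0. prob {\<omega> \<in> space M. t < norm (X 1 \<omega>)} \<le> C * t powr - q"
    and ball_lower: "\<And>q v e. \<alpha> < q \<Longrightarrow> 0 < e \<Longrightarrow>
      \<exists>b>0. \<exists>T>0. \<forall>t\<ge>T. b * t powr - q \<le> prob {\<omega> \<in> space M. X 1 \<omega> \<in> ball (t *\<^sub>R v) (t * e)}"
    and A: "compact A" "convex A" "interior A \<noteq> {}" "0 \<notin> A"
    and A_pos: "0 < prob {\<omega> \<in> space M. X 1 \<omega> \<in> interior A}"
begin

definition walk :: "nat \<Rightarrow> 'w \<Rightarrow> real^'d" where
  "walk k \<omega> = (\<Sum>i=1..k. X i \<omega>)"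

definition stay_prob :: "nat \<Rightarrow> real" where
  "stay_prob n = prob {\<omega> \<in> space M. \<forall>k\<in>{1..n}. walk k \<omega> /\<^sub>R real k \<in> A}"

lemma walk_measurable[measurable]: "walk k \<in> borel_measurable M"
  unfolding walk_def by (intro borel_measurable_sum X_measurable) auto

lemma A_sets[measurable]: "A \<in> sets borel"
  using A(1) by (simp add: borel_compact)

lemma stay_sets[measurable]: "{\<omega> \<in> space M. \<forall>k\<in>{1..n}. walk k \<omega> /\<^sub>R real k \<in> A} \<in> sets M"
  by measurable

lemma stay_prob_antimono: "m \<le> n \<Longrightarrow> stay_prob n \<le> stay_prob m"
  unfolding stay_prob_def by (intro finite_measure_mono) auto

lemma block_deviation_prob:
  assumes q: "1 < q" "q < \<alpha>" and r: "1 < r" and e: "0 < e"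
  obtains C where "0 < C"
    "\<And>m m'. 1 \<le> m \<Longrightarrow> r * real m \<le> real m' \<Longrightarrow> real m' \<le> (r + 1) * real m \<Longrightarrow>
      prob {\<omega> \<in> space M. e * real m \<le> norm (\<Sum>i\<in>{m<..m'}. X i \<omega>)} \<le> C * real m powr - (q - 1)"
proof -
  obtain C0 where C0: "\<And>t. 0 < t \<Longrightarrow> prob {\<omega> \<in> space M. t < norm (X 1 \<omega>)} \<le> C0 * t powr - q"
    using tail_upper[OF q] by blast
  have er: "0 < e / r" using e r by simp
  obtain K where K: "0 \<le> K" and bound:
    "\<And>N I. 1 \<le> N \<Longrightarrow> I \<subseteq> {1..} \<Longrightarrow> finite I \<Longrightarrow> card I \<le> N \<Longrightarrow>
       prob {\<omega> \<in> space M. \<exists>k. e / r * real N \<le> norm (\<Sum>i\<in>{i\<in>I. i \<le> k}. X i \<omega>)} \<le> K * real N powr (1 - q)"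
    by (rule maximal_large_deviation[OF int zero q(1) C0 er]) (assumption, (rule that; assumption))
  show ?thesis
  proof (rule that[of "K * (r - 1) powr (1 - q) + 1"])
    show "0 < K * (r - 1) powr (1 - q) + 1" using K by (simp add: add_nonneg_pos)
    fix m m' :: nat assume m: "1 \<le> m" "r * real m \<le> real m'" "real m' \<le> (r + 1) * real m"
    have "1 * real m < r * real m" using m r by (intro mult_strict_right_mono) auto
    then have mm: "m < m'" using m by linarith
    define N where "N = m' - m"
    have N: "1 \<le> N" "(r - 1) * real m \<le> real N" "real N \<le> r * real m"
      using mm m by (auto simp: N_def of_nat_diff algebra_simps)
    have [measurable]: "(\<lambda>\<omega>. \<Sum>i\<in>{i\<in>{m<..m'}. i \<le> k}. X i \<omega>) \<in> borel_measurable M" for k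
      by (intro borel_measurable_sum X_measurable) auto
    have "prob {\<omega> \<in> space M. e * real m \<le> norm (\<Sum>i\<in>{m<..m'}. X i \<omega>)}
        \<le> prob {\<omega> \<in> space M. \<exists>k. e / r * real N \<le> norm (\<Sum>i\<in>{i\<in>{m<..m'}. i \<le> k}. X i \<omega>)}"
    proof (intro finite_measure_mono subsetI)
      fix \<omega> assume "\<omega> \<in> {\<omega> \<in> space M. e * real m \<le> norm (\<Sum>i\<in>{m<..m'}. X i \<omega>)}"
      then have \<omega>: "\<omega> \<in> space M" "e * real m \<le> norm (\<Sum>i\<in>{m<..m'}. X i \<omega>)" by auto
      have "e / r * real N \<le> e / r * (r * real m)" using N e r by (intro mult_left_mono) auto
      also have "\<dots> = e * real m" using r by simp
      also note \<omega>(2)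
      also have "{m<..m'} = {i\<in>{m<..m'}. i \<le> m'}" by auto
      finally show "\<omega> \<in> {\<omega> \<in> space M. \<exists>k. e / r * real N \<le> norm (\<Sum>i\<in>{i\<in>{m<..m'}. i \<le> k}. X i \<omega>)}"
        using \<omega>(1) by blast
    qed measurable
    also have "\<dots> \<le> K * real N powr (1 - q)"
      using N(1) by (intro bound) (auto simp: N_def)
    also have "\<dots> \<le> K * ((r - 1) * real m) powr (1 - q)"
      using N m r q K by (intro mult_left_mono powr_mono2') auto
    also have "\<dots> = K * (r - 1) powr (1 - q) * real m powr - (q - 1)"
      using r by (simp add: powr_mult)
    also have "\<dots> \<le> (K * (r - 1) powr (1 - q) + 1) * real m powr - (q - 1)"
      by (intro mult_right_mono) auto
    finally show "prob {\<omega> \<in> space M. e * real m \<le> norm (\<Sum>i\<in>{m<..m'}. X i \<omega>)}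
      \<le> (K * (r - 1) powr (1 - q) + 1) * real m powr - (q - 1)" .
  qed
qed

text \<open>
Each block of the grid contains a deviation of linear size, by \<open>radial_gap\<close>, and the deviations in
different blocks are independent.
\<close>

lemma stay_prob_upper:
  assumes q: "1 < q" "q < \<alpha>" and r: "max_radial_ratio A < r"
  obtains C where "0 < C"
    "\<And>J. stay_prob (geometric_grid r 1 J) \<le> (\<Prod>j<J. C * (r ^ j) powr - (q - 1))"
proof -
  have r1: "1 < r" using max_radial_ratio_gt_1[OF A(1,4,3)] r by simp
  obtain e where e: "0 < e"
    "\<And>x y s. x \<in> A \<Longrightarrow> y \<in> A \<Longrightarrow> r \<le> s \<Longrightarrow> s \<le> r + 1 \<Longrightarrow> e \<le> norm (s *\<^sub>R y - x)"
    by (rule radial_gap[OF A(1,4) r r1, of "r + 1"]) (simp, (rule that; assumption))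
  obtain C where C: "0 < C" and dev:
    "\<And>m m'. 1 \<le> m \<Longrightarrow> r * real m \<le> real m' \<Longrightarrow> real m' \<le> (r + 1) * real m \<Longrightarrow>
      prob {\<omega> \<in> space M. e * real m \<le> norm (\<Sum>i\<in>{m<..m'}. X i \<omega>)} \<le> C * real m powr - (q - 1)"
    by (rule block_deviation_prob[OF q r1 e(1)]) (rule that; assumption)
  define g where "g = geometric_grid r 1"
  have g1: "1 \<le> g j" for j unfolding g_def using geometric_grid_pos(2)[OF r1, of 1] by simp
  have gl: "g j < g (Suc j)" for j unfolding g_def using geometric_grid_less_Suc[OF r1, of 1] by blast
  have gmono: "i \<le> j \<Longrightarrow> g i \<le> g j" for i j using lift_Suc_mono_le[of g, OF less_imp_le[OF gl]] by blast
  have gr: "r * real (g j) \<le> real (g (Suc j))" "real (g (Suc j)) \<le> (r + 1) * real (g j)" for j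
  proof -
    show "r * real (g j) \<le> real (g (Suc j))" unfolding g_def by (rule geometric_grid_Suc_bounds(1)[OF r1])
    have "real (g (Suc j)) \<le> r * real (g j) + 1" unfolding g_def by (rule geometric_grid_Suc_bounds(2)[OF r1])
    moreover have "1 \<le> real (g j)" using g1[of j] by simp
    ultimately show "real (g (Suc j)) \<le> (r + 1) * real (g j)" by (simp add: distrib_right)
  qed
  define D where "D j f \<longleftrightarrow> e * real (g j) \<le> norm (\<Sum>i\<in>{g j<..g (Suc j)}. f i)" for j and f :: "nat \<Rightarrow> real^'d"
  have pD: "prob {\<omega> \<in> space M. D j (\<lambda>i. X i \<omega>)} \<le> C * (r ^ j) powr - (q - 1)" for j
  proof -
    have "prob {\<omega> \<in> space M. D j (\<lambda>i. X i \<omega>)} \<le> C * real (g j) powr - (q - 1)"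
      unfolding D_def by (intro dev g1 gr)
    also have "\<dots> \<le> C * (r ^ j) powr - (q - 1)"
      using geometric_grid_ge[OF r1, of 1 j] r1 C q by (intro mult_left_mono powr_mono2') (auto simp: g_def)
    finally show ?thesis .
  qed
  have prod: "prob {\<omega> \<in> space M. \<forall>j<J. D j (\<lambda>i. X i \<omega>)} \<le> (\<Prod>j<J. C * (r ^ j) powr - (q - 1))" for J
  proof (induction J)
    case 0
    then show ?case by (simp add: prob_space)
  next
    case (Suc J)
    have sub: "{g j<..g (Suc j)} \<subseteq> {1..g J}" if "j < J" for j using that gmono[of "Suc j" J] g1[of j] by auto
    have mD: "Measurable.pred (PiM K (\<lambda>_. borel)) (D j)" if "{g j<..g (Suc j)} \<subseteq> K" for j K
      unfolding D_def using measurable_sum_coords[OF that] by measurable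
    have rD: "D j (restrict f K) = D j f" if "{g j<..g (Suc j)} \<subseteq> K" for j f K
      unfolding D_def using sum_restrict_coords[OF that] by metis
    have "{\<omega> \<in> space M. \<forall>j<Suc J. D j (\<lambda>i. X i \<omega>)}
      = {\<omega> \<in> space M. (\<forall>j<J. D j (\<lambda>i. X i \<omega>)) \<and> D J (\<lambda>i. X i \<omega>)}"
      by (auto simp: less_Suc_eq)
    then have "prob {\<omega> \<in> space M. \<forall>j<Suc J. D j (\<lambda>i. X i \<omega>)}
      = prob {\<omega> \<in> space M. (\<forall>j<J. D j (\<lambda>i. X i \<omega>)) \<and> D J (\<lambda>i. X i \<omega>)}" by simp
    also have "\<dots> = prob {\<omega> \<in> space M. \<forall>j<J. D j (\<lambda>i. X i \<omega>)} * prob {\<omega> \<in> space M. D J (\<lambda>i. X i \<omega>)}"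
    proof (rule prob_indep_conj[where I="{1..g J}" and J="{g J<..g (Suc J)}"])
      have "Measurable.pred (PiM {1..g J} (\<lambda>_. borel)) (\<lambda>f. \<forall>j\<in>{..<J}. D j f)"
        using mD sub by (intro pred_intros_finite) auto
      then show "Measurable.pred (PiM {1..g J} (\<lambda>_. borel)) (\<lambda>f. \<forall>j<J. D j f)" unfolding Ball_def lessThan_iff .
      show "(\<forall>j<J. D j (restrict f {1..g J})) = (\<forall>j<J. D j f)" for f using rD sub by blast
      show "Measurable.pred (PiM {g J<..g (Suc J)} (\<lambda>_. borel)) (D J)" by (rule mD) simp
      show "D J (restrict f {g J<..g (Suc J)}) = D J f" for f by (rule rD) simp
    qed auto
    also have "\<dots> \<le> (\<Prod>j<J. C * (r ^ j) powr - (q - 1)) * (C * (r ^ J) powr - (q - 1))"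
      using C by (intro mult_mono Suc pD prod_nonneg) auto
    finally show ?case by simp
  qed
  show ?thesis
  proof (rule that[OF C])
    fix J
    have DS: "D j (\<lambda>i. X i \<omega>) \<longleftrightarrow> e * real (g j) \<le> norm (walk (g (Suc j)) \<omega> - walk (g j) \<omega>)" for j \<omega>
    proof -
      have "{1..g (Suc j)} = {1..g j} \<union> {g j<..g (Suc j)}" using gl[of j] by auto
      moreover have "(\<Sum>i\<in>{1..g j} \<union> {g j<..g (Suc j)}. X i \<omega>)
          = (\<Sum>i=1..g j. X i \<omega>) + (\<Sum>i\<in>{g j<..g (Suc j)}. X i \<omega>)"
        by (rule sum.union_disjoint) auto
      ultimately have "walk (g (Suc j)) \<omega> = walk (g j) \<omega> + (\<Sum>i\<in>{g j<..g (Suc j)}. X i \<omega>)"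
        unfolding walk_def by simp
      then show ?thesis by (simp add: D_def)
    qed
    have "stay_prob (g J) \<le> prob {\<omega> \<in> space M. \<forall>j<J. D j (\<lambda>i. X i \<omega>)}"
      unfolding stay_prob_def
    proof (intro finite_measure_mono subsetI)
      fix \<omega> assume "\<omega> \<in> {\<omega> \<in> space M. \<forall>k\<in>{1..g J}. walk k \<omega> /\<^sub>R real k \<in> A}"
      then have \<omega>: "\<omega> \<in> space M" and stay: "\<And>k. 1 \<le> k \<Longrightarrow> k \<le> g J \<Longrightarrow> walk k \<omega> /\<^sub>R real k \<in> A" by auto
      have "e * real (g j) \<le> norm (walk (g (Suc j)) \<omega> - walk (g j) \<omega>)" if "j < J" for j
      proof -
        have g0: "0 < real (g j)" "0 < real (g (Suc j))" using g1[of j] g1[of "Suc j"] by auto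
        define s where "s = real (g (Suc j)) / real (g j)"
        have s: "r \<le> s" "s \<le> r + 1" using gr[of j] g0 by (auto simp: s_def field_simps)
        have "e \<le> norm (s *\<^sub>R (walk (g (Suc j)) \<omega> /\<^sub>R real (g (Suc j))) - walk (g j) \<omega> /\<^sub>R real (g j))"
          using that gmono[of "Suc j" J] gmono[of j J] g1 by (intro e(2) stay s) auto
        also have "s *\<^sub>R (walk (g (Suc j)) \<omega> /\<^sub>R real (g (Suc j))) - walk (g j) \<omega> /\<^sub>R real (g j)
          = (walk (g (Suc j)) \<omega> - walk (g j) \<omega>) /\<^sub>R real (g j)"
          using g0 by (simp add: s_def algebra_simps divide_inverse)
        finally have "e \<le> norm ((walk (g (Suc j)) \<omega> - walk (g j) \<omega>) /\<^sub>R real (g j))" .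
        moreover have "norm (u /\<^sub>R real (g j)) = norm u / real (g j)" for u :: "real^'d"
          by (simp add: divide_inverse mult.commute)
        ultimately show ?thesis using g0 by (simp only: pos_le_divide_eq)
      qed
      then show "\<omega> \<in> {\<omega> \<in> space M. \<forall>j<J. D j (\<lambda>i. X i \<omega>)}" using \<omega> by (simp add: DS)
    next
      show "{\<omega> \<in> space M. \<forall>j<J. D j (\<lambda>i. X i \<omega>)} \<in> sets M" unfolding DS by measurable
    qed
    then show "stay_prob (geometric_grid r 1 J) \<le> (\<Prod>j<J. C * (r ^ j) powr - (q - 1))"
      using prod[of J] by (simp add: g_def)
  qed
qed

end

section \<open>The lower bound\<close>

context centered_regular_walk
begin

text \<open>
The events for different jump times are disjoint, so their probabilities, each of order $m^{- q}$, add
up over the order of $m$ admissible times.  This sum over the times makes the exponent $q - 1$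
instead of $q$.
\<close>

lemma jump_block_prob:
  assumes q: "\<alpha> < q" and \<rho>: "1 < \<rho>" and \<theta>: "0 < \<theta>" "\<theta> \<le> \<rho> - 1"
    and \<delta>: "0 < \<delta>" "3 * \<delta> < norm v"
  obtains c T where "0 < c"
    "\<And>m m'. T \<le> real m \<Longrightarrow> \<rho> * real m \<le> real m' \<Longrightarrow> real m' \<le> \<rho> * real m + 1 \<Longrightarrow>
       c * real m powr - (q - 1) \<le>
         prob {\<omega> \<in> space M. \<exists>\<tau>\<in>{m<..m'}. (\<rho> - \<theta>) * real m \<le> real \<tau> \<and> jump_block v \<delta> m m' \<tau> (\<lambda>i. X i \<omega>)}"
proof -
  \<comment> \<open>Some decay of the noise suffices here, so any exponent between $1$ and \<open>\<alpha>\<close> will do.\<close>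
  define p where "p = (1 + \<alpha>) / 2"
  have p: "1 < p" "p < \<alpha>" using alpha by (auto simp: p_def)
  obtain C0 where C0: "\<And>t. 0 < t \<Longrightarrow> prob {\<omega> \<in> space M. t < norm (X 1 \<omega>)} \<le> C0 * t powr - p"
    using tail_upper[OF p] by blast
  have e: "0 < \<delta> / \<rho>" using \<delta> \<rho> by simp
  obtain K where K: "0 \<le> K" and dev:
    "\<And>N I. 1 \<le> N \<Longrightarrow> I \<subseteq> {1..} \<Longrightarrow> finite I \<Longrightarrow> card I \<le> N \<Longrightarrow>
       prob {\<omega> \<in> space M. \<exists>k. \<delta> / \<rho> * real N \<le> norm (\<Sum>i\<in>{i\<in>I. i \<le> k}. X i \<omega>)} \<le> K * real N powr (1 - p)"
    by (rule maximal_large_deviation[OF int zero p(1) C0 e]) (assumption, (rule that; assumption))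
  obtain b T0 where b: "0 < b" "0 < T0" and ball:
    "\<And>t. T0 \<le> t \<Longrightarrow> b * t powr - q \<le> prob {\<omega> \<in> space M. X 1 \<omega> \<in> ball (t *\<^sub>R v) (t * \<delta>)}"
    using ball_lower[OF q \<delta>(1)] by blast
  have "((\<lambda>m. K * ((\<rho> - 1) * m) powr (1 - p)) \<longlongrightarrow> K * 0) at_top"
    using p \<rho> by (intro tendsto_mult tendsto_const tendsto_neg_powr)
      (auto intro!: filterlim_tendsto_pos_mult_at_top[OF tendsto_const] filterlim_ident)
  then have "eventually (\<lambda>m. K * ((\<rho> - 1) * m) powr (1 - p) < 1 / 2) at_top"
    by (intro order_tendstoD(2)) auto
  then obtain T1 where T1: "\<And>m. T1 \<le> m \<Longrightarrow> K * ((\<rho> - 1) * m) powr (1 - p) < 1 / 2"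
    unfolding eventually_at_top_linorder by blast
  define T where "T = max (max T0 T1) (max 1 (1 / (\<rho> - 1)))"
  show ?thesis
  proof (rule that[of "\<theta> * b / 2" T])
    show "0 < \<theta> * b / 2" using b \<theta> by simp
    fix m m' :: nat assume m: "T \<le> real m" and m': "\<rho> * real m \<le> real m'" "real m' \<le> \<rho> * real m + 1"
    have mT: "T0 \<le> real m" "T1 \<le> real m" "1 \<le> real m" "1 \<le> (\<rho> - 1) * real m"
      using m \<rho> by (auto simp: T_def field_simps)
    have mm: "real m + 1 \<le> real m'" using mT(4) m' by (simp add: algebra_simps)
    \<comment> \<open>The admissible jump times are those after \<open>w\<close>.\<close>
    define w where "w = nat \<lfloor>(\<rho> - \<theta>) * real m\<rfloor>"
    have "1 * real m \<le> (\<rho> - \<theta>) * real m" using \<theta> by (intro mult_right_mono) auto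
    then have w: "real m \<le> real w" "real w \<le> (\<rho> - \<theta>) * real m" "(\<rho> - \<theta>) * real m < real w + 1"
    proof -
      assume le: "1 * real m \<le> (\<rho> - \<theta>) * real m"
      then show "real m \<le> real w" unfolding w_def of_nat_le_iff by (intro le_nat_floor) simp
      have "0 \<le> (\<rho> - \<theta>) * real m" using le by simp
      then show "real w \<le> (\<rho> - \<theta>) * real m" "(\<rho> - \<theta>) * real m < real w + 1"
        unfolding w_def by linarith+
    qed
    define W where "W = {w<..m'}"
    have Wsub: "W \<subseteq> {m<..m'}" unfolding W_def using w(1) by auto
    have cardW: "\<theta> * real m \<le> real (card W)"
    proof -
      have "real w \<le> real m'" using w(2) m' \<theta> mult_right_mono[of "\<rho> - \<theta>" \<rho> "real m"] by simp
      then show ?thesis unfolding W_def using w(2) m' by (simp add: of_nat_diff algebra_simps)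
    qed
    define E where "E \<tau> = {\<omega> \<in> space M. jump_block v \<delta> m m' \<tau> (\<lambda>i. X i \<omega>)}" for \<tau>
    have mE: "E \<tau> \<in> sets M" if "\<tau> \<in> {m<..m'}" for \<tau>
    proof -
      have "(\<lambda>\<omega>. restrict (\<lambda>i. X i \<omega>) {m<..m'}) \<in> measurable M (PiM {m<..m'} (\<lambda>_. borel))"
        by (intro measurable_restrict X_measurable) auto
      from measurable_compose[OF this measurable_jump_block[OF that subset_refl]]
      have "Measurable.pred M (\<lambda>\<omega>. jump_block v \<delta> m m' \<tau> (\<lambda>i. X i \<omega>))"
        unfolding jump_block_restrict[OF that subset_refl] .
      then show ?thesis unfolding E_def by measurable
    qed
    have pE: "b * real m powr - q * (1 / 2) \<le> prob (E \<tau>)" if \<tau>: "\<tau> \<in> {m<..m'}" for \<tau>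
    proof -
      define I where "I = {m<..m'} - {\<tau>}"
      have I: "I \<subseteq> {1..}" "finite I" "{\<tau>} \<inter> I = {}" unfolding I_def by auto
      have \<tau>1: "1 \<le> \<tau>" using \<tau> by simp
      let ?J = "\<lambda>f::nat \<Rightarrow> real^'d. f \<tau> \<in> ball (real m *\<^sub>R v) (real m * \<delta>)"
      let ?N = "\<lambda>f::nat \<Rightarrow> real^'d. \<forall>k. norm (\<Sum>i\<in>{i\<in>I. i \<le> k}. f i) < \<delta> * real m"
      have msum: "(\<lambda>f. \<Sum>i\<in>{i\<in>I. i \<le> k}. f i) \<in> borel_measurable (PiM I (\<lambda>_. borel :: (real^'d) measure))" for k
        by (intro measurable_sum_coords) auto
      have rsum: "(\<Sum>i\<in>{i\<in>I. i \<le> k}. restrict f I i) = (\<Sum>i\<in>{i\<in>I. i \<le> k}. f i)" for k and f :: "nat \<Rightarrow> real^'d"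
        by (intro sum_restrict_coords) auto
      have "prob (E \<tau>) = prob {\<omega> \<in> space M. ?J (\<lambda>i. X i \<omega>) \<and> ?N (\<lambda>i. X i \<omega>)}"
        unfolding E_def jump_block_def I_def by simp
      also have "\<dots> = prob {\<omega> \<in> space M. ?J (\<lambda>i. X i \<omega>)} * prob {\<omega> \<in> space M. ?N (\<lambda>i. X i \<omega>)}"
      proof (rule prob_indep_conj[OF I(3) _ I(1)])
        have "(\<lambda>f. f \<tau>) \<in> borel_measurable (PiM {\<tau>} (\<lambda>_. borel :: (real^'d) measure))"
          by (intro measurable_component_singleton) auto
        then show "Measurable.pred (PiM {\<tau>} (\<lambda>_. borel)) ?J" unfolding mem_ball by measurable
        show "Measurable.pred (PiM I (\<lambda>_. borel)) ?N" using msum by measurable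
        show "{\<tau>} \<subseteq> {1..}" using \<tau>1 by simp
        show "?N (restrict f I) = ?N f" for f unfolding rsum ..
      qed simp
      also have "prob {\<omega> \<in> space M. ?J (\<lambda>i. X i \<omega>)} = prob {\<omega> \<in> space M. X 1 \<omega> \<in> ball (real m *\<^sub>R v) (real m * \<delta>)}"
        by (rule prob_X_eq[OF \<tau>1]) simp
      finally have eq: "prob (E \<tau>) = prob {\<omega> \<in> space M. X 1 \<omega> \<in> ball (real m *\<^sub>R v) (real m * \<delta>)} * prob {\<omega> \<in> space M. ?N (\<lambda>i. X i \<omega>)}" .
      define N where "N = m' - m"
      have N: "1 \<le> N" "(\<rho> - 1) * real m \<le> real N" "real N \<le> \<rho> * real m" "card I \<le> N"
      proof -
        have "m < m'" using mm by linarith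
        then have Nr: "real N = real m' - real m" by (simp add: N_def of_nat_diff)
        then show "(\<rho> - 1) * real m \<le> real N" "real N \<le> \<rho> * real m"
          using m' mT(3) by (auto simp: algebra_simps)
        show "1 \<le> N" using \<open>m < m'\<close> by (simp add: N_def)
        show "card I \<le> N" unfolding I_def N_def using card_Diff1_le[of "{m<..m'}" \<tau>] by simp
      qed
      have [measurable]: "(\<lambda>\<omega>. \<Sum>i\<in>{i\<in>I. i \<le> k}. X i \<omega>) \<in> borel_measurable M" for k
        using I(1) by (intro borel_measurable_sum X_measurable) auto
      have "prob {\<omega> \<in> space M. \<not> ?N (\<lambda>i. X i \<omega>)}
        \<le> prob {\<omega> \<in> space M. \<exists>k. \<delta> / \<rho> * real N \<le> norm (\<Sum>i\<in>{i\<in>I. i \<le> k}. X i \<omega>)}"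
      proof (intro finite_measure_mono subsetI)
        fix \<omega> assume "\<omega> \<in> {\<omega> \<in> space M. \<not> ?N (\<lambda>i. X i \<omega>)}"
        then obtain k where \<omega>: "\<omega> \<in> space M" "\<delta> * real m \<le> norm (\<Sum>i\<in>{i\<in>I. i \<le> k}. X i \<omega>)"
          by (auto simp: not_less)
        have "\<delta> / \<rho> * real N \<le> \<delta> / \<rho> * (\<rho> * real m)" using N(3) e by (intro mult_left_mono) auto
        then have "\<delta> / \<rho> * real N \<le> norm (\<Sum>i\<in>{i\<in>I. i \<le> k}. X i \<omega>)" using \<omega>(2) \<rho> by simp
        then show "\<omega> \<in> {\<omega> \<in> space M. \<exists>k. \<delta> / \<rho> * real N \<le> norm (\<Sum>i\<in>{i\<in>I. i \<le> k}. X i \<omega>)}"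
          using \<omega>(1) by blast
      qed measurable
      also have "\<dots> \<le> K * real N powr (1 - p)" by (rule dev[OF N(1) I(1,2) N(4)])
      also have "\<dots> \<le> K * ((\<rho> - 1) * real m) powr (1 - p)"
        using N(2) mT \<rho> p K by (intro mult_left_mono powr_mono2') auto
      also have "\<dots> \<le> 1 / 2" using T1[OF mT(2)] by simp
      finally have "prob {\<omega> \<in> space M. \<not> ?N (\<lambda>i. X i \<omega>)} \<le> 1 / 2" .
      moreover have "prob {\<omega> \<in> space M. \<not> ?N (\<lambda>i. X i \<omega>)} = 1 - prob {\<omega> \<in> space M. ?N (\<lambda>i. X i \<omega>)}"
        by (rule prob_neg) measurable
      ultimately have "1 / 2 \<le> prob {\<omega> \<in> space M. ?N (\<lambda>i. X i \<omega>)}" by simp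
      then show ?thesis unfolding eq using ball[OF mT(1)] b by (intro mult_mono) auto
    qed
    have disj: "disjoint_family_on E W"
      unfolding disjoint_family_on_def
    proof (intro ballI impI)
      fix \<tau> \<tau>' assume *: "\<tau> \<in> W" "\<tau>' \<in> W" "\<tau> \<noteq> \<tau>'"
      have "0 < m" using mT(3) by simp
      then show "E \<tau> \<inter> E \<tau>' = {}"
        using jump_block_unique[OF \<delta>(2)] * Wsub unfolding E_def by blast
    qed
    have "\<theta> * b / 2 * real m powr - (q - 1) = (\<theta> * real m) * (b * real m powr - q * (1 / 2))"
      using mT(3) by (simp add: powr_diff powr_minus divide_simps)
    also have "\<dots> \<le> real (card W) * (b * real m powr - q * (1 / 2))"
      using cardW b by (intro mult_right_mono) auto
    also have "\<dots> = (\<Sum>\<tau>\<in>W. b * real m powr - q * (1 / 2))" by simp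
    also have "\<dots> \<le> (\<Sum>\<tau>\<in>W. prob (E \<tau>))" using pE Wsub by (intro sum_mono) auto
    also have "\<dots> = prob (\<Union>\<tau>\<in>W. E \<tau>)"
      using disj mE Wsub by (intro finite_measure_finite_Union[symmetric]) (auto simp: W_def)
    also have "\<dots> \<le> prob {\<omega> \<in> space M. \<exists>\<tau>\<in>{m<..m'}. (\<rho> - \<theta>) * real m \<le> real \<tau> \<and> jump_block v \<delta> m m' \<tau> (\<lambda>i. X i \<omega>)}"
    proof (intro finite_measure_mono subsetI)
      fix \<omega> assume "\<omega> \<in> (\<Union>\<tau>\<in>W. E \<tau>)"
      then obtain \<tau> where \<tau>: "\<tau> \<in> W" "\<omega> \<in> E \<tau>" by blast
      have "real w + 1 \<le> real \<tau>" using \<tau>(1) by (auto simp: W_def)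
      then have "(\<rho> - \<theta>) * real m \<le> real \<tau>" using w(3) by linarith
      then show "\<omega> \<in> {\<omega> \<in> space M. \<exists>\<tau>\<in>{m<..m'}. (\<rho> - \<theta>) * real m \<le> real \<tau> \<and> jump_block v \<delta> m m' \<tau> (\<lambda>i. X i \<omega>)}"
        using \<tau> Wsub unfolding E_def by blast
    next
      have "{\<omega> \<in> space M. \<exists>\<tau>\<in>{m<..m'}. (\<rho> - \<theta>) * real m \<le> real \<tau> \<and> jump_block v \<delta> m m' \<tau> (\<lambda>i. X i \<omega>)}
        = (\<Union>\<tau>\<in>{\<tau>\<in>{m<..m'}. (\<rho> - \<theta>) * real m \<le> real \<tau>}. E \<tau>)"
        unfolding E_def by blast
      also have "\<dots> \<in> sets M" by (intro sets.finite_UN mE) auto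
      finally show "{\<omega> \<in> space M. \<exists>\<tau>\<in>{m<..m'}. (\<rho> - \<theta>) * real m \<le> real \<tau> \<and> jump_block v \<delta> m m' \<tau> (\<lambda>i. X i \<omega>)} \<in> sets M" .
    qed
    finally show "\<theta> * b / 2 * real m powr - (q - 1)
      \<le> prob {\<omega> \<in> space M. \<exists>\<tau>\<in>{m<..m'}. (\<rho> - \<theta>) * real m \<le> real \<tau> \<and> jump_block v \<delta> m m' \<tau> (\<lambda>i. X i \<omega>)}" .
  qed
qed

text \<open>
The state at the end of a block: the averages have stayed in \<open>A\<close>, and the current one is close to \<open>x\<close>.
\<close>

definition aimed :: "real^'d \<Rightarrow> real \<Rightarrow> nat \<Rightarrow> (nat \<Rightarrow> real^'d) \<Rightarrow> bool" where
  "aimed x \<epsilon> m f \<longleftrightarrow> (\<forall>k\<in>{1..m}. (\<Sum>i=1..k. f i) /\<^sub>R real k \<in> A) \<and>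
     norm ((\<Sum>i=1..m. f i) - real m *\<^sub>R x) \<le> \<epsilon> * real m"

lemma measurable_aimed: "Measurable.pred (PiM {1..m} (\<lambda>_. borel)) (aimed x \<epsilon> m)"
proof -
  have [measurable]: "(\<lambda>f. \<Sum>i=1..k. f i) \<in> borel_measurable (PiM {1..m} (\<lambda>_. borel :: (real^'d) measure))"
    if "k \<in> {1..m}" for k
    using that by (intro measurable_sum_coords) auto
  have [measurable]: "(\<lambda>f. \<Sum>i=1..m. f i) \<in> borel_measurable (PiM {1..m} (\<lambda>_. borel :: (real^'d) measure))"
    by (intro measurable_sum_coords) auto
  show ?thesis unfolding aimed_def by measurable
qed

lemma aimed_restrict: "aimed x \<epsilon> m (restrict f {1..m}) \<longleftrightarrow> aimed x \<epsilon> m f"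
proof -
  have "(\<Sum>i=1..k. restrict f {1..m} i) = (\<Sum>i=1..k. f i)" if "k \<le> m" for k
    using that by (intro sum_restrict_coords) auto
  then show ?thesis unfolding aimed_def by auto
qed

text \<open>
The first steps are taken from a small convex piece of \<open>A\<close> of positive probability, which keeps the
averages in \<open>A\<close>; at a fixed but large time a single jump of matching length leads close to \<open>x\<close>.
\<close>

lemma aimed_initially:
  assumes x: "cball x \<epsilon> \<subseteq> A" and \<epsilon>: "0 < \<epsilon>"
  obtains m0 where "T \<le> real m0" "1 \<le> m0" "0 < prob {\<omega> \<in> space M. aimed x \<epsilon> m0 (\<lambda>i. X i \<omega>)}"
proof -
  obtain w where w: "0 < prob {\<omega> \<in> space M. X 1 \<omega> \<in> ball w (\<epsilon> / 4) \<inter> A}"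
  proof (rule ccontr)
    assume no: "\<not> thesis"
    have "\<not> 0 < prob {\<omega> \<in> space M. X 1 \<omega> \<in> ball w (\<epsilon> / 4) \<inter> A}" for w
      using no that[of w] by blast
    then have null: "prob {\<omega> \<in> space M. X 1 \<omega> \<in> ball w (\<epsilon> / 4) \<inter> A} = 0" for w
      by (simp add: not_less measure_le_0_iff)
    have cover: "A \<subseteq> (\<Union>w\<in>A. ball w (\<epsilon> / 4))" using \<epsilon> by auto
    obtain F where F: "finite F" "A \<subseteq> (\<Union>w\<in>F. ball w (\<epsilon> / 4))"
      by (rule compactE_image[OF A(1) _ cover]) (rule open_ball, rule that)
    have X1[measurable]: "X 1 \<in> borel_measurable M" by simp
    have ev: "{\<omega> \<in> space M. X 1 \<omega> \<in> B} \<in> sets M" if "B \<in> sets borel" for B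
      using measurable_sets[OF X1 that] by (simp add: vimage_def Int_def conj_commute)
    have "prob {\<omega> \<in> space M. X 1 \<omega> \<in> interior A} \<le> prob (\<Union>w\<in>F. {\<omega> \<in> space M. X 1 \<omega> \<in> ball w (\<epsilon> / 4) \<inter> A})"
    proof (intro finite_measure_mono sets.finite_UN F(1) ev)
      show "{\<omega> \<in> space M. X 1 \<omega> \<in> interior A} \<subseteq> (\<Union>w\<in>F. {\<omega> \<in> space M. X 1 \<omega> \<in> ball w (\<epsilon> / 4) \<inter> A})"
        using F(2) interior_subset[of A] by blast
    qed auto
    also have "\<dots> \<le> (\<Sum>w\<in>F. prob {\<omega> \<in> space M. X 1 \<omega> \<in> ball w (\<epsilon> / 4) \<inter> A})"
      using F(1) by (intro finite_measure_subadditive_finite) (auto intro!: ev)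
    also have "\<dots> = 0" using null by simp
    finally show False using A_pos by simp
  qed
  have "\<alpha> < \<alpha> + 1" "0 < \<epsilon> / 4" using \<epsilon> by auto
  then obtain b T0 where b: "0 < b" "0 < T0" and ball:
    "\<And>t. T0 \<le> t \<Longrightarrow> b * t powr - (\<alpha> + 1) \<le> prob {\<omega> \<in> space M. X 1 \<omega> \<in> ball (t *\<^sub>R (x - w)) (t * (\<epsilon> / 4))}"
    using ball_lower by blast
  define m0 where "m0 = nat \<lceil>max (max T0 T) (max 1 (4 * norm w / \<epsilon>))\<rceil>"
  have m0: "T0 \<le> real m0" "T \<le> real m0" "1 \<le> real m0" "4 * norm w / \<epsilon> \<le> real m0"
    unfolding m0_def by linarith+
  \<comment> \<open>The jump leads from \<open>m0 w\<close> to \<open>m0 x\<close>.\<close>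
  define B where "B i = (if i < m0 then ball w (\<epsilon> / 4) \<inter> A else ball (real m0 *\<^sub>R (x - w)) (real m0 * (\<epsilon> / 4)))" for i
  have B: "B i \<in> sets borel" for i by (simp add: B_def)
  have m01: "1 \<le> m0" using m0(3) by simp
  show ?thesis
  proof (rule that[OF m0(2) m01])
    have "0 < prob {\<omega> \<in> space M. X i \<omega> \<in> B i}" if "i \<in> {1..m0}" for i
    proof -
      have "prob {\<omega> \<in> space M. X i \<omega> \<in> B i} = prob {\<omega> \<in> space M. X 1 \<omega> \<in> B i}"
        using that by (intro prob_X_eq B) auto
      moreover have "0 < b * real m0 powr - (\<alpha> + 1)" using b m01 by simp
      ultimately show ?thesis using w ball[OF m0(1)] by (auto simp: B_def)
    qed
    then have "0 < (\<Prod>i=1..m0. prob (X i -` B i \<inter> space M))"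
      by (intro prod_pos) (simp add: vimage_def Int_def conj_commute)
    also have "\<dots> = prob (\<Inter>i\<in>{1..m0}. X i -` B i \<inter> space M)"
      using m01 by (intro indep_varsD[OF indep, symmetric] B) auto
    also have "\<dots> \<le> prob {\<omega> \<in> space M. aimed x \<epsilon> m0 (\<lambda>i. X i \<omega>)}"
    proof (intro finite_measure_mono subsetI)
      fix \<omega> assume "\<omega> \<in> (\<Inter>i\<in>{1..m0}. X i -` B i \<inter> space M)"
      then have \<omega>: "\<omega> \<in> space M" "\<And>i. i \<in> {1..m0} \<Longrightarrow> X i \<omega> \<in> B i" using m01 by auto
      have early: "X i \<omega> \<in> A" "norm (X i \<omega> - w) \<le> \<epsilon> / 4" if "1 \<le> i" "i < m0" for i
        using \<omega>(2)[of i] that by (auto simp: B_def dist_norm norm_minus_commute)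
      have last: "norm (X m0 \<omega> - real m0 *\<^sub>R (x - w)) \<le> real m0 * (\<epsilon> / 4)"
        using \<omega>(2)[of m0] m01 by (auto simp: B_def dist_norm norm_minus_commute)
      have Ssplit: "walk m0 \<omega> = (\<Sum>i=1..m0 - 1. X i \<omega>) + X m0 \<omega>"
      proof -
        have "{1..m0} = insert m0 {1..m0 - 1}" using m01 by auto
        then show ?thesis unfolding walk_def using m01 by (simp add: add.commute)
      qed
      have "(\<Sum>i=1..m0 - 1. X i \<omega>) = (\<Sum>i=1..m0 - 1. X i \<omega> - w) + (real m0 - 1) *\<^sub>R w"
        using m01 by (simp add: sum_subtractf of_nat_diff sum_constant_scaleR del: sum_constant)
      then have decomp: "walk m0 \<omega> - real m0 *\<^sub>R x
          = (\<Sum>i=1..m0 - 1. X i \<omega> - w) + ((X m0 \<omega> - real m0 *\<^sub>R (x - w)) - w)"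
        unfolding Ssplit by (simp add: algebra_simps)
      have "norm (\<Sum>i=1..m0 - 1. X i \<omega> - w) \<le> (\<Sum>i=1..m0 - 1. \<epsilon> / 4)"
        using early m01 by (intro sum_norm_le) auto
      also have "\<dots> \<le> real m0 * (\<epsilon> / 4)" using \<epsilon> m01 by (simp add: of_nat_diff mult_right_mono)
      finally have "norm (\<Sum>i=1..m0 - 1. X i \<omega> - w) \<le> real m0 * (\<epsilon> / 4)" .
      moreover have "norm w \<le> real m0 * (\<epsilon> / 4)" using m0(4) \<epsilon> by (simp add: field_simps)
      moreover have "0 \<le> real m0 * (\<epsilon> / 4)" using \<epsilon> by simp
      ultimately have close: "norm (walk m0 \<omega> - real m0 *\<^sub>R x) \<le> \<epsilon> * real m0"
        unfolding decomp
        using norm_triangle_ineq[of "\<Sum>i=1..m0 - 1. X i \<omega> - w" "(X m0 \<omega> - real m0 *\<^sub>R (x - w)) - w"]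
          norm_triangle_ineq4[of "X m0 \<omega> - real m0 *\<^sub>R (x - w)" w] last by (simp add: algebra_simps)
      have "walk k \<omega> /\<^sub>R real k \<in> A" if k: "k \<in> {1..m0}" for k
      proof (cases "k = m0")
        case True
        have "walk m0 \<omega> /\<^sub>R real m0 - x = (walk m0 \<omega> - real m0 *\<^sub>R x) /\<^sub>R real m0"
          using m01 by (simp add: algebra_simps)
        then have "norm (walk m0 \<omega> /\<^sub>R real m0 - x) = norm (walk m0 \<omega> - real m0 *\<^sub>R x) / real m0"
          by (simp add: divide_inverse)
        also have "\<dots> \<le> \<epsilon>" using close m01 by (simp add: field_simps)
        finally have "walk m0 \<omega> /\<^sub>R real m0 \<in> cball x \<epsilon>" by (simp add: dist_norm norm_minus_commute)
        then show ?thesis using x True by blast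
      next
        case False
        have "(\<Sum>i\<in>{1..k}. (1 / real k) *\<^sub>R X i \<omega>) \<in> A"
          using k False early(1) by (intro convex_sum A(2)) auto
        then show ?thesis by (simp add: walk_def scaleR_sum_right divide_inverse)
      qed
      then show "\<omega> \<in> {\<omega> \<in> space M. aimed x \<epsilon> m0 (\<lambda>i. X i \<omega>)}"
        using \<omega>(1) close by (simp add: aimed_def walk_def)
    next
      show "{\<omega> \<in> space M. aimed x \<epsilon> m0 (\<lambda>i. X i \<omega>)} \<in> sets M"
        unfolding aimed_def walk_def[symmetric] by measurable
    qed
    finally show "0 < prob {\<omega> \<in> space M. aimed x \<epsilon> m0 (\<lambda>i. X i \<omega>)}" .
  qed
qed

text \<open>
Starting close to \<open>x\<close>, each block succeeds with the probability of \<open>jump_block_prob\<close>, independently of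
the past, and leads back close to \<open>x\<close>.
\<close>

lemma stay_prob_lower:
  assumes q: "\<alpha> < q" and \<rho>: "1 < \<rho>" "\<rho> < max_radial_ratio A"
  obtains m0 c p where "0 < c" "0 < p" "1 \<le> m0"
    "\<And>J. p * (\<Prod>j<J. c * real (geometric_grid \<rho> m0 j) powr - (q - 1)) \<le> stay_prob (geometric_grid \<rho> m0 J)"
proof -
  \<comment> \<open>The segment is chosen slightly longer than the block so that rounding at its inner end is harmless.\<close>
  obtain \<rho>' where \<rho>': "\<rho> < \<rho>'" "\<rho>' < max_radial_ratio A" using dense[OF \<rho>(2)] by blast
  obtain x0 e where e: "0 < e" and tube: "\<And>s. 1 / \<rho>' \<le> s \<Longrightarrow> s \<le> 1 \<Longrightarrow> cball (s *\<^sub>R x0) e \<subseteq> A"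
    by (rule radial_segment_neighborhood[OF A(1,4,2,3), of \<rho>']) (use \<rho> \<rho>' in simp, use \<rho>' in simp, (rule that; assumption))
  define x where "x = x0"
  have x: "x \<noteq> 0"
  proof
    assume "x = 0"
    then have "0 \<in> cball ((1::real) *\<^sub>R x0) e" using e by (simp add: x_def)
    moreover have "cball ((1::real) *\<^sub>R x0) e \<subseteq> A" using \<rho> \<rho>' by (intro tube) (auto simp: field_simps)
    ultimately show False using A(4) by blast
  qed
  define \<theta> where "\<theta> = min (\<rho> - 1) (e / (4 * norm x))"
  have \<theta>: "0 < \<theta>" "\<theta> \<le> \<rho> - 1" "\<theta> * norm x \<le> e / 4"
  proof -
    show "0 < \<theta>" "\<theta> \<le> \<rho> - 1" using \<rho> e x by (auto simp: \<theta>_def)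
    have "\<theta> \<le> e / (4 * norm x)" by (simp add: \<theta>_def)
    then show "\<theta> * norm x \<le> e / 4" using x by (simp add: field_simps)
  qed
  define v where "v = (\<rho> - 1) *\<^sub>R x"
  have v: "0 < norm v" using \<rho> x by (simp add: v_def)
  \<comment> \<open>The first bound separates jumps from noise, the other two are the error budget of a block.\<close>
  define \<delta> where "\<delta> = min (norm v / 4) (min (e / 8) (e / 4 * (\<rho> - 1) / 4))"
  have "0 < e / 4 * (\<rho> - 1) / 4" using e \<rho> by simp
  then have "0 < \<delta>" using e v unfolding \<delta>_def by linarith
  moreover have "\<delta> \<le> norm v / 4" "\<delta> \<le> e / 8" "\<delta> \<le> e / 4 * (\<rho> - 1) / 4"
    unfolding \<delta>_def by linarith+
  ultimately have \<delta>: "0 < \<delta>" "3 * \<delta> < norm v" "\<delta> \<le> e / 8" "\<delta> \<le> e / 4 * (\<rho> - 1) / 4"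
    by linarith+
  obtain c T where c: "0 < c" and jump:
    "\<And>m m'. T \<le> real m \<Longrightarrow> \<rho> * real m \<le> real m' \<Longrightarrow> real m' \<le> \<rho> * real m + 1 \<Longrightarrow>
       c * real m powr - (q - 1) \<le>
         prob {\<omega> \<in> space M. \<exists>\<tau>\<in>{m<..m'}. (\<rho> - \<theta>) * real m \<le> real \<tau> \<and> jump_block v \<delta> m m' \<tau> (\<lambda>i. X i \<omega>)}"
    by (rule jump_block_prob[OF q \<rho>(1) \<theta>(1,2) \<delta>(1,2)]) (rule that; assumption)
  have "cball x (e / 4) \<subseteq> cball ((1::real) *\<^sub>R x0) e" using e by (simp add: x_def subset_cball)
  also have "\<dots> \<subseteq> A" using \<rho> \<rho>' by (intro tube) (auto simp: field_simps)
  finally have xA: "cball x (e / 4) \<subseteq> A" .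
  obtain m0 where m0: "max T (max (1 / (\<rho>' - \<rho>)) (2 * norm x / (e / 4 * (\<rho> - 1)))) \<le> real m0" "1 \<le> m0"
    and p0: "0 < prob {\<omega> \<in> space M. aimed x (e / 4) m0 (\<lambda>i. X i \<omega>)}"
    by (rule aimed_initially[OF xA, where T = "max T (max (1 / (\<rho>' - \<rho>)) (2 * norm x / (e / 4 * (\<rho> - 1))))"])
      (use e in simp, (rule that; assumption))
  define g where "g = geometric_grid \<rho> m0"
  define p where "p = prob {\<omega> \<in> space M. aimed x (e / 4) m0 (\<lambda>i. X i \<omega>)}"
  have g1: "1 \<le> g j" "m0 \<le> g j" for j unfolding g_def using geometric_grid_pos[OF \<rho>(1) m0(2)] by auto
  have large: "T \<le> real (g j)" "1 \<le> real (g j) * (\<rho>' - \<rho>)" "2 * norm x \<le> real (g j) * (e / 4) * (\<rho> - 1)" for j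
  proof -
    have gj: "real m0 \<le> real (g j)" using g1(2)[of j] by simp
    show "T \<le> real (g j)" using m0(1) gj by simp
    have "1 / (\<rho>' - \<rho>) \<le> real (g j)" using m0(1) gj by simp
    then show "1 \<le> real (g j) * (\<rho>' - \<rho>)" using \<rho>' by (simp add: field_simps)
    have "2 * norm x / (e / 4 * (\<rho> - 1)) \<le> real (g j)" using m0(1) gj by simp
    then have "2 * norm x \<le> real (g j) * (e / 4 * (\<rho> - 1))"
      using e \<rho> by (subst (asm) pos_divide_le_eq) auto
    then show "2 * norm x \<le> real (g j) * (e / 4) * (\<rho> - 1)" by (simp only: mult.assoc)
  qed
  have gr: "\<rho> * real (g j) \<le> real (g (Suc j))" "real (g (Suc j)) \<le> \<rho> * real (g j) + 1" for j
    unfolding g_def by (rule geometric_grid_Suc_bounds[OF \<rho>(1)])+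
  let ?H = "\<lambda>j f. \<exists>\<tau>\<in>{g j<..g (Suc j)}. (\<rho> - \<theta>) * real (g j) \<le> real \<tau> \<and> jump_block v \<delta> (g j) (g (Suc j)) \<tau> f"
  have step: "aimed x (e / 4) (g (Suc j)) f" if a: "aimed x (e / 4) (g j) f" and H: "?H j f" for j f
  proof -
    obtain \<tau> where \<tau>: "g j < \<tau>" "\<tau> \<le> g (Suc j)" "(\<rho> - \<theta>) * real (g j) \<le> real \<tau>"
      and jb: "jump_block v \<delta> (g j) (g (Suc j)) \<tau> f"
      using H by auto
    have jmp: "norm (f \<tau> - (real (g j) * (\<rho> - 1)) *\<^sub>R x) \<le> \<delta> * real (g j)"
      using jb by (simp add: jump_block_def v_def dist_norm norm_minus_commute mult.commute)
    have noise: "norm (\<Sum>i\<in>{i\<in>{g j<..g (Suc j)} - {\<tau>}. i \<le> k}. f i) \<le> \<delta> * real (g j)" for k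
      using jb unfolding jump_block_def by (blast intro: less_imp_le)
    have stay: "\<forall>k\<in>{1..g j}. (\<Sum>i=1..k. f i) /\<^sub>R real k \<in> A"
      and start: "norm ((\<Sum>i=1..g j. f i) - real (g j) *\<^sub>R x) \<le> e / 4 * real (g j)"
      using a by (auto simp: aimed_def)
    note result = one_jump_block[OF tube[folded x_def] \<rho>(1) \<rho>'(1) e less_imp_le[OF \<theta>(1)] \<theta>(2,3)
        less_imp_le[OF \<delta>(1)] \<delta>(3,4) g1(1) large(2,3) gr stay start \<tau> jmp noise]
    show ?thesis unfolding aimed_def using result by blast
  qed
  have chain: "p * (\<Prod>j<J. c * real (g j) powr - (q - 1)) \<le> prob {\<omega> \<in> space M. aimed x (e / 4) (g J) (\<lambda>i. X i \<omega>)}" for J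
  proof (induction J)
    case 0
    then show ?case by (simp add: p_def g_def)
  next
    case (Suc J)
    have mH: "Measurable.pred (PiM {g J<..g (Suc J)} (\<lambda>_. borel)) (?H J)"
    proof -
      have "Measurable.pred (PiM {g J<..g (Suc J)} (\<lambda>_. borel))
          (\<lambda>f. \<exists>\<tau>\<in>{\<tau>\<in>{g J<..g (Suc J)}. (\<rho> - \<theta>) * real (g J) \<le> real \<tau>}. jump_block v \<delta> (g J) (g (Suc J)) \<tau> f)"
        by (intro pred_intros_finite measurable_jump_block) auto
      moreover have "(\<lambda>f. \<exists>\<tau>\<in>{\<tau>\<in>{g J<..g (Suc J)}. (\<rho> - \<theta>) * real (g J) \<le> real \<tau>}. jump_block v \<delta> (g J) (g (Suc J)) \<tau> f) = ?H J"
        by (rule ext) blast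
      ultimately show ?thesis by (simp only:)
    qed
    have "p * (\<Prod>j<Suc J. c * real (g j) powr - (q - 1))
      = p * (\<Prod>j<J. c * real (g j) powr - (q - 1)) * (c * real (g J) powr - (q - 1))" by simp
    also have "\<dots> \<le> prob {\<omega> \<in> space M. aimed x (e / 4) (g J) (\<lambda>i. X i \<omega>)} * prob {\<omega> \<in> space M. ?H J (\<lambda>i. X i \<omega>)}"
      using c by (intro mult_mono Suc jump large gr) auto
    also have "\<dots> = prob {\<omega> \<in> space M. aimed x (e / 4) (g J) (\<lambda>i. X i \<omega>) \<and> ?H J (\<lambda>i. X i \<omega>)}"
    proof (rule prob_indep_conj[symmetric, where I="{1..g J}" and J="{g J<..g (Suc J)}"])
      show "?H J (restrict f {g J<..g (Suc J)}) = ?H J f" for f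
        by (rule bex_cong[OF refl]) (simp only: jump_block_restrict[OF _ subset_refl])
      show "{1..g J} \<inter> {g J<..g (Suc J)} = {}" "{1..g J} \<subseteq> {1..}" "{g J<..g (Suc J)} \<subseteq> {1..}" by auto
    qed (rule measurable_aimed aimed_restrict mH)+
    also have "\<dots> \<le> prob {\<omega> \<in> space M. aimed x (e / 4) (g (Suc J)) (\<lambda>i. X i \<omega>)}"
    proof (rule finite_measure_mono)
      show "{\<omega> \<in> space M. aimed x (e / 4) (g J) (\<lambda>i. X i \<omega>) \<and> ?H J (\<lambda>i. X i \<omega>)}
        \<subseteq> {\<omega> \<in> space M. aimed x (e / 4) (g (Suc J)) (\<lambda>i. X i \<omega>)}"
        using step by blast
      show "{\<omega> \<in> space M. aimed x (e / 4) (g (Suc J)) (\<lambda>i. X i \<omega>)} \<in> sets M"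
        unfolding aimed_def walk_def[symmetric] by measurable
    qed
    finally show ?case .
  qed
  show ?thesis
  proof (rule that[OF c _ m0(2)])
    show "0 < p" using p0 by (simp add: p_def)
    fix J
    have "prob {\<omega> \<in> space M. aimed x (e / 4) (g J) (\<lambda>i. X i \<omega>)} \<le> stay_prob (g J)"
      unfolding stay_prob_def by (intro finite_measure_mono stay_sets) (auto simp: aimed_def walk_def)
    then show "p * (\<Prod>j<J. c * real (geometric_grid \<rho> m0 j) powr - (q - 1)) \<le> stay_prob (geometric_grid \<rho> m0 J)"
      using chain[of J] by (simp add: g_def)
  qed
qed

end

section \<open>The rate\<close>

context centered_regular_walk
begin

lemma stay_prob_pos: "0 < stay_prob n"
proof -
  obtain \<rho> where \<rho>: "1 < \<rho>" "\<rho> < max_radial_ratio A"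
    using dense[OF max_radial_ratio_gt_1[OF A(1,4,3)]] by blast
  obtain m0 c p where c: "0 < c" "0 < p" "1 \<le> m0" and bound:
    "\<And>J. p * (\<Prod>j<J. c * real (geometric_grid \<rho> m0 j) powr - (\<alpha> + 1 - 1)) \<le> stay_prob (geometric_grid \<rho> m0 J)"
    by (rule stay_prob_lower[of "\<alpha> + 1", OF _ \<rho>]) (simp, (rule that; assumption))
  obtain J where "real n < \<rho> ^ J" using real_arch_pow[OF \<rho>(1)] by blast
  also have "1 * \<rho> ^ J \<le> real m0 * \<rho> ^ J" using c(3) \<rho> by (intro mult_right_mono) auto
  then have "\<rho> ^ J \<le> real m0 * \<rho> ^ J" by simp
  also have "\<dots> \<le> real (geometric_grid \<rho> m0 J)" by (rule geometric_grid_ge[OF \<rho>(1)])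
  finally have "stay_prob (geometric_grid \<rho> m0 J) \<le> stay_prob n" by (intro stay_prob_antimono) simp
  moreover have "0 < p * (\<Prod>j<J. c * real (geometric_grid \<rho> m0 j) powr - (\<alpha> + 1 - 1))"
    using c geometric_grid_pos(2)[OF \<rho>(1) c(3)] by (intro mult_pos_pos prod_pos) (auto simp: Suc_le_eq)
  ultimately show ?thesis using bound[of J] by linarith
qed

lemma stay_prob_rate_upper:
  assumes q: "1 < q" "q < \<alpha>" and r: "max_radial_ratio A < r" and l: "- (q - 1) / (2 * ln r) < l"
  shows "eventually (\<lambda>n. ln (stay_prob n) / (ln (real n))\<^sup>2 < l) sequentially"
proof -
  have r1: "1 < r" using max_radial_ratio_gt_1[OF A(1,4,3)] r by simp
  obtain C where C: "0 < C" and bound: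
    "\<And>J. stay_prob (geometric_grid r 1 J) \<le> (\<Prod>j<J. C * (r ^ j) powr - (q - 1))"
    by (rule stay_prob_upper[OF q r]) (rule that; assumption)
  show ?thesis
  proof (rule log_square_rate_upper[OF stay_prob_pos stay_prob_antimono r1 _ _ _ l, where K="1 + 1 / (r - 1)"
        and m="geometric_grid r 1" and u="ln C + (q - 1) * ln r / 2" and w=0])
    show "0 < 1 + 1 / (r - 1)" using r1 by (simp add: add_pos_pos)
    show "real (geometric_grid r 1 j) \<le> (1 + 1 / (r - 1)) * r ^ j" for j
      using geometric_grid_le[OF r1, of 1 j] by simp
    fix J
    have "ln (stay_prob (geometric_grid r 1 J)) \<le> ln (\<Prod>j<J. C * (r ^ j) powr - (q - 1))"
      using bound[of J] stay_prob_pos by (intro ln_mono) auto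
    also have "\<dots> = (\<Sum>j<J. ln (C * (r ^ j) powr - (q - 1)))"
      using C r1 by (intro ln_prod) auto
    also have "\<dots> = (\<Sum>j<J. ln C - (q - 1) * ln r * real j)"
      using C r1 by (intro sum.cong) (auto simp: ln_mult ln_powr ln_realpow algebra_simps)
    also have "\<dots> = real J * ln C - (q - 1) * ln r * ((real J)\<^sup>2 / 2 - real J / 2)"
      unfolding sum_subtractf sum_distrib_left[symmetric] sum_real_lessThan by simp
    also have "\<dots> = real J * (ln C + (q - 1) * ln r / 2) + 0 - (q - 1) * ln r * (real J)\<^sup>2 / 2"
      by (simp add: field_simps)
    finally show "ln (stay_prob (geometric_grid r 1 J))
      \<le> real J * (ln C + (q - 1) * ln r / 2) + 0 - (q - 1) * ln r * (real J)\<^sup>2 / 2" .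
  qed
qed

lemma stay_prob_rate_lower:
  assumes q: "\<alpha> < q" and \<rho>: "1 < \<rho>" "\<rho> < max_radial_ratio A" and l: "l < - (q - 1) / (2 * ln \<rho>)"
  shows "eventually (\<lambda>n. l < ln (stay_prob n) / (ln (real n))\<^sup>2) sequentially"
proof -
  obtain m0 c p where c: "0 < c" "0 < p" "1 \<le> m0" and bound:
    "\<And>J. p * (\<Prod>j<J. c * real (geometric_grid \<rho> m0 j) powr - (q - 1)) \<le> stay_prob (geometric_grid \<rho> m0 J)"
    by (rule stay_prob_lower[OF q \<rho>]) (rule that; assumption)
  define g where "g = geometric_grid \<rho> m0"
  define K where "K = real m0 + 1 / (\<rho> - 1)"
  have K: "0 < K" using c(3) \<rho> by (simp add: K_def add_nonneg_pos)
  have g: "0 < real (g j)" for j using geometric_grid_pos(2)[OF \<rho>(1) c(3), of j] by (simp add: g_def)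
  have q0: "0 < q - 1" using q alpha by simp
  show ?thesis
  proof (rule log_square_rate_lower[OF stay_prob_pos stay_prob_antimono \<rho>(1) _ _ l, where m=g
        and u="ln c - (q - 1) * ln K + (q - 1) * ln \<rho> / 2" and w="ln p"])
    fix j
    have "1 * \<rho> ^ j \<le> real m0 * \<rho> ^ j" using c(3) \<rho> by (intro mult_right_mono) auto
    then show "\<rho> ^ j \<le> real (g j)" using geometric_grid_ge[OF \<rho>(1), of m0 j] by (simp add: g_def)
  next
    fix J
    have t: "ln c - (q - 1) * ln K - (q - 1) * ln \<rho> * real j \<le> ln (c * real (g j) powr - (q - 1))" for j
    proof -
      have "ln (real (g j)) \<le> ln (K * \<rho> ^ j)"
        using geometric_grid_le[OF \<rho>(1), of m0 j] g[of j] by (intro ln_mono) (auto simp: g_def K_def)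
      also have "\<dots> = ln K + real j * ln \<rho>" using K \<rho> by (simp add: ln_mult ln_realpow)
      finally have "(q - 1) * ln (real (g j)) \<le> (q - 1) * (ln K + real j * ln \<rho>)"
        using q0 by (intro mult_left_mono) auto
      then show ?thesis using c g[of j] by (simp add: ln_mult ln_powr algebra_simps)
    qed
    have pos: "0 < (\<Prod>j<J. c * real (g j) powr - (q - 1))" using c g by (intro prod_pos) (auto simp: less_imp_neq[OF g, symmetric])
    have "real J * (ln c - (q - 1) * ln K + (q - 1) * ln \<rho> / 2) + ln p - (q - 1) * ln \<rho> * (real J)\<^sup>2 / 2
        = ln p + (real J * (ln c - (q - 1) * ln K) - (q - 1) * ln \<rho> * ((real J)\<^sup>2 / 2 - real J / 2))"
      by (simp add: field_simps)
    also have "\<dots> = ln p + (\<Sum>j<J. ln c - (q - 1) * ln K - (q - 1) * ln \<rho> * real j)"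
      unfolding sum_subtractf[of "\<lambda>_. ln c - (q - 1) * ln K"] sum_distrib_left[symmetric] sum_real_lessThan by simp
    also have "\<dots> \<le> ln p + (\<Sum>j<J. ln (c * real (g j) powr - (q - 1)))"
      by (intro add_left_mono sum_mono t)
    also have "(\<Sum>j<J. ln (c * real (g j) powr - (q - 1))) = ln (\<Prod>j<J. c * real (g j) powr - (q - 1))"
      using c g by (intro ln_prod[symmetric]) (auto simp: less_imp_neq[OF g, symmetric])
    also have "ln p + \<dots> = ln (p * (\<Prod>j<J. c * real (g j) powr - (q - 1)))"
      by (rule ln_mult_pos[OF c(2) pos, symmetric])
    also have "\<dots> \<le> ln (stay_prob (g J))"
      using bound[of J] c(2) pos unfolding g_def[symmetric] by (intro ln_mono mult_pos_pos) auto
    finally show "real J * (ln c - (q - 1) * ln K + (q - 1) * ln \<rho> / 2) + ln p - (q - 1) * ln \<rho> * (real J)\<^sup>2 / 2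
      \<le> ln (stay_prob (g J))" .
  qed
qed

text \<open>
The exponents $q = \alpha \mp d$ and ratios $R e^{\pm d}$ give one-sided bounds that converge to the
asserted limit as $d$ tends to $0$.
\<close>

lemma stay_prob_rate:
  "(\<lambda>n. ln (stay_prob n) / (ln (real n))\<^sup>2) \<longlonglongrightarrow> - (\<alpha> - 1) / (2 * ln (max_radial_ratio A))"
proof (rule order_tendstoI)
  define R where "R = max_radial_ratio A"
  have R: "1 < R" unfolding R_def by (rule max_radial_ratio_gt_1[OF A(1,4,3)])
  then have lnR: "0 < ln R" by simp
  fix l
  have lim: "((\<lambda>d. - (\<alpha> - 1 - s * d) / (2 * (ln R + s * d))) \<longlongrightarrow> - (\<alpha> - 1 - s * 0) / (2 * (ln R + s * 0))) (at_right 0)" for s :: real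
    using lnR by (intro tendsto_intros) auto
  have ev: "eventually (\<lambda>d::real. d \<in> {0<..<min (\<alpha> - 1) (ln R)}) (at_right 0)"
    using alpha lnR by (intro eventually_at_right_real) auto
  {
    assume "- (\<alpha> - 1) / (2 * ln (max_radial_ratio A)) < l"
    then have "- (\<alpha> - 1 - 1 * 0) / (2 * (ln R + 1 * 0)) < l" by (simp add: R_def)
    from eventually_conj[OF order_tendstoD(2)[OF lim this] ev]
    obtain d where d: "- (\<alpha> - 1 - 1 * d) / (2 * (ln R + 1 * d)) < l" "0 < d" "d < \<alpha> - 1"
      using eventually_happens[of _ "at_right (0::real)"] by auto
    show "eventually (\<lambda>n. ln (stay_prob n) / (ln (real n))\<^sup>2 < l) sequentially"
    proof (rule stay_prob_rate_upper[of "\<alpha> - d" "R * exp d"])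
      have "R * 1 < R * exp d" using R d by (intro mult_strict_left_mono) auto
      then show "max_radial_ratio A < R * exp d" by (simp add: R_def)
      show "- (\<alpha> - d - 1) / (2 * ln (R * exp d)) < l" using d R by (simp add: ln_mult algebra_simps)
    qed (use d in auto)
  next
    assume "l < - (\<alpha> - 1) / (2 * ln (max_radial_ratio A))"
    then have "l < - (\<alpha> - 1 - (- 1) * 0) / (2 * (ln R + (- 1) * 0))" by (simp add: R_def)
    from eventually_conj[OF order_tendstoD(1)[OF lim this] ev]
    obtain d where d: "l < - (\<alpha> - 1 - (- 1) * d) / (2 * (ln R + (- 1) * d))" "0 < d" "d < ln R"
      using eventually_happens[of _ "at_right (0::real)"] by auto
    show "eventually (\<lambda>n. l < ln (stay_prob n) / (ln (real n))\<^sup>2) sequentially"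
    proof (rule stay_prob_rate_lower[of "\<alpha> + d" "R * exp (- d)"])
      have "R * exp (- d) < R * 1" using R d by (intro mult_strict_left_mono) auto
      then show "R * exp (- d) < max_radial_ratio A" by (simp add: R_def)
      have "1 < exp (ln R + - d)" using d by simp
      also have "\<dots> = R * exp (- d)" unfolding exp_add using R by simp
      finally show "1 < R * exp (- d)" .
      show "l < - (\<alpha> + d - 1) / (2 * ln (R * exp (- d)))" using d R by (simp add: ln_mult algebra_simps)
    qed (use d in auto)
  }
qed

end

theorem theorem2p1:
  fixes M :: "'w measure"
    and X :: "nat \<Rightarrow> 'w \<Rightarrow> real^'d"
    and \<alpha> :: real
    and \<mu> :: "(ereal^'d) measure"
    and \<sigma> :: "(real^'d) measure"
    and A :: "(real^'d) set"
  assumes "CARD('d) \<ge> 2"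
    and "prob_space M"
    and "prob_space.indep_vars M (\<lambda>_. borel) X {1..}"
    and "\<forall>i\<ge>1. distr M borel (X i) = distr M borel (X 1)"
    and "\<alpha> > 1"
    and "regularly_varying M (X 1) \<alpha> \<mu>"
    and "has_bochner_integral M (X 1) 0"
    and "angular_measure \<alpha> \<mu> \<sigma>"
    and "absolutely_continuous sphere_surface_measure \<sigma>"
    and "\<forall>U. openin (top_of_set (sphere 0 1)) U \<and> U \<noteq> {} \<longrightarrow> emeasure \<sigma> U > 0"
    and "compact A" and "convex A" and "interior A \<noteq> {}" and "0 \<notin> A"
    and "measure M {\<omega> \<in> space M. X 1 \<omega> \<in> interior A} > 0"
  shows "(\<lambda>n. ln (measure M {\<omega> \<in> space M.
              \<forall>k\<in>{1..n}. (\<Sum>i=1..k. X i \<omega>) /\<^sub>R real k \<in> A}) / (ln (real n))\<^sup>2)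
           \<longlonglongrightarrow> - (\<alpha> - 1) / (2 * ln (max_radial_ratio A))"
proof -
  interpret prob_space M by fact
  interpret iid_vectors M X
  proof unfold_locales
    show "indep_vars (\<lambda>_. borel) X {1..}" by (rule assms(3))
    show "distr M borel (X i) = distr M borel (X 1)" if "1 \<le> i" for i using assms(4) that by blast
  qed
  have X1[measurable]: "X 1 \<in> borel_measurable M" by simp
  have alpha: "0 < \<alpha>" using assms(5) by simp
  have pos: "0 < emeasure \<sigma> U" if "openin (top_of_set (sphere 0 1)) U" "U \<noteq> {}" for U
    using assms(10) that by blast
  obtain a :: "nat \<Rightarrow> real" and c where a: "incseq a" "\<And>n. 0 < a n" "filterlim a at_top sequentially" "0 < c"
    and norms: "\<And>s. 0 < s \<Longrightarrow> (\<lambda>n. real n * prob {\<omega> \<in> space M. a n * s < norm (X 1 \<omega>)}) \<longlonglongrightarrow> c * s powr - \<alpha>"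
    and balls: "\<And>v e. v \<noteq> 0 \<Longrightarrow> 0 < e \<Longrightarrow> \<exists>e' m. 0 < e' \<and> e' < e \<and> 0 < m \<and>
       (\<lambda>n. real n * prob {\<omega> \<in> space M. X 1 \<omega> /\<^sub>R a n \<in> ball v e'}) \<longlonglongrightarrow> m"
    by (rule regularly_varying_norm_and_ball_limits[OF assms(2) X1 alpha assms(6,8) pos])
      (assumption, assumption, (rule that; assumption))
  have tail: "regular_tail (\<lambda>t. prob {\<omega> \<in> space M. t < norm (X 1 \<omega>)}) a c \<alpha>"
  proof
    show "prob {\<omega> \<in> space M. t < norm (X 1 \<omega>)} \<le> prob {\<omega> \<in> space M. s < norm (X 1 \<omega>)}" if "s \<le> t" for s t
      using that by (intro finite_measure_mono) auto
  qed (use a alpha norms in auto)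
  interpret centered_regular_walk M X \<alpha> A
  proof
    show "integrable M (X 1)" "expectation (X 1) = 0"
      using assms(7) by (auto simp: has_bochner_integral_iff)
    show "\<exists>C. \<forall>t>0. prob {\<omega> \<in> space M. t < norm (X 1 \<omega>)} \<le> C * t powr - q" if "1 < q" "q < \<alpha>" for q
    proof -
      have "0 < q" using that by simp
      obtain C where "\<And>t. 0 < t \<Longrightarrow> prob {\<omega> \<in> space M. t < norm (X 1 \<omega>)} \<le> C * t powr - q"
        by (rule regular_tail.upper_power_bound[OF tail \<open>0 < q\<close> \<open>q < \<alpha>\<close>]) (rule that)
      then show ?thesis by blast
    qed
    show "\<exists>b>0. \<exists>T>0. \<forall>t\<ge>T. b * t powr - q \<le> prob {\<omega> \<in> space M. X 1 \<omega> \<in> ball (t *\<^sub>R v) (t * e)}"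
      if q: "\<alpha> < q" and e: "0 < e" for q v e
      by (rule ball_prob_power_bound[OF X1 tail balls q e, of v]) (assumption, assumption, blast)
  qed (use assms in auto)
  show ?thesis using stay_prob_rate unfolding stay_prob_def walk_def .
qed

end
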